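(* Assume $\mathrm{char}(\mathbb F)=0$ and $0\ne h\in R=\mathbb F[x]$. Let $\mathcal N=\mathrm{span}_{\mathbb F}\{\mathrm{ad}_{ra_n}\mid r\in R\,\pi_{(h/\pi_h)},\ n\ge0\}\subseteq \mathsf{HH}^1(A_h)$. Then: (a) $\mathsf Z(\mathsf{HH}^1(A_h))\oplus\mathcal N$ is the unique maximal nilpotent ideal of $\mathsf{HH}^1(A_h)$. (b) $\mathsf{HH}^1(A_h)$ is a nilpotent Lie algebra if and only if $\frac{h}{\pi_h}\in\mathbb F^*$. (c) If $\frac{h}{\pi_h}\in\mathbb F^*$, then $\pi_{(h/\pi_h)}=1$, which implies $[\mathsf{HH}^1(A_h),\mathsf{HH}^1(A_h)]=0=\mathcal N$ and $\mathsf{HH}^1(A_h)\cong\{D_g\mid g\in R,\ \deg g<\deg\pi_h=\deg h\}$, an abelian Lie algebra of dimension $\deg h$.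
   Context: $\mathbb F$ is a field, $R=\mathbb F[x]$, $0\ne h\in R$. The Weyl algebra $A_1$ is the unital associative $\mathbb F$-algebra with generators $x,y$ and relation $yx-xy=1$. $A_h$ is the unital associative $\mathbb F$-algebra with generators $x,\hat y$ and relation $\hat yx-x\hat y=h$; it is identified with the subalgebra of $A_1$ generated by $x$ and $\hat y=yh$. $\mathsf{HH}^1(A_h)=\mathrm{Der}_{\mathbb F}(A_h)/\mathrm{Inder}_{\mathbb F}(A_h)$ (derivations modulo inner derivations, as a Lie algebra); $\mathsf Z(\cdot)$ is the center; derivations and their images in $\mathsf{HH}^1(A_h)$ are denoted by the same symbol. For $g\in R$, $D_g$ is the derivation of $A_h$ with $D_g(x)=0$, $D_g(\hat y)=g$. For $0\neq f\in R$, $\pi_f\in R$ is the unique monic polynomial such that for all $r\in R$: $f\mid f'r\iff \pi_f\mid r$ (in characteristic 0, the product of the distinct monic prime factors of $f$; $1$ if $f$ is constant); $\pi_{(h/\pi_h)}$ is this polynomial for $f=h/\pi_h$. Put $a_n=\pi_hh^{n-1}y^n$ for $n\ge 0$, where $a_0=\pi_hh^{-1}$ lies in the localization $A_1\Sigma^{-1}$, $\Sigma=\{h^m\mid m\ge0\}$. With $\mathrm{ad}_u(v)=uv-vu$, each $\mathrm{ad}_{ra_n}$ ($r\in R$, $n\ge0$) maps $A_h$ to itself and is regarded as a derivation of $A_h$. $\deg 0=-\infty$. *)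

theory Defs
  imports
    "HOL-Library.Poly_Mapping"
    "HOL-Computational_Algebra.Polynomial"
    "HOL-Algebra.QuotRing"
    "Jordan_Normal_Form.VS_Connect"
begin

section \<open>Algebras presented by generators and relations\<close>

text \<open>
  The ground field is a type \<open>'a\<close> of class field; \<open>class_ring\<close> is this field as a ring record.
  An algebra over it is a record of type \<open>('a, 'b) module\<close> whose field \<open>mult\<close> holds the product.
  Lie algebras are records of the same type, with the Lie bracket in the field \<open>mult\<close> and
  an unused field \<open>one\<close>.
\<close>

datatype 'g free_word = Word (letters: "'g list")

instantiation free_word :: (type) monoid_add
begin
definition zero_free_word :: "'a free_word" where "0 = Word []"
definition plus_free_word :: "'a free_word \<Rightarrow> 'a free_word \<Rightarrow> 'a free_word"
  where "u + v = Word (letters u @ letters v)"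
instance by standard (simp_all add: zero_free_word_def plus_free_word_def)
end

text \<open>
  The free unital associative algebra on \<open>'g\<close> is the monoid algebra of the (additively
  written) monoid of words; its product is the convolution product of \<open>Poly_Mapping\<close>.
\<close>

type_synonym ('g, 'a) free_alg = "'g free_word \<Rightarrow>\<^sub>0 'a"

definition fvar :: "'g \<Rightarrow> ('g, 'a::field) free_alg" where
  "fvar g = Poly_Mapping.single (Word [g]) 1"

definition fconst :: "'a::field \<Rightarrow> ('g, 'a) free_alg" where
  "fconst c = Poly_Mapping.single 0 c"

definition fpoly :: "'a::field poly \<Rightarrow> ('g, 'a) free_alg \<Rightarrow> ('g, 'a) free_alg" where
  "fpoly p u = (\<Sum>i\<le>degree p. fconst (coeff p i) * u ^ i)"

definition free_algebra :: "('a::field, ('g, 'a) free_alg) module" where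
  "free_algebra = \<lparr>carrier = UNIV, mult = (*), one = 1, zero = 0, add = (+),
     smult = (\<lambda>c u. fconst c * u)\<rparr>"

text \<open>Used for ideals of associative algebras and for ideals of Lie algebras alike.\<close>

definition quot_alg :: "('a, 'b) module \<Rightarrow> 'b set \<Rightarrow> ('a, 'b set) module" where
  "quot_alg A I = \<lparr>carrier = a_rcosets\<^bsub>A\<^esub> I, mult = rcoset_mult A I,
     one = I +>\<^bsub>A\<^esub> \<one>\<^bsub>A\<^esub>, zero = I, add = set_add A,
     smult = (\<lambda>c U. \<Union>u\<in>U. I +>\<^bsub>A\<^esub> (c \<odot>\<^bsub>A\<^esub> u))\<rparr>"

definition rel_ideal :: "('g, 'a::field) free_alg set \<Rightarrow> ('g, 'a) free_alg set" where
  "rel_ideal S = genideal free_algebra S"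

definition presented :: "('g, 'a::field) free_alg set \<Rightarrow> ('a, ('g, 'a) free_alg set) module" where
  "presented S = quot_alg free_algebra (rel_ideal S)"

definition cls :: "('g, 'a::field) free_alg set \<Rightarrow> ('g, 'a) free_alg \<Rightarrow> ('g, 'a) free_alg set" where
  "cls S u = rel_ideal S +>\<^bsub>free_algebra\<^esub> u"

definition alg_hom :: "('a::field, 'b) module \<Rightarrow> ('a, 'c) module \<Rightarrow> ('b \<Rightarrow> 'c) set" where
  "alg_hom A B = Ring.ring_hom A B \<inter> LinearCombinations.module_hom class_ring A B"


section \<open>Derivations and the first Hochschild cohomology\<close>

text \<open>Linear maps on a carrier are kept extensional, so that equality of derivations is equality
  on the carrier.\<close>

definition derivations :: "('a::field, 'b) module \<Rightarrow> ('b \<Rightarrow> 'b) set" where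
  "derivations A = {D \<in> carrier A \<rightarrow>\<^sub>E carrier A. D \<in> LinearCombinations.module_hom class_ring A A \<and>
     (\<forall>u\<in>carrier A. \<forall>v\<in>carrier A.
        D (u \<otimes>\<^bsub>A\<^esub> v) = (D u \<otimes>\<^bsub>A\<^esub> v) \<oplus>\<^bsub>A\<^esub> (u \<otimes>\<^bsub>A\<^esub> D v))}"

definition Der :: "('a::field, 'b) module \<Rightarrow> ('a, 'b \<Rightarrow> 'b) module" where
  "Der A = \<lparr>carrier = derivations A,
     mult = (\<lambda>D E. \<lambda>u\<in>carrier A. D (E u) \<ominus>\<^bsub>A\<^esub> E (D u)),
     one = undefined,
     zero = (\<lambda>u\<in>carrier A. \<zero>\<^bsub>A\<^esub>),
     add = (\<lambda>D E. \<lambda>u\<in>carrier A. D u \<oplus>\<^bsub>A\<^esub> E u),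
     smult = (\<lambda>c D. \<lambda>u\<in>carrier A. c \<odot>\<^bsub>A\<^esub> D u)\<rparr>"

definition ad :: "('a::field, 'b) module \<Rightarrow> 'b \<Rightarrow> 'b \<Rightarrow> 'b" where
  "ad A u = (\<lambda>v\<in>carrier A. (u \<otimes>\<^bsub>A\<^esub> v) \<ominus>\<^bsub>A\<^esub> (v \<otimes>\<^bsub>A\<^esub> u))"

definition Inder :: "('a::field, 'b) module \<Rightarrow> ('b \<Rightarrow> 'b) set" where
  "Inder A = ad A ` carrier A"

definition HH1 :: "('a::field, 'b) module \<Rightarrow> ('a, ('b \<Rightarrow> 'b) set) module" where
  "HH1 A = quot_alg (Der A) (Inder A)"

definition HH1_class :: "('a::field, 'b) module \<Rightarrow> ('b \<Rightarrow> 'b) \<Rightarrow> ('b \<Rightarrow> 'b) set" where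
  "HH1_class A D = Inder A +>\<^bsub>Der A\<^esub> D"


section \<open>Lie algebras\<close>

abbreviation lspan :: "('a::field, 'b) module \<Rightarrow> 'b set \<Rightarrow> 'b set" where
  "lspan L \<equiv> LinearCombinations.module.span class_ring L"

definition lie_center :: "('a::field, 'b) module \<Rightarrow> 'b set" where
  "lie_center L = {z \<in> carrier L. \<forall>x\<in>carrier L. z \<otimes>\<^bsub>L\<^esub> x = \<zero>\<^bsub>L\<^esub>}"

definition lie_subalgebra :: "('a::field, 'b) module \<Rightarrow> 'b set \<Rightarrow> bool" where
  "lie_subalgebra L S \<longleftrightarrow> VectorSpace.subspace class_ring S L \<and> (\<forall>u\<in>S. \<forall>v\<in>S. u \<otimes>\<^bsub>L\<^esub> v \<in> S)"

definition lie_ideal :: "('a::field, 'b) module \<Rightarrow> 'b set \<Rightarrow> bool" where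
  "lie_ideal L I \<longleftrightarrow> VectorSpace.subspace class_ring I L \<and> (\<forall>x\<in>carrier L. \<forall>u\<in>I. x \<otimes>\<^bsub>L\<^esub> u \<in> I)"

definition lie_commutator :: "('a::field, 'b) module \<Rightarrow> 'b set \<Rightarrow> 'b set \<Rightarrow> 'b set" where
  "lie_commutator L U V = lspan L {u \<otimes>\<^bsub>L\<^esub> v | u v. u \<in> U \<and> v \<in> V}"

primrec lower_central :: "('a::field, 'b) module \<Rightarrow> 'b set \<Rightarrow> nat \<Rightarrow> 'b set" where
  "lower_central L S 0 = S"
| "lower_central L S (Suc n) = lie_commutator L S (lower_central L S n)"

definition lie_nilpotent :: "('a::field, 'b) module \<Rightarrow> 'b set \<Rightarrow> bool" where
  "lie_nilpotent L S \<longleftrightarrow> (\<exists>n. lower_central L S n = {\<zero>\<^bsub>L\<^esub>})"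

definition lie_abelian :: "('a::field, 'b) module \<Rightarrow> bool" where
  "lie_abelian L \<longleftrightarrow> (\<forall>u\<in>carrier L. \<forall>v\<in>carrier L. u \<otimes>\<^bsub>L\<^esub> v = \<zero>\<^bsub>L\<^esub>)"

definition nilpotent_ideal :: "('a::field, 'b) module \<Rightarrow> 'b set \<Rightarrow> bool" where
  "nilpotent_ideal L I \<longleftrightarrow> lie_ideal L I \<and> lie_nilpotent L I"

definition maximal_nilpotent_ideal :: "('a::field, 'b) module \<Rightarrow> 'b set \<Rightarrow> bool" where
  "maximal_nilpotent_ideal L I \<longleftrightarrow>
     nilpotent_ideal L I \<and> (\<forall>J. nilpotent_ideal L J \<and> I \<subseteq> J \<longrightarrow> J = I)"

definition lie_isomorphic :: "('a::field, 'b) module \<Rightarrow> ('a, 'c) module \<Rightarrow> bool" where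
  "lie_isomorphic L M \<longleftrightarrow> (\<exists>f \<in> LinearCombinations.module_hom class_ring L M. bij_betw f (carrier L) (carrier M) \<and>
     (\<forall>u\<in>carrier L. \<forall>v\<in>carrier L. f (u \<otimes>\<^bsub>L\<^esub> v) = f u \<otimes>\<^bsub>M\<^esub> f v))"


section \<open>The algebras \<open>A\<^sub>h\<close>\<close>

definition pi_poly :: "'a::field poly \<Rightarrow> 'a poly" where
  "pi_poly f = (THE p. lead_coeff p = 1 \<and> (\<forall>r. f dvd pderiv f * r \<longleftrightarrow> p dvd r))"

datatype Ah_gen = Ah_x | Ah_y

definition Ah_rels :: "'a::field poly \<Rightarrow> (Ah_gen, 'a) free_alg set" where
  "Ah_rels h = {fvar Ah_y * fvar Ah_x - fvar Ah_x * fvar Ah_y - fpoly h (fvar Ah_x)}"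

definition Ah :: "'a::field poly \<Rightarrow> ('a, (Ah_gen, 'a) free_alg set) module" where
  "Ah h = presented (Ah_rels h)"

definition D_der :: "'a::field poly \<Rightarrow> 'a poly \<Rightarrow> (Ah_gen, 'a) free_alg set \<Rightarrow> (Ah_gen, 'a) free_alg set"
  where "D_der h g = (THE D. D \<in> derivations (Ah h) \<and>
     D (cls (Ah_rels h) (fvar Ah_x)) = \<zero>\<^bsub>Ah h\<^esub> \<and>
     D (cls (Ah_rels h) (fvar Ah_y)) = cls (Ah_rels h) (fpoly g (fvar Ah_x)))"

text \<open>
  The localization of the Weyl algebra at the powers of \<open>h\<close>: the presentation of the Weyl algebra
  by \<open>x\<close>, \<open>y\<close> and \<open>y x - x y = 1\<close>, with a two-sided inverse of \<open>h\<close> adjoined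
  (the universal algebra inverting the Ore set of powers of \<open>h\<close>, i.e. the Ore localization).
\<close>

datatype Wloc_gen = W_x | W_y | W_hinv

definition Wloc_rels :: "'a::field poly \<Rightarrow> (Wloc_gen, 'a) free_alg set" where
  "Wloc_rels h = {fvar W_y * fvar W_x - fvar W_x * fvar W_y - 1,
     fpoly h (fvar W_x) * fvar W_hinv - 1, fvar W_hinv * fpoly h (fvar W_x) - 1}"

definition Wloc :: "'a::field poly \<Rightarrow> ('a, (Wloc_gen, 'a) free_alg set) module" where
  "Wloc h = presented (Wloc_rels h)"

text \<open>The identification of \<open>A\<^sub>h\<close> with the subalgebra generated by \<open>x\<close> and \<open>y h\<close>.\<close>

definition Ah_embed :: "'a::field poly \<Rightarrow> (Ah_gen, 'a) free_alg set \<Rightarrow> (Wloc_gen, 'a) free_alg set"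
  where "Ah_embed h = (THE f. f \<in> alg_hom (Ah h) (Wloc h) \<and> f \<in> extensional (carrier (Ah h)) \<and>
     f (cls (Ah_rels h) (fvar Ah_x)) = cls (Wloc_rels h) (fvar W_x) \<and>
     f (cls (Ah_rels h) (fvar Ah_y)) = cls (Wloc_rels h) (fvar W_y * fpoly h (fvar W_x)))"

text \<open>The element \<open>r a\<^sub>n\<close>, where \<open>a\<^sub>n = \<pi>\<^sub>h h\<^sup>n\<^sup>-\<^sup>1 y\<^sup>n\<close>.\<close>

definition ra_elem :: "'a::field poly \<Rightarrow> 'a poly \<Rightarrow> nat \<Rightarrow> (Wloc_gen, 'a) free_alg set" where
  "ra_elem h r n = cls (Wloc_rels h) (fpoly r (fvar W_x) * fpoly (pi_poly h) (fvar W_x) *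
     (case n of 0 \<Rightarrow> fvar W_hinv | Suc m \<Rightarrow> fpoly h (fvar W_x) ^ m * fvar W_y ^ n))"

text \<open>The derivation of \<open>A\<^sub>h\<close> obtained by restricting \<open>ad\<close> of \<open>r a\<^sub>n\<close> to the image of \<open>A\<^sub>h\<close>.\<close>

definition ad_ra :: "'a::field poly \<Rightarrow> 'a poly \<Rightarrow> nat \<Rightarrow> (Ah_gen, 'a) free_alg set \<Rightarrow> (Ah_gen, 'a) free_alg set"
  where "ad_ra h r n = (\<lambda>u\<in>carrier (Ah h).
     inv_into (carrier (Ah h)) (Ah_embed h) (ad (Wloc h) (ra_elem h r n) (Ah_embed h u)))"

definition calN :: "'a::field poly \<Rightarrow> ((Ah_gen, 'a) free_alg set \<Rightarrow> (Ah_gen, 'a) free_alg set) set set" where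
  "calN h = lspan (HH1 (Ah h))
     {HH1_class (Ah h) (ad_ra h r n) | r n. pi_poly (h div pi_poly h) dvd r}"

text \<open>The first disjunct covers \<open>deg 0 = -\<infinity>\<close>; in the library the zero polynomial has degree 0.\<close>

definition D_space :: "'a::field poly \<Rightarrow> ((Ah_gen, 'a) free_alg set \<Rightarrow> (Ah_gen, 'a) free_alg set) set" where
  "D_space h = {D_der h g | g. g = 0 \<or> degree g < degree (pi_poly h)}"

end

theory Submission
  imports "HOL-Computational_Algebra.Formal_Laurent_Series"
    "HOL-Computational_Algebra.Polynomial_FPS" Defs
begin

text \<open>
  Write \<open>q = h / \<pi>\<^sub>h\<close>. Everything rests on one explicit description of \<open>HH\<^sup>1(A\<^sub>h)\<close>.

  The algebras are realised by differential operators whose coefficients lie in a field \<open>K\<close> of Laurent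
  series containing \<open>F[x]\<close>. A polynomial \<open>p = \<Sum> p\<^sub>n Y\<^sup>n\<close> over \<open>K\<close> is the symbol of the operator
  \<open>\<Sum> p\<^sub>n h\<^sup>n \<partial>\<^sup>n\<close>; in this normalisation \<open>A\<^sub>h\<close> (with \<open>y h = \<partial> h\<close>) consists of the operators whose symbols
  have polynomial coefficients, and \<open>r a\<^sub>n\<close> has the symbol \<open>(r/q) Y\<^sup>n\<close>. The series are taken at a point
  where \<open>h\<close> does not vanish, so every \<open>g/h\<close> has an antiderivative in \<open>K\<close> and \<open>D\<^sub>g\<close> becomes a commutator
  with an element of \<open>K\<close>. In characteristic 0 all derivations of \<open>A\<^sub>h\<close> are then commutators with
  operators that normalise \<open>A\<^sub>h\<close> (\<open>derivation_is_\<delta>\<close>). The normaliser is given by the symbols with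
  \<open>p\<^sub>n \<in> q\<^sup>-\<^sup>1 F[x]\<close> for \<open>n \<ge> 1\<close> and \<open>h p\<^sub>0' \<in> F[x]\<close> (\<open>Mc_iff\<close>), and modulo \<open>A\<^sub>h\<close> the commutator of two
  such operators is the Poisson bracket \<open>{p, s} = h (p\<^sub>Y s\<^sub>x - p\<^sub>x s\<^sub>Y)\<close> of their symbols, because the terms
  of higher order in the product formula have polynomial symbols (\<open>commutator_Mc\<close>). So \<open>HH\<^sup>1(A\<^sub>h)\<close> is the
  Poisson algebra of normaliser symbols modulo polynomial symbols, and the rest is commutative algebra.

  The centre consists of the symbols with \<open>p\<^sub>n \<in> F[x]\<close> for \<open>n \<ge> 1\<close> and \<open>\<pi>\<^sub>h p\<^sub>0' \<in> F[x]\<close> (\<open>center_eq\<close>). It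
  meets the span of all \<open>r a\<^sub>n\<close> trivially, because differentiating a pole of \<open>r/q\<close> raises its order and the
  squarefree \<open>\<pi>\<^sub>h\<close> cannot make up for a pole of order two (\<open>Zc_Nf_inter\<close>), and together they span everything,
  because a first order differential equation can be solved modulo \<open>q\<close> (\<open>Mc_decomposition\<close>). The bracket of
  \<open>r a\<^sub>m\<close> and \<open>s a\<^sub>n\<close> is a multiple of \<open>a\<^sub>m\<^sub>+\<^sub>n\<^sub>-\<^sub>1\<close> whose coefficient is divisible by \<open>\<pi>\<^sub>q\<^sup>i\<^sup>+\<^sup>j\<close> if \<open>\<pi>\<^sub>q\<^sup>i\<close> divides
  \<open>r\<close> and \<open>\<pi>\<^sub>q\<^sup>j\<close> divides \<open>s\<close>. As \<open>q\<close> divides a power of \<open>\<pi>\<^sub>q\<close>, the ideal \<open>Z + N\<close> is nilpotent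
  (\<open>nilpotent_ZN\<close>).

  It contains every nilpotent ideal. Modulo a prime \<open>P\<close> dividing \<open>q\<close>, the bracket of \<open>r a\<^sub>m\<close> and \<open>s a\<^sub>n\<close> is
  \<open>(m - n) r s\<close> times a unit times \<open>a\<^sub>m\<^sub>+\<^sub>n\<^sub>-\<^sub>1\<close>, as in a Witt algebra. An ideal with an element outside
  \<open>Z + N\<close> has one whose coefficients do not all vanish modulo some such \<open>P\<close>. Brackets with \<open>D\<^sub>1\<close>, which acts
  as \<open>d/dY\<close>, bring it to the form \<open>r a\<^sub>0\<close> with \<open>r\<close> prime to \<open>P\<close>; a bracket with \<open>a\<^sub>2\<close> gives an element
  with leading term \<open>a\<^sub>1\<close>, and that element acts on the first one without ever killing it
  (\<open>not_nilpotent_if_meets_V\<close>). The same argument applied to the whole algebra shows that it is not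
  nilpotent when \<open>q\<close> is not constant. When \<open>q\<close> is constant only the classes of the \<open>D\<^sub>g\<close> remain, with \<open>g\<close>
  determined modulo \<open>h\<close>.
\<close>

section \<open>The polynomial \<open>\<pi>\<^sub>f\<close>\<close>

text \<open>
  The multipliers \<open>r\<close> with \<open>f dvd f' r\<close> form an ideal of \<open>F[x]\<close> that contains \<open>f\<close>; a nonzero element of
  least degree generates it.
\<close>

lemma ex1_pi_poly:
  fixes f :: "'a::field poly"
  assumes "f \<noteq> 0"
  shows "\<exists>!p. lead_coeff p = 1 \<and> (\<forall>r. f dvd pderiv f * r \<longleftrightarrow> p dvd r)"
proof (rule ex_ex1I)
  let ?S = "\<lambda>r. f dvd pderiv f * r \<and> r \<noteq> 0"
  obtain r0 where r0: "?S r0" and min: "\<And>r. ?S r \<Longrightarrow> degree r0 \<le> degree r"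
    using ex_has_least_nat[of ?S f degree] assms by auto
  define p where "p = Polynomial.smult (inverse (lead_coeff r0)) r0"
  have lc: "lead_coeff p = 1" and dp: "degree p = degree r0" "p \<noteq> 0" using r0 by (auto simp: p_def)
  have fp: "f dvd pderiv f * p" using r0 by (simp add: p_def dvd_smult)
  have "p dvd r" if "f dvd pderiv f * r" for r
  proof -
    have "f dvd pderiv f * r - pderiv f * p * (r div p)" using that fp by (meson dvd_diff dvd_mult2)
    also have "pderiv f * r - pderiv f * p * (r div p) = pderiv f * (r mod p)"
      by (simp add: minus_div_mult_eq_mod[symmetric] algebra_simps)
    finally have "r mod p = 0" using min[of "r mod p"] degree_mod_less[OF dp(2), of r] dp(1)
      by (metis not_le)
    then show ?thesis by auto
  qed
  moreover have "f dvd pderiv f * r" if "p dvd r" for r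
    using fp mult_dvd_mono[OF dvd_refl that, of "pderiv f"] by (rule dvd_trans)
  ultimately show "\<exists>p. lead_coeff p = 1 \<and> (\<forall>r. f dvd pderiv f * r \<longleftrightarrow> p dvd r)" using lc by blast
next
  fix p p' assume *: "lead_coeff p = 1 \<and> (\<forall>r. f dvd pderiv f * r \<longleftrightarrow> p dvd r)"
    "lead_coeff p' = 1 \<and> (\<forall>r. f dvd pderiv f * r \<longleftrightarrow> p' dvd r)"
  then have "p dvd p'" "p' dvd p" "lead_coeff p = 1" "lead_coeff p' = 1" using dvd_refl by blast+
  moreover from this obtain k where k: "p' = p * k" by blast
  ultimately have "lead_coeff k = 1" "degree p = degree p'"
    by (auto simp: lead_coeff_mult intro!: antisym dvd_imp_degree_le)
  moreover have "degree k = 0" using calculation k \<open>lead_coeff p' = 1\<close>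
    by (metis add_cancel_right_right degree_mult_eq leading_coeff_0_iff mult_not_zero zero_neq_one)
  ultimately have "k = 1" by (auto elim!: degree_eq_zeroE)
  then show "p = p'" using k by simp
qed

lemma lead_coeff_pi_poly: "f \<noteq> 0 \<Longrightarrow> lead_coeff (pi_poly f) = 1"
  and dvd_pderiv_mult_iff: "f \<noteq> 0 \<Longrightarrow> f dvd pderiv f * r \<longleftrightarrow> pi_poly f dvd r"
  for f :: "'a::field poly"
proof -
  assume "f \<noteq> 0"
  from theI'[OF ex1_pi_poly[OF this], folded pi_poly_def]
  show "lead_coeff (pi_poly f) = 1" "f dvd pderiv f * r \<longleftrightarrow> pi_poly f dvd r" by blast+
qed

lemma pi_poly_nonzero: "f \<noteq> 0 \<Longrightarrow> pi_poly f \<noteq> 0" for f :: "'a::field poly"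
  using lead_coeff_pi_poly by force

lemma dvd_pderiv_mult_pi_poly: "f \<noteq> 0 \<Longrightarrow> f dvd pderiv f * pi_poly f" for f :: "'a::field poly"
  by (simp add: dvd_pderiv_mult_iff)

lemma pi_poly_dvd_self: "f \<noteq> 0 \<Longrightarrow> pi_poly f dvd f" for f :: "'a::field poly"
  using dvd_pderiv_mult_iff[of f f] by simp

lemma irreducible_degree_pos:
  fixes p :: "'a::field poly"
  assumes "irreducible p" shows "degree p > 0"
  using assms is_unit_iff_degree[of p] by (auto simp: irreducible_def)

lemma ex_irreducible_factor:
  fixes f :: "'a::field poly"
  assumes "degree f > 0"
  obtains p where "irreducible p" "p dvd f"
proof -
  let ?S = "\<lambda>b. b dvd f \<and> degree b > 0"
  obtain p where p: "?S p" and min: "\<And>b. ?S b \<Longrightarrow> degree p \<le> degree b"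
    using ex_has_least_nat[of ?S f degree] assms by auto
  have "irreducible p"
  proof (rule irreducibleI)
    show "p \<noteq> 0" using p by auto
    then show "\<not> is_unit p" using p by (simp add: is_unit_iff_degree)
  next
    fix a b assume ab: "p = a * b"
    then have nz: "a \<noteq> 0" "b \<noteq> 0" using p by auto
    have "degree p = degree a + degree b" using ab nz by (simp add: degree_mult_eq)
    moreover have "a dvd f" "b dvd f" using ab p by (auto intro: dvd_trans)
    ultimately show "is_unit a \<or> is_unit b" using min[of a] min[of b] p nz
      by (auto simp: is_unit_iff_degree)
  qed
  then show thesis using that p by blast
qed

text \<open>
  A divisor of \<open>q\<close> of largest degree with the property \<open>P\<close> must be \<open>q\<close> up to a unit, since otherwise
  another prime factor could be moved into it. This serves as a substitute for valuations at the
  primes. The scalar in the conclusion is there because factorisations are unique only up to units.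
\<close>

lemma divisor_chain_induct [consumes 1, case_names scale step]:
  fixes q :: "'a::field poly"
  assumes "q \<noteq> 0"
    and scale: "\<And>c. c \<noteq> 0 \<Longrightarrow> P [:c:]"
    and step: "\<And>b p. irreducible p \<Longrightarrow> b * p dvd q \<Longrightarrow> P b \<Longrightarrow> P (b * p)"
  shows "\<exists>c. c \<noteq> 0 \<and> P (Polynomial.smult c q)"
proof -
  let ?S = "\<lambda>b. b dvd q \<and> P b"
  have "?S [:1:]" using scale[of 1] by (auto simp: one_pCons[symmetric] intro: one_dvd)
  then obtain b where b: "?S b" and max: "\<And>y. ?S y \<Longrightarrow> degree y \<le> degree b"
    using ex_has_greatest_nat[of ?S "[:1:]" degree "Suc (degree q)"] dvd_imp_degree_le[OF _ assms(1)]
    by (auto simp: less_Suc_eq_le)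
  then obtain c where c: "q = b * c" by blast
  have "degree c = 0"
  proof (rule ccontr)
    assume "degree c \<noteq> 0"
    then obtain p where p: "irreducible p" "p dvd c" using ex_irreducible_factor[of c] by auto
    have "degree p > 0" using p(1) by (rule irreducible_degree_pos)
    moreover have "b * p dvd q" using p c by (simp add: mult_dvd_mono)
    ultimately show False using max[of "b * p"] step[OF p(1) _ conjunct2[OF b]] b p assms(1) c
      by (auto simp: degree_mult_eq)
  qed
  then obtain c' where c': "c = [:c':]" by (rule degree_eq_zeroE)
  then have "c' \<noteq> 0" using c assms(1) by auto
  then have "Polynomial.smult (inverse c') q = b" using c c' by simp
  then show ?thesis using b \<open>c' \<noteq> 0\<close> by (metis inverse_nonzero_iff_nonzero)
qed

lemma dvd_by_divisor_chain:
  fixes q :: "'a::field poly"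
  assumes "q \<noteq> 0" and step: "\<And>b p. irreducible p \<Longrightarrow> b * p dvd q \<Longrightarrow> b dvd r \<Longrightarrow> b * p dvd r"
  shows "q dvd r"
proof -
  have "[:c:] dvd r" if "c \<noteq> 0" for c
    by (rule unit_imp_dvd) (use that in \<open>simp add: is_unit_iff_degree\<close>)
  then obtain c where "c \<noteq> 0" "Polynomial.smult c q dvd r"
    using divisor_chain_induct[of q "\<lambda>b. b dvd r", OF assms(1) _ step] by auto
  then show ?thesis by (blast dest: smult_dvd_cancel)
qed

text \<open>
  This turns non-divisibility by a squarefree polynomial into non-divisibility by one of its primes.
\<close>

lemma squarefree_dvd:
  fixes s :: "'a::field poly"
  assumes "s \<noteq> 0" and sqf: "\<And>p. irreducible p \<Longrightarrow> \<not> p\<^sup>2 dvd s"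
    and primes: "\<And>p. irreducible p \<Longrightarrow> p dvd s \<Longrightarrow> p dvd r"
  shows "s dvd r"
proof (rule dvd_by_divisor_chain[OF assms(1)])
  fix b p :: "'a poly" assume *: "irreducible p" "b * p dvd s" "b dvd r"
  have pr: "prime_elem p" using *(1) by (rule field_poly_irreducible_imp_prime)
  obtain t where t: "r = b * t" using *(3) by blast
  have "\<not> p dvd b"
  proof
    assume "p dvd b"
    then have "p\<^sup>2 dvd b * p" unfolding power2_eq_square by (rule mult_dvd_mono) simp
    then show False using sqf[OF *(1)] *(2) dvd_trans by blast
  qed
  moreover have "p dvd b * t" using primes[OF *(1)] *(2) t by (auto dest: dvd_mult_right)
  ultimately have "p dvd t" using pr by (simp add: prime_elem_dvd_mult_iff)
  then show "b * p dvd r" using t by (simp add: mult_dvd_mono)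
qed

lemma extract_prime_power:
  fixes f :: "'a::field poly"
  assumes "irreducible p" "f \<noteq> 0"
  obtains e g where "f = p ^ e * g" "\<not> p dvd g"
proof -
  have "\<exists>e g. f = p ^ e * g \<and> \<not> p dvd g" using assms(2)
  proof (induction "degree f" arbitrary: f rule: less_induct)
    case less
    show ?case
    proof (cases "p dvd f")
      case True
      then obtain f1 where f1: "f = p * f1" by blast
      have "degree p > 0" using assms(1) by (rule irreducible_degree_pos)
      then have "degree f1 < degree f" using f1 less.prems by (auto simp: degree_mult_eq)
      then obtain e g where "f1 = p ^ e * g" "\<not> p dvd g" using less f1 by fastforce
      then have "f = p ^ Suc e * g \<and> \<not> p dvd g" using f1 by simp
      then show ?thesis by blast
    next
      case False
      then show ?thesis by (intro exI[of _ 0] exI[of _ f]) simp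
    qed
  qed
  then show thesis using that by blast
qed

lemma irreducible_not_dvd_pderiv:
  fixes p :: "'a::field_char_0 poly"
  assumes "irreducible p" shows "\<not> p dvd pderiv p"
proof
  assume "p dvd pderiv p"
  moreover have "degree p > 0" using assms by (rule irreducible_degree_pos)
  ultimately show False
    using dvd_imp_degree_le[of p "pderiv p"] by (auto simp: degree_pderiv pderiv_eq_0_iff)
qed

lemma prime_power_cancel:
  fixes p :: "'a::field poly"
  assumes "prime_elem p" "\<not> p dvd g" "g dvd p * x" shows "g dvd x"
proof -
  obtain k where k: "p * x = g * k" using assms(3) by blast
  then have "p dvd k" using assms by (metis dvd_triv_left prime_elem_dvd_mult_iff)
  then obtain k' where "k = p * k'" by blast
  then have "x = g * k'" using k assms(1) by (simp add: prime_elem_def mult.left_commute)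
  then show ?thesis by simp
qed

lemma pderiv_prime_power_mult:
  "pderiv (p ^ Suc e * g) = p ^ e * (of_nat (Suc e) * pderiv p * g + p * pderiv g)"
  for p :: "'a::field_char_0 poly"
  by (simp only: pderiv_mult[of "p ^ Suc e" g] pderiv_power_Suc)
     (simp add: of_nat_poly algebra_simps del: of_nat_Suc)

text \<open>
  Write \<open>f = p\<^sup>e\<^sup>+\<^sup>1 g\<close> with \<open>g\<close> prime to \<open>p\<close>. After division by \<open>p\<^sup>e\<close> the derivative of \<open>f\<close> is
  \<open>(e + 1) p' g\<close> modulo \<open>p\<close>, which is nonzero in characteristic 0; so a factor \<open>p\<close> has to come
  from \<open>\<pi>\<^sub>f\<close>.
\<close>

lemma irreducible_dvd_pi_poly:
  fixes f :: "'a::field_char_0 poly"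
  assumes p: "irreducible p" and "p dvd f" "f \<noteq> 0"
  shows "p dvd pi_poly f"
proof -
  have pr: "prime_elem p" using p by (rule field_poly_irreducible_imp_prime)
  obtain e0 g where e0: "f = p ^ e0 * g" and g: "\<not> p dvd g" using extract_prime_power[OF p assms(3)] .
  then obtain e where e: "e0 = Suc e" using assms(2) by (cases e0) auto
  have "p ^ e * (p * g) dvd p ^ e * ((of_nat (Suc e) * pderiv p * g + p * pderiv g) * pi_poly f)"
    using dvd_pderiv_mult_pi_poly[OF assms(3)] unfolding e0 e pderiv_prime_power_mult
    by (simp add: mult.assoc mult.left_commute)
  then have "p * g dvd (of_nat (Suc e) * pderiv p * g + p * pderiv g) * pi_poly f"
    using pr by (subst (asm) dvd_times_left_cancel_iff) auto
  then have "p dvd (of_nat (Suc e) * pderiv p * g + p * pderiv g) * pi_poly f"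
    by (rule dvd_mult_left)
  also have "\<dots> = of_nat (Suc e) * pderiv p * g * pi_poly f + p * (pderiv g * pi_poly f)"
    by (simp only: algebra_simps)
  finally have "p dvd of_nat (Suc e) * pderiv p * g * pi_poly f + p * (pderiv g * pi_poly f)" .
  then have "p dvd of_nat (Suc e) * (pderiv p * g * pi_poly f)"
    using dvd_add_left_iff[OF dvd_triv_left[of p "pderiv g * pi_poly f"]] by (simp add: mult.assoc)
  then have "p dvd pderiv p * g * pi_poly f"
    unfolding of_nat_poly by (auto simp del: of_nat_Suc dest!: dvd_smult_cancel)
  then show ?thesis using pr g irreducible_not_dvd_pderiv[OF p] by (simp add: prime_elem_dvd_mult_iff)
qed

text \<open>
  If \<open>\<pi>\<^sub>f = p\<^sup>2 t\<close>, then already \<open>p t\<close> is a multiplier as in the definition of \<open>\<pi>\<^sub>f\<close>.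
\<close>

lemma pi_poly_squarefree:
  fixes f :: "'a::field_char_0 poly"
  assumes p: "irreducible p" and "f \<noteq> 0"
  shows "\<not> p\<^sup>2 dvd pi_poly f"
proof
  assume "p\<^sup>2 dvd pi_poly f"
  then obtain t where "pi_poly f = p\<^sup>2 * t" by (rule dvdE)
  then have t: "pi_poly f = p * (p * t)" by (simp only: power2_eq_square mult.assoc)
  have pr: "prime_elem p" using p by (rule field_poly_irreducible_imp_prime)
  obtain e0 g where e0: "f = p ^ e0 * g" and g: "\<not> p dvd g" using extract_prime_power[OF p assms(2)] .
  note cancel = prime_power_cancel[OF pr g]
  have "f dvd pderiv f * (p * t)"
  proof (cases e0)
    case 0
    then have "g dvd p * (pderiv f * (p * t))"
      using dvd_pderiv_mult_pi_poly[OF assms(2)] unfolding t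
        by (simp add: e0 mult.left_commute)
    from cancel[OF this] show ?thesis using 0 e0 by simp
  next
    case (Suc e)
    let ?k = "of_nat (Suc e) * pderiv p * g + p * pderiv g"
    have "p ^ e * (p * g) dvd p ^ e * (?k * pi_poly f)"
      using dvd_pderiv_mult_pi_poly[OF assms(2)] unfolding e0 Suc pderiv_prime_power_mult
      by (simp add: mult.assoc mult.left_commute)
    then have "p * g dvd ?k * pi_poly f"
      using pr by (subst (asm) dvd_times_left_cancel_iff) auto
    then have "g dvd ?k * (p * (p * t))" unfolding t by (rule dvd_mult_right)
    also have "?k * (p * (p * t))
        = g * (of_nat (Suc e) * pderiv p * p * p * t) + p * (p * (p * (pderiv g * t)))"
      by (simp only: algebra_simps)
    finally have "g dvd p * (p * (p * (pderiv g * t)))" using dvd_add_right_iff dvd_triv_left by blast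
    then have "g dvd pderiv g * t" using cancel by blast
    then have "p * g dvd p * (g * (of_nat (Suc e) * pderiv p * t) + p * (pderiv g * t))"
      by (intro mult_dvd_mono dvd_add) auto
    also have "p * (g * (of_nat (Suc e) * pderiv p * t) + p * (pderiv g * t)) = ?k * (p * t)"
      by (simp only: algebra_simps)
    finally have "p ^ e * (p * g) dvd p ^ e * (?k * (p * t))" by (rule mult_dvd_mono[OF dvd_refl])
    then show ?thesis unfolding e0 Suc pderiv_prime_power_mult
      by (simp add: mult.assoc mult.left_commute)
  qed
  then have "p * (p * t) dvd p * t" using dvd_pderiv_mult_iff[OF assms(2)] t by simp
  moreover have "p * t \<noteq> 0" using t pi_poly_nonzero[OF assms(2)] by auto
  ultimately have "is_unit p" using dvd_times_right_cancel_iff[of "p * t" p 1] by simp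
  then show False using p by (simp add: irreducible_def)
qed

lemma pi_poly_dvd_mono:
  fixes f :: "'a::field_char_0 poly"
  assumes "b dvd f" "f \<noteq> 0" shows "pi_poly b dvd pi_poly f"
proof -
  have b: "b \<noteq> 0" using assms by auto
  show ?thesis
  proof (rule squarefree_dvd)
    show "pi_poly b \<noteq> 0" using b by (rule pi_poly_nonzero)
    show "\<not> p\<^sup>2 dvd pi_poly b" if "irreducible p" for p using that b by (rule pi_poly_squarefree)
    show "p dvd pi_poly f" if "irreducible p" "p dvd pi_poly b" for p
      using irreducible_dvd_pi_poly[OF that(1) _ assms(2)]
        dvd_trans[OF dvd_trans[OF that(2) pi_poly_dvd_self[OF b]] assms(1)] by blast
  qed
qed

lemma divisor_dvd_pi_poly_mult_pderiv:
  fixes f :: "'a::field_char_0 poly"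
  assumes "b dvd f" "f \<noteq> 0" shows "b dvd pderiv b * pi_poly f"
proof -
  have "b \<noteq> 0" using assms by auto
  then show ?thesis using pi_poly_dvd_mono[OF assms] dvd_pderiv_mult_iff by blast
qed

lemma dvd_pi_poly_power:
  fixes q :: "'a::field_char_0 poly"
  assumes "q \<noteq> 0" shows "\<exists>k. q dvd pi_poly q ^ k"
proof -
  have "[:c:] dvd r" if "c \<noteq> 0" for c :: 'a and r
    by (rule unit_imp_dvd) (use that in \<open>simp add: is_unit_iff_degree\<close>)
  moreover have "\<exists>k. b * p dvd pi_poly q ^ k"
    if "irreducible p" "b * p dvd q" "\<exists>k. b dvd pi_poly q ^ k" for b p
  proof -
    have "p dvd pi_poly q" using irreducible_dvd_pi_poly[OF that(1) dvd_mult_right[OF that(2)] assms] .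
    moreover from that(3) obtain k where "b dvd pi_poly q ^ k" by blast
    ultimately have "b * p dvd pi_poly q ^ k * pi_poly q" by (intro mult_dvd_mono)
    then have "b * p dvd pi_poly q ^ Suc k" by (simp only: power_Suc2)
    then show ?thesis by blast
  qed
  ultimately obtain c where "c \<noteq> 0" "\<exists>k. Polynomial.smult c q dvd pi_poly q ^ k"
    using divisor_chain_induct[of q "\<lambda>b. \<exists>k. b dvd pi_poly q ^ k", OF assms] by auto
  then show ?thesis by (blast dest: smult_dvd_cancel)
qed

text \<open>
  The quotient \<open>k\<close> is \<open>\<pi>\<^sub>f\<close> times the logarithmic derivative of \<open>c\<close>. If \<open>p\<close> divided it, \<open>\<pi>\<^sub>f / p\<close> would
  still be a multiple of \<open>\<pi>\<^sub>c\<close> and hence of \<open>p\<close>, but \<open>\<pi>\<^sub>f\<close> is squarefree.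
\<close>

lemma log_pderiv_unit:
  fixes f :: "'a::field_char_0 poly"
  assumes "irreducible p" "p dvd c" "c dvd f" "f \<noteq> 0" and k: "pi_poly f * pderiv c = c * k"
  shows "\<not> p dvd k"
proof
  assume "p dvd k"
  then obtain t where t: "k = p * t" by blast
  have c: "c \<noteq> 0" using assms by auto
  have "p dvd pi_poly f" using irreducible_dvd_pi_poly[OF assms(1) dvd_trans[OF assms(2,3)] assms(4)] .
  then obtain u where u: "pi_poly f = p * u" by blast
  have "p * (pderiv c * u) = p * (c * t)" using k t u by (simp add: algebra_simps)
  then have "c dvd pderiv c * u" using assms(1) by (auto simp: irreducible_def)
  then have "pi_poly c dvd u" using dvd_pderiv_mult_iff[OF c] by blast
  with irreducible_dvd_pi_poly[OF assms(1,2) c] have "p dvd u" by (rule dvd_trans)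
  then have "p\<^sup>2 dvd pi_poly f" unfolding u power2_eq_square by (rule mult_dvd_mono[OF dvd_refl])
  then show False using pi_poly_squarefree[OF assms(1,4)] by blast
qed

text \<open>
  The hypothesis says that \<open>\<pi>\<^sub>h (r/q)'\<close> is a polynomial, the conclusion that \<open>r/q\<close> is one: a pole of
  order \<open>j\<close> of \<open>r/q\<close> gives a pole of order \<open>j + 1\<close> of the derivative, and \<open>\<pi>\<^sub>h\<close> lowers the order by
  one only.
\<close>

lemma dvd_if_wronskian_dvd:
  fixes h :: "'a::field_char_0 poly"
  assumes "q dvd h" "h \<noteq> 0" and main: "q * q dvd pi_poly h * (pderiv r * q - r * pderiv q)"
  shows "q dvd r"
proof (rule dvd_by_divisor_chain)
  show "q \<noteq> 0" using assms by auto
  fix b p assume p: "irreducible p" and bp: "b * p dvd q" and "b dvd r"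
  then obtain s where s: "r = b * s" by blast
  obtain c' where c': "q = b * p * c'" using bp by blast
  define c where "c = p * c'"
  have q: "q = b * c" by (simp add: c' c_def mult.assoc)
  have nz: "b \<noteq> 0" "c \<noteq> 0" using \<open>q \<noteq> 0\<close> q by auto
  have ch: "c dvd h" using assms(1) unfolding q by (rule dvd_mult_right)
  obtain k where k: "pi_poly h * pderiv c = c * k"
    using divisor_dvd_pi_poly_mult_pderiv[OF ch assms(2)] by (auto simp: dvd_def mult.commute)
  have "pi_poly h * (pderiv r * q - r * pderiv q)
      = (b * b * c) * (pi_poly h * pderiv s) - (b * b) * s * (pi_poly h * pderiv c)"
    unfolding s q pderiv_mult by (simp add: algebra_simps)
  also have "\<dots> = (b * b * c) * (pi_poly h * pderiv s - s * k)"
    unfolding k by (simp add: algebra_simps)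
  finally have "(b * b * c) * c dvd (b * b * c) * (pi_poly h * pderiv s - s * k)"
    using main unfolding q by (simp only: mult_ac)
  then have "c dvd pi_poly h * pderiv s - s * k" using nz by (simp add: dvd_times_left_cancel_iff)
  then have "p dvd pi_poly h * pderiv s - s * k" unfolding c_def by (rule dvd_mult_left)
  moreover have pc: "p dvd c" by (simp add: c_def)
  have "p dvd pi_poly h * pderiv s"
    using irreducible_dvd_pi_poly[OF p dvd_trans[OF pc ch] assms(2)] by (rule dvd_mult2)
  ultimately have "p dvd s * k" using dvd_diff_right_iff by blast
  moreover have "\<not> p dvd k" using log_pderiv_unit[OF p pc ch assms(2) k] .
  ultimately have "p dvd s" using field_poly_irreducible_imp_prime[OF p]
    by (simp add: prime_elem_dvd_mult_iff)
  then show "b * p dvd r" using s by (simp add: mult_dvd_mono)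
qed

text \<open>
  A nonzero combination of \<open>k\<close> and \<open>p\<close> of least degree divides both, so it is a unit.
\<close>

lemma bezout_irreducible:
  fixes p :: "'a::field poly"
  assumes "irreducible p" "\<not> p dvd k"
  obtains s where "p dvd u - s * k"
proof -
  let ?S = "\<lambda>m. m \<noteq> 0 \<and> (\<exists>s t. m = s * k + t * p)"
  have "p = 0 * k + 1 * p" by simp
  then have "?S p" using assms(1) unfolding irreducible_def by blast
  then obtain m where m: "?S m" and min: "\<And>m'. ?S m' \<Longrightarrow> degree m \<le> degree m'"
    using ex_has_least_nat[of ?S p degree] by blast
  obtain s t where st: "m = s * k + t * p" using m by blast
  have dvd: "m dvd a * k + b * p" for a b
  proof (rule ccontr)
    assume "\<not> m dvd a * k + b * p"
    then have nz: "(a * k + b * p) mod m \<noteq> 0" by (simp add: dvd_eq_mod_eq_0)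
    let ?c = "(a * k + b * p) div m"
    have "(a * k + b * p) mod m = a * k + b * p - ?c * m" by (simp add: minus_div_mult_eq_mod)
    also have "\<dots> = (a - ?c * s) * k + (b - ?c * t) * p" unfolding st by (simp add: algebra_simps)
    finally have "?S ((a * k + b * p) mod m)" using nz by blast
    then have "degree m \<le> degree ((a * k + b * p) mod m)" by (rule min)
    moreover have "degree ((a * k + b * p) mod m) < degree m" using m nz degree_mod_less[of m] by blast
    ultimately show False by simp
  qed
  have "m dvd p" "m dvd k" using dvd[of 0 1] dvd[of 1 0] by simp_all
  obtain c where c: "p = m * c" using \<open>m dvd p\<close> by blast
  have "is_unit m"
  proof (rule ccontr)
    assume "\<not> is_unit m"
    then have "is_unit c" using assms(1) c by (auto simp: irreducible_def)
    then have "p dvd m" unfolding c by simp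
    then show False using \<open>m dvd k\<close> assms(2) dvd_trans by blast
  qed
  then obtain m' where m': "m * m' = 1" by (metis dvd_def)
  have "u - (u * m' * s) * k = u * (m * m') - u * m' * s * k" using m' by simp
  also have "\<dots> = p * (u * m' * t)" unfolding st by (simp add: algebra_simps)
  finally have "p dvd u - (u * m' * s) * k" by simp
  then show thesis by (rule that)
qed

lemma ex_pderiv_eq:
  fixes p :: "'a::field_char_0 poly"
  obtains r where "pderiv r = p" "coeff r 0 = 0"
proof -
  have pderiv_sum: "pderiv (sum f A) = (\<Sum>x\<in>A. pderiv (f x))" for f :: "nat \<Rightarrow> 'a poly" and A
    by (induction A rule: infinite_finite_induct) (simp_all add: pderiv_add)
  define r where "r = (\<Sum>i\<le>degree p. monom (coeff p i / of_nat (Suc i)) (Suc i))"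
  have "pderiv r = (\<Sum>i\<le>degree p. monom (coeff p i) i)"
    by (simp add: r_def pderiv_sum pderiv_monom del: of_nat_Suc)
  moreover have "coeff r 0 = 0" by (simp add: r_def coeff_sum)
  ultimately show thesis using that by (simp add: poly_as_sum_of_monoms)
qed

section \<open>Differential operators over a differential field\<close>

text \<open>
  The map \<open>\<iota>\<close> embeds \<open>F[x]\<close> into a differential field \<open>(K, d)\<close>. The elements \<open>\<mu> f\<close> (multiplication by
  \<open>f\<close>) and \<open>dy\<close> (the derivation itself) generate a ring of operators. By the last two assumptions
  \<open>g/h\<close> has an antiderivative in \<open>K\<close> for every polynomial \<open>g\<close>, and \<open>K\<close> has no new constants; this is
  what makes \<open>D\<^sub>g\<close> a commutator with an element of \<open>K\<close>.
\<close>

locale weyl_calculus =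
  fixes d :: "'k::field_char_0 \<Rightarrow> 'k"
    and \<iota> :: "'a::field_char_0 poly \<Rightarrow> 'k"
    and \<mu> :: "'k \<Rightarrow> 'e::ring_1"
    and dy :: 'e
    and h :: "'a poly"
  assumes d_add: "d (x + y) = d x + d y"
    and d_mult: "d (x * y) = d x * y + x * d y"
    and \<iota>_add: "\<iota> (p + q) = \<iota> p + \<iota> q"
    and \<iota>_mult: "\<iota> (p * q) = \<iota> p * \<iota> q"
    and \<iota>_1: "\<iota> 1 = 1"
    and \<iota>_inj: "\<iota> p = 0 \<Longrightarrow> p = 0"
    and d_\<iota>: "d (\<iota> p) = \<iota> (pderiv p)"
    and \<mu>_add: "\<mu> (x + y) = \<mu> x + \<mu> y"
    and \<mu>_mult: "\<mu> (x * y) = \<mu> x * \<mu> y"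
    and \<mu>_1: "\<mu> 1 = 1"
    and \<mu>_inj: "\<mu> x = 0 \<Longrightarrow> x = 0"
    and dy_\<mu>: "dy * \<mu> x = \<mu> x * dy + \<mu> (d x)"
    and h_nonzero: "h \<noteq> 0"
    and antiderivative: "\<exists>w. \<iota> h * d w = \<iota> g"
    and d_eq_0: "d w = 0 \<Longrightarrow> \<exists>c. w = \<iota> [:c:]"
begin

lemma d_0 [simp]: "d 0 = 0" using d_add[of 0 0] by simp
lemma \<iota>_0 [simp]: "\<iota> 0 = 0" using \<iota>_add[of 0 0] by simp
lemma \<mu>_0 [simp]: "\<mu> 0 = 0" using \<mu>_add[of 0 0] by simp
lemma d_1 [simp]: "d 1 = 0" using d_mult[of 1 1] by simp
lemma d_uminus: "d (- x) = - d x" using d_add[of x "- x"] by (simp add: eq_neg_iff_add_eq_0 add.commute)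
lemma \<iota>_uminus: "\<iota> (- x) = - \<iota> x" using \<iota>_add[of x "- x"] by (simp add: eq_neg_iff_add_eq_0 add.commute)
lemma \<mu>_uminus: "\<mu> (- x) = - \<mu> x" using \<mu>_add[of x "- x"] by (simp add: eq_neg_iff_add_eq_0 add.commute)
lemma d_diff: "d (x - y) = d x - d y" using d_add[of x "- y"] by (simp add: d_uminus)
lemma \<iota>_diff: "\<iota> (x - y) = \<iota> x - \<iota> y" using \<iota>_add[of x "- y"] by (simp add: \<iota>_uminus)
lemma \<mu>_diff: "\<mu> (x - y) = \<mu> x - \<mu> y" using \<mu>_add[of x "- y"] by (simp add: \<mu>_uminus)
lemma \<iota>_eq_iff: "\<iota> p = \<iota> q \<longleftrightarrow> p = q" using \<iota>_inj[of "p - q"] by (auto simp: \<iota>_diff)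
lemma \<iota>_eq_0_iff: "\<iota> p = 0 \<longleftrightarrow> p = 0" using \<iota>_eq_iff[of p 0] by simp
lemma \<mu>_of_nat: "\<mu> (of_nat n) = of_nat n" by (induction n) (simp_all add: \<mu>_add \<mu>_1)
lemma \<iota>_of_nat: "\<iota> (of_nat n) = of_nat n" by (induction n) (simp_all add: \<iota>_add \<iota>_1)
lemma d_of_nat [simp]: "d (of_nat n) = 0" by (induction n) (simp_all add: d_add)
lemma d_power: "d (x ^ n) = of_nat n * x ^ (n - 1) * d x"
proof (induction n)
  case (Suc n) then show ?case by (cases n) (simp_all add: d_mult algebra_simps)
qed simp

lemma d_inverse: "x \<noteq> 0 \<Longrightarrow> d (inverse x) = - d x * inverse x ^ 2"
  using d_mult[of x "inverse x"] by (simp add: field_simps power2_eq_square eq_neg_iff_add_eq_0)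

definition H :: 'k where "H = \<iota> h"
definition Pi :: 'k where "Pi = \<iota> (pi_poly h)"
definition q :: "'a poly" where "q = h div pi_poly h"
definition Q :: 'k where "Q = \<iota> q"

lemma h_eq: "h = q * pi_poly h"
  using pi_poly_dvd_self[OF h_nonzero] by (simp add: q_def)
lemma q_nonzero: "q \<noteq> 0" using h_eq h_nonzero by auto
lemma q_dvd_h: "q dvd h" using h_eq by (metis dvd_triv_left)
lemma H_eq: "H = Q * Pi" unfolding H_def Q_def Pi_def using h_eq \<iota>_mult by metis
lemma H_nonzero: "H \<noteq> 0" and Q_nonzero: "Q \<noteq> 0" and Pi_nonzero: "Pi \<noteq> 0"
  using h_nonzero q_nonzero pi_poly_nonzero[OF h_nonzero] by (auto simp: H_def Q_def Pi_def \<iota>_eq_0_iff)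

lemma q_dvd_pderiv_h: "q dvd pderiv h"
proof -
  have "q * pi_poly h dvd pderiv h * pi_poly h" using dvd_pderiv_mult_pi_poly[OF h_nonzero] h_eq by simp
  then show ?thesis using pi_poly_nonzero[OF h_nonzero] by simp
qed

definition R :: "'k set" where "R = range \<iota>"

lemma \<iota>_in_R [simp]: "\<iota> p \<in> R" by (simp add: R_def)
lemma R_0 [simp]: "0 \<in> R" using \<iota>_in_R[of 0] by simp
lemma R_1 [simp]: "1 \<in> R" using \<iota>_in_R[of 1] by (simp add: \<iota>_1)
lemma H_in_R [simp]: "H \<in> R" by (simp add: H_def)
lemma R_of_nat [simp]: "of_nat n \<in> R" using \<iota>_in_R[of "of_nat n"] by (simp add: \<iota>_of_nat)
lemma R_add: "x \<in> R \<Longrightarrow> y \<in> R \<Longrightarrow> x + y \<in> R" by (auto simp: R_def \<iota>_add[symmetric])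
lemma R_mult: "x \<in> R \<Longrightarrow> y \<in> R \<Longrightarrow> x * y \<in> R" by (auto simp: R_def \<iota>_mult[symmetric])
lemma R_uminus: "x \<in> R \<Longrightarrow> - x \<in> R" by (auto simp: R_def \<iota>_uminus[symmetric])
lemma R_diff: "x \<in> R \<Longrightarrow> y \<in> R \<Longrightarrow> x - y \<in> R" by (auto simp: R_def \<iota>_diff[symmetric])
lemma R_d: "x \<in> R \<Longrightarrow> d x \<in> R" by (auto simp: R_def d_\<iota>)
lemma R_power: "x \<in> R \<Longrightarrow> x ^ n \<in> R" by (induction n) (simp_all add: R_mult)
lemma R_sum: "(\<And>x. x \<in> A \<Longrightarrow> f x \<in> R) \<Longrightarrow> sum f A \<in> R"
  by (induction A rule: infinite_finite_induct) (simp_all add: R_add)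
lemma inverse_of_nat_in_R: assumes "n \<ge> 1" shows "1 / of_nat n \<in> R"
proof -
  have "\<iota> [:1 / of_nat n:] * of_nat n = 1"
    unfolding \<iota>_of_nat[symmetric] \<iota>_mult[symmetric] using assms
    by (simp add: of_nat_poly \<iota>_1 one_pCons[symmetric])
  then have "1 / of_nat n = \<iota> [:1 / of_nat n:]" using assms by (simp add: field_simps)
  then show ?thesis by simp
qed
lemma R_div_of_nat: "of_nat n * x \<in> R \<Longrightarrow> n \<ge> 1 \<Longrightarrow> x \<in> R"
  using R_mult[OF inverse_of_nat_in_R, of n "of_nat n * x"] by simp
lemma \<iota>_div_in_R: "p \<noteq> 0 \<Longrightarrow> \<iota> r / \<iota> p \<in> R \<longleftrightarrow> p dvd r"
proof
  assume "p \<noteq> 0" "\<iota> r / \<iota> p \<in> R"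
  then obtain s where "\<iota> r = \<iota> (p * s)" by (auto simp: R_def \<iota>_mult field_simps \<iota>_eq_0_iff)
  then show "p dvd r" by (simp add: \<iota>_eq_iff)
next
  assume "p \<noteq> 0" "p dvd r"
  then show "\<iota> r / \<iota> p \<in> R" by (auto simp: \<iota>_mult \<iota>_eq_0_iff elim!: dvdE)
qed

text \<open>
  The fractional ideal \<open>h\<^sup>j F[x]\<close>.
\<close>

definition J :: "int \<Rightarrow> 'k set" where "J j = {x. x * H powi (- j) \<in> R}"

lemma powi_add: "H powi (i + j) = H powi i * H powi j"
  using H_nonzero by (simp add: power_int_add)
lemma powi_cancel: "H powi j * H powi (- j) = 1" "H powi (- j) * H powi j = 1"
  by (simp_all add: powi_add[symmetric])

lemma J_0_iff: "x \<in> J 0 \<longleftrightarrow> x \<in> R" by (simp add: J_def)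
lemma J_zero [simp]: "0 \<in> J j" by (simp add: J_def)
lemma J_add: "x \<in> J j \<Longrightarrow> y \<in> J j \<Longrightarrow> x + y \<in> J j" by (simp add: J_def ring_distribs R_add)
lemma J_diff: "x \<in> J j \<Longrightarrow> y \<in> J j \<Longrightarrow> x - y \<in> J j" by (simp add: J_def ring_distribs R_diff)
lemma J_mult: assumes "x \<in> J i" "y \<in> J j" shows "x * y \<in> J (i + j)"
proof -
  have "x * y * H powi (- (i + j)) = (x * H powi (- i)) * (y * H powi (- j))"
    unfolding minus_add_distrib powi_add by (simp only: mult_ac)
  moreover have "\<dots> \<in> R" using assms by (auto simp: J_def intro: R_mult[of "x * H powi (- i)"])
  ultimately show ?thesis by (simp only: J_def mem_Collect_eq)
qed
lemma H_power_in_J: "H ^ n \<in> J (int n)" using H_nonzero by (simp add: J_def power_int_minus)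
lemma J_antimono: assumes "x \<in> J j" "i \<le> j" shows "x \<in> J i"
proof -
  have "x * H powi (- i) = (x * H powi (- j)) * H powi (j - i)"
    unfolding mult.assoc powi_add[symmetric] by simp
  moreover have "H powi (j - i) = H ^ nat (j - i)" using assms(2) by (simp add: power_int_def)
  ultimately have "x * H powi (- i) = (x * H powi (- j)) * H ^ nat (j - i)" by (simp only:)
  moreover have "\<dots> \<in> R" using assms(1) R_mult[OF _ R_power[OF H_in_R]] by (auto simp: J_def)
  ultimately show ?thesis by (simp only: J_def mem_Collect_eq)
qed
lemma J_R_mult: "c \<in> R \<Longrightarrow> x \<in> J j \<Longrightarrow> c * x \<in> J j"
  using J_mult[of c 0 x j] by (simp add: J_0_iff)

lemma d_powi: "d (H powi j) = of_int j * H powi (j - 1) * d H"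
proof (cases "j \<ge> 0")
  case True
  then obtain n where n: "j = int n" using nonneg_int_cases by blast
  show ?thesis
  proof (cases n)
    case (Suc m)
    then have "j - 1 = int m" using n by simp
    then have "H powi (j - 1) = H ^ m" by (simp only: power_int_of_nat)
    moreover have "H powi j = H ^ Suc m" unfolding n Suc by (rule power_int_of_nat)
    ultimately show ?thesis using d_power[of H "Suc m"] unfolding n Suc
      by (simp del: of_nat_Suc power_Suc)
  qed (simp add: n)
next
  case False
  define n where "n = nat (- j)"
  have n: "j = - int n" using False by (simp add: n_def)
  have "d (H powi j) = - d (H ^ n) * inverse (H ^ n) ^ 2"
    using H_nonzero unfolding n power_int_minus by (simp add: d_inverse power_int_of_nat)
  also have "\<dots> = of_int j * H powi (j - 1) * d H"
  proof -
    obtain m where m: "n = Suc m" using False n by (cases n) auto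
    have "j - 1 = - int (Suc n)" using n by simp
    then have "H powi (j - 1) = inverse (H ^ Suc n)" by (simp only: power_int_minus power_int_of_nat)
    moreover have "(of_int j :: 'k) = - of_nat n" using n by simp
    moreover have "d (H ^ n) = of_nat n * H ^ m * d H" using d_power[of H n] m by simp
    ultimately show ?thesis using H_nonzero unfolding m
      by (simp add: field_simps power2_eq_square del: of_nat_Suc)
  qed
  finally show ?thesis .
qed

lemma J_elim: assumes "x \<in> J j" obtains r where "r \<in> R" "x = r * H powi j"
proof -
  have "x = (x * H powi (- j)) * H powi j" by (simp add: mult.assoc powi_cancel)
  then show thesis using that assms by (auto simp: J_def)
qed
lemma J_intro: "r \<in> R \<Longrightarrow> r * H powi j \<in> J j"
  by (simp add: J_def mult.assoc powi_cancel)

lemma d_H: "d H = \<iota> (pderiv h)" by (simp add: H_def d_\<iota>)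

lemma J_d: assumes "x \<in> J j" shows "d x \<in> J (j - 1)"
proof -
  obtain r where r: "r \<in> R" "x = r * H powi j" using J_elim[OF assms] .
  have "d x = d r * H powi j + (of_int j * r * d H) * H powi (j - 1)"
    unfolding r(2) d_mult d_powi by (simp add: algebra_simps)
  moreover have "(of_int j :: 'k) \<in> R" by (cases j) (simp_all add: R_uminus R_diff)
  then have "(of_int j * r * d H) * H powi (j - 1) \<in> J (j - 1)"
    using r(1) by (intro J_intro R_mult) (simp_all add: d_H)
  moreover have "d r * H powi j \<in> J (j - 1)" using J_antimono[OF J_intro[OF R_d[OF r(1)]]] by simp
  ultimately show ?thesis by (simp add: J_add)
qed

lemma Pi_d_H: "\<exists>k\<in>R. Pi * d H = H * k"
proof -
  obtain k where "pderiv h * pi_poly h = h * k" using dvd_pderiv_mult_pi_poly[OF h_nonzero] by blast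
  then have "\<iota> (pderiv h * pi_poly h) = \<iota> (h * k)" by (rule arg_cong)
  then have "Pi * \<iota> (pderiv h) = H * \<iota> k" unfolding Pi_def H_def \<iota>_mult by (simp only: mult.commute)
  then have "Pi * d H = H * \<iota> k" by (simp only: d_H)
  then show ?thesis by auto
qed

text \<open>
  In general a derivative loses one power of \<open>h\<close>; multiplication by \<open>\<pi>\<^sub>h\<close> restores it because
  \<open>h dvd h' \<pi>\<^sub>h\<close>.
\<close>

lemma J_Pi_d: assumes "x \<in> J j" shows "Pi * d x \<in> J j"
proof -
  obtain r where r: "r \<in> R" "x = r * H powi j" using J_elim[OF assms] .
  obtain k where k: "k \<in> R" "Pi * d H = H * k" using Pi_d_H by blast
  have "Pi * d x = Pi * d r * H powi j + of_int j * r * (Pi * d H) * H powi (j - 1)"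
    unfolding r(2) d_mult d_powi by (simp add: algebra_simps)
  also have "\<dots> = (Pi * d r + of_int j * r * k) * H powi j"
    unfolding k(2) using H_nonzero by (simp add: power_int_diff field_simps)
  also have "\<dots> \<in> J j"
  proof (intro J_intro R_add R_mult)
    show "(of_int j :: 'k) \<in> R" by (cases j) (simp_all add: R_uminus R_diff)
  qed (simp_all add: k r R_d Pi_def)
  finally show ?thesis .
qed

text \<open>
  The factor \<open>\<pi>\<^sub>h\<close> gains one power of \<open>h\<close> for all derivatives from the second on. This is the reason why
  commutators of normaliser elements are determined by their first order terms.
\<close>

lemma higher_derivative_bounds:
  assumes "d f \<in> J j"
  shows "(d ^^ Suc k) f \<in> J (j - int k)"
    and "Pi * (d ^^ Suc (Suc k)) f \<in> J (j - int k)"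
proof -
  have 1: "(d ^^ Suc k) f \<in> J (j - int k)" for k
  proof (induction k)
    case (Suc k) then show ?case using J_d[OF Suc] by (simp add: algebra_simps)
  qed (use assms in simp)
  show "(d ^^ Suc k) f \<in> J (j - int k)" by (rule 1)
  show "Pi * (d ^^ Suc (Suc k)) f \<in> J (j - int k)"
  proof (induction k)
    case 0 then show ?case using J_Pi_d[OF assms] by simp
  next
    case (Suc k)
    let ?u = "(d ^^ Suc (Suc k)) f"
    have "Pi * d ?u = d (Pi * ?u) - d Pi * ?u" by (simp add: d_mult)
    moreover have "d (Pi * ?u) \<in> J (j - int (Suc k))" using J_d[OF Suc] by (simp add: algebra_simps)
    moreover have "d Pi * ?u \<in> J (j - int (Suc k))" using 1[of "Suc k"]
      by (intro J_R_mult) (simp_all add: Pi_def d_\<iota>)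
    ultimately show ?case by (simp add: J_diff)
  qed
qed

lemma dy_power_\<mu>:
  "dy ^ n * \<mu> f = (\<Sum>k\<le>n. \<mu> (of_nat (n choose k) * (d ^^ k) f) * dy ^ (n - k))"
proof (induction n)
  case (Suc n)
  define T where "T c k m = \<mu> (of_nat c * (d ^^ k) f) * dy ^ m" for c k m
  have dT: "dy * T c k m = T c k (Suc m) + T c (Suc k) m" for c k m
  proof -
    have "dy * T c k m = (dy * \<mu> (of_nat c * (d ^^ k) f)) * dy ^ m" by (simp only: T_def mult.assoc)
    also have "\<dots> = T c k (Suc m) + T c (Suc k) m"
      unfolding dy_\<mu> distrib_right T_def by (simp add: d_mult mult.assoc)
    finally show ?thesis .
  qed
  have T_add: "T (a + b) k m = T a k m + T b k m" for a b k m
    by (simp add: T_def \<mu>_add distrib_right)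
  have T_0: "T 0 k m = 0" for k m by (simp add: T_def)
  have "dy ^ Suc n * \<mu> f = dy * (\<Sum>k\<le>n. T (n choose k) k (n - k))"
    using Suc by (simp add: T_def mult.assoc)
  also have "\<dots> = (\<Sum>k\<le>n. T (n choose k) k (Suc (n - k))) + (\<Sum>k\<le>n. T (n choose k) (Suc k) (n - k))"
    by (simp add: sum_distrib_left dT sum.distrib)
  also have "(\<Sum>k\<le>n. T (n choose k) k (Suc (n - k))) = (\<Sum>k\<le>Suc n. T (n choose k) k (Suc n - k))"
    by (simp add: T_0 Suc_diff_le binomial_eq_0)
  also have "\<dots> = T 1 0 (Suc n) + (\<Sum>k\<le>n. T (n choose Suc k) (Suc k) (n - k))"
    by (subst sum.atMost_Suc_shift) simp
  also have "\<dots> + (\<Sum>k\<le>n. T (n choose k) (Suc k) (n - k))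
    = T 1 0 (Suc n) + (\<Sum>k\<le>n. T (Suc n choose Suc k) (Suc k) (n - k))"
    by (simp only: binomial_Suc_Suc T_add sum.distrib add_ac)
  also have "\<dots> = (\<Sum>k\<le>Suc n. T (Suc n choose k) k (Suc n - k))"
    by (simp add: sum.atMost_Suc_shift del: sum.atMost_Suc)
  finally show ?case by (simp add: T_def)
qed simp

text \<open>
  The powers of \<open>h\<close> are built in so that the symbols of \<open>A\<^sub>h\<close> are those with polynomial coefficients.
\<close>

definition op :: "'k poly \<Rightarrow> 'e" where
  "op p = (\<Sum>i\<le>degree p. \<mu> (coeff p i * H ^ i) * dy ^ i)"

lemma op_eq_sum: "degree p \<le> n \<Longrightarrow> op p = (\<Sum>i\<le>n. \<mu> (coeff p i * H ^ i) * dy ^ i)"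
  unfolding op_def by (rule sum.mono_neutral_left) (auto simp: coeff_eq_0 not_le)

lemma op_0 [simp]: "op 0 = 0" by (simp add: op_def)
lemma op_add: "op (p + s) = op p + op s"
proof -
  let ?n = "max (degree p) (degree s)"
  have "degree (p + s) \<le> ?n" by (rule degree_add_le_max)
  then show ?thesis using op_eq_sum[of p ?n] op_eq_sum[of s ?n] op_eq_sum[of "p + s" ?n]
    by (simp add: ring_distribs \<mu>_add sum.distrib)
qed
lemma op_uminus: "op (- p) = - op p" using op_add[of p "- p"]
  by (simp add: eq_neg_iff_add_eq_0 add.commute)
lemma op_diff: "op (p - s) = op p - op s" using op_add[of p "- s"] by (simp add: op_uminus)
lemma op_sum: "op (sum f A) = (\<Sum>x\<in>A. op (f x))"
  by (induction A rule: infinite_finite_induct) (simp_all add: op_add)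
lemma op_monom: "op (monom c n) = \<mu> (c * H ^ n) * dy ^ n"
proof (cases "c = 0")
  case False
  have "op (monom c n) = (\<Sum>i\<le>n. if i = n then \<mu> (c * H ^ n) * dy ^ n else 0)"
    unfolding op_eq_sum[OF degree_monom_le] by (rule sum.cong) auto
  then show ?thesis by simp
qed simp
lemma op_const: "op [:c:] = \<mu> c" using op_monom[of c 0] by (simp add: monom_0)
lemma \<mu>_dy_eq_op: "\<mu> c * dy ^ n = op (monom (c / H ^ n) n)"
  using H_nonzero by (simp add: op_monom)

definition Xop :: 'e where "Xop = \<mu> (\<iota> [:0, 1:])"
definition Yop :: 'e where "Yop = dy * \<mu> H"

lemma additive_polyI:
  fixes F :: "'b::comm_ring_1 poly \<Rightarrow> 'c::ab_group_add"
  assumes add: "\<And>p s. F (p + s) = F p + F s" and monom: "\<And>c n. F (monom c n) = 0"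
  shows "F p = 0"
proof -
  have F0: "F 0 = 0" using add[of 0 0] by simp
  have "F (sum f A) = (\<Sum>x\<in>A. F (f x))" for f :: "nat \<Rightarrow> 'b poly" and A
    by (induction A rule: infinite_finite_induct) (simp_all add: add F0)
  then have "F (\<Sum>i\<le>degree p. monom (coeff p i) i) = 0" by (simp add: monom)
  then show ?thesis by (simp add: poly_as_sum_of_monoms)
qed

lemma dy_power_Xop: "dy ^ n * Xop = Xop * dy ^ n + of_nat n * dy ^ (n - 1)"
proof (induction n)
  case (Suc n)
  have dyX: "dy * Xop = Xop * dy + 1"
    by (simp add: Xop_def dy_\<mu> d_\<iota> pderiv_pCons \<iota>_1 \<mu>_1 one_pCons[symmetric])
  have c: "dy * (of_nat n :: 'e) = of_nat n * dy" by (rule mult_of_nat_commute[symmetric])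
  have "dy ^ Suc n * Xop = dy * (Xop * dy ^ n) + dy * (of_nat n * dy ^ (n - 1))"
    by (simp add: mult.assoc Suc distrib_left)
  also have "dy * (Xop * dy ^ n) = Xop * dy ^ Suc n + dy ^ n"
    unfolding mult.assoc[symmetric] dyX by (simp add: ring_distribs mult.assoc)
  also have "dy * (of_nat n * dy ^ (n - 1)) = of_nat n * dy ^ n"
    unfolding mult.assoc[symmetric] c by (cases n) (simp_all add: mult.assoc)
  finally show ?case by (simp add: ring_distribs)
qed simp

lemma commutator_Xop: "op r * Xop - Xop * op r = op (Polynomial.smult H (pderiv r))"
proof -
  have "op r * Xop - Xop * op r - op (Polynomial.smult H (pderiv r)) = 0"
  proof (rule additive_polyI[of "\<lambda>r. op r * Xop - Xop * op r - op (Polynomial.smult H (pderiv r))"])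
    fix c n
    have cX: "\<mu> z * Xop = Xop * \<mu> z" for z by (simp add: Xop_def \<mu>_mult[symmetric] mult.commute)
    have "op (monom c n) * Xop = \<mu> (c * H ^ n) * (Xop * dy ^ n) + \<mu> (c * H ^ n) * (of_nat n * dy ^ (n - 1))"
      unfolding op_monom mult.assoc dy_power_Xop by (rule distrib_left)
    also have "\<mu> (c * H ^ n) * (Xop * dy ^ n) = Xop * op (monom c n)"
      unfolding op_monom mult.assoc[symmetric] cX by simp
    also have "\<mu> (c * H ^ n) * (of_nat n * dy ^ (n - 1)) = of_nat n * (\<mu> (c * H ^ n) * dy ^ (n - 1))"
      unfolding mult.assoc[symmetric] mult_of_nat_commute[of n "\<mu> (c * H ^ n)"] by simp
    finally have "op (monom c n) * Xop = Xop * op (monom c n) + of_nat n * (\<mu> (c * H ^ n) * dy ^ (n - 1))" .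
    moreover have "op (Polynomial.smult H (pderiv (monom c n))) = of_nat n * (\<mu> (c * H ^ n) * dy ^ (n - 1))"
    proof (cases n)
      case (Suc m)
      have "H * (of_nat n * c) * H ^ m = of_nat n * (c * H ^ n)" using Suc by (simp del: of_nat_Suc)
      then have "\<mu> (H * (of_nat n * c) * H ^ m) = of_nat n * \<mu> (c * H ^ n)"
        by (simp only: \<mu>_mult[of "of_nat n"] \<mu>_of_nat)
      then show ?thesis using Suc
        by (simp add: pderiv_monom smult_monom op_monom mult.assoc del: of_nat_Suc)
    qed (simp add: pderiv_monom)
    ultimately show "op (monom c n) * Xop - Xop * op (monom c n)
        - op (Polynomial.smult H (pderiv (monom c n))) = 0"
      by simp
  qed (simp add: op_add ring_distribs pderiv_add smult_add_right)
  then show ?thesis by simp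
qed

text \<open>
  The commutator with \<open>x\<close> differentiates the symbol with respect to \<open>Y\<close>, which allows an induction on
  the degree.
\<close>

lemma op_eq_0: "op p = 0 \<Longrightarrow> p = 0"
proof (induction "degree p" arbitrary: p)
  case 0
  then obtain c where "p = [:c:]" by (auto elim: degree_eq_zeroE)
  then show ?case using 0 \<mu>_inj by (simp add: op_const)
next
  case (Suc n)
  have "op (Polynomial.smult H (pderiv p)) = 0" using commutator_Xop[of p] Suc.prems by simp
  moreover have "degree (Polynomial.smult H (pderiv p)) = n"
    using Suc.hyps H_nonzero by (simp add: degree_pderiv)
  ultimately have "Polynomial.smult H (pderiv p) = 0" using Suc.hyps(1) by blast
  then have "pderiv p = 0" using H_nonzero by simp
  then show ?case using Suc.hyps by (simp add: pderiv_eq_0_iff)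
qed

lemma op_eq_iff: "op p = op s \<longleftrightarrow> p = s"
  using op_eq_0[of "p - s"] by (auto simp: op_diff)

definition dx :: "'k poly \<Rightarrow> 'k poly" where "dx = map_poly d"
lemma coeff_dx [simp]: "coeff (dx p) n = d (coeff p n)" by (simp add: dx_def coeff_map_poly)
lemma dx_add: "dx (p + s) = dx p + dx s" by (simp add: poly_eq_iff d_add)
lemma dx_monom: "dx (monom c n) = monom (d c) n" by (simp add: poly_eq_iff)

text \<open>
  The symbols of the elements of \<open>A\<^sub>h\<close>, and those of the operators that normalise \<open>A\<^sub>h\<close>.
\<close>

definition Ac :: "'k poly set" where "Ac = {p. \<forall>n. coeff p n \<in> R}"
definition Mc :: "'k poly set" where
  "Mc = {p. (\<forall>n\<ge>1. Q * coeff p n \<in> R) \<and> H * d (coeff p 0) \<in> R}"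

definition PB :: "'k poly \<Rightarrow> 'k poly \<Rightarrow> 'k poly" where
  "PB p s = Polynomial.smult H (pderiv p * dx s - dx p * pderiv s)"

lemma Ac_0 [simp]: "0 \<in> Ac" by (simp add: Ac_def)
lemma Ac_add: "p \<in> Ac \<Longrightarrow> s \<in> Ac \<Longrightarrow> p + s \<in> Ac" by (simp add: Ac_def R_add)
lemma Ac_uminus: "p \<in> Ac \<Longrightarrow> - p \<in> Ac" by (simp add: Ac_def R_uminus)
lemma Ac_diff: "p \<in> Ac \<Longrightarrow> s \<in> Ac \<Longrightarrow> p - s \<in> Ac" by (simp add: Ac_def R_diff)
lemma Ac_mult: "p \<in> Ac \<Longrightarrow> s \<in> Ac \<Longrightarrow> p * s \<in> Ac" by (simp add: Ac_def coeff_mult R_sum R_mult)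
lemma Ac_smult: "c \<in> R \<Longrightarrow> p \<in> Ac \<Longrightarrow> Polynomial.smult c p \<in> Ac" by (simp add: Ac_def R_mult)
lemma Ac_dx: "p \<in> Ac \<Longrightarrow> dx p \<in> Ac" by (simp add: Ac_def R_d)
lemma Ac_pderiv: "p \<in> Ac \<Longrightarrow> pderiv p \<in> Ac" using R_mult[OF R_of_nat]
  by (auto simp: Ac_def coeff_pderiv simp del: of_nat_Suc)

lemma \<mu>_dy_in_op_Ac: assumes "c \<in> J (int n)" shows "\<mu> c * dy ^ n \<in> op ` Ac"
proof -
  have "monom (c / H ^ n) n \<in> Ac" using assms H_nonzero
    by (auto simp: Ac_def J_def power_int_minus field_simps)
  then show ?thesis using \<mu>_dy_eq_op by blast
qed

lemma op_Ac_add: "x \<in> op ` Ac \<Longrightarrow> y \<in> op ` Ac \<Longrightarrow> x + y \<in> op ` Ac"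
  by (auto simp: op_add[symmetric] intro!: imageI Ac_add)
lemma op_Ac_diff: "x \<in> op ` Ac \<Longrightarrow> y \<in> op ` Ac \<Longrightarrow> x - y \<in> op ` Ac"
  by (auto simp: op_diff[symmetric] intro!: imageI Ac_diff)
lemma op_Ac_0: "0 \<in> op ` Ac" by (rule image_eqI[of _ _ 0]) simp_all

lemma op_Ac_sum: "(\<And>x. x \<in> A \<Longrightarrow> f x \<in> op ` Ac) \<Longrightarrow> sum f A \<in> op ` Ac"
  by (induction A rule: infinite_finite_induct) (simp_all add: op_Ac_add op_Ac_0)

text \<open>
  The product of \<open>a h\<^sup>m \<partial>\<^sup>m\<close> and \<open>b h\<^sup>n \<partial>\<^sup>n\<close> contains \<open>a h\<^sup>m (b h\<^sup>n)\<^sup>(\<^sup>k\<^sup>) \<partial>\<^sup>m\<^sup>+\<^sup>n\<^sup>-\<^sup>k\<close>; the condition says that these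
  terms lie in \<open>A\<^sub>h\<close> for \<open>k \<ge> 2\<close>.
\<close>

definition small :: "'k \<Rightarrow> nat \<Rightarrow> 'k \<Rightarrow> nat \<Rightarrow> bool" where
  "small a m b n \<longleftrightarrow> (\<forall>k. a * H ^ m * (d ^^ Suc (Suc k)) (b * H ^ n) \<in> J (int m
      + int n - 2 - int k) \<or> Suc (Suc k) > m)"

lemma op_monom_mult:
  assumes "small a m b n"
  shows "op (monom a m) * op (monom b n) - \<mu> (a * b * H ^ (m + n)) * dy ^ (m + n)
     - \<mu> (of_nat m * a * H ^ m * d (b * H ^ n)) * dy ^ (m + n - 1) \<in> op ` Ac"
proof -
  define T where "T k = \<mu> (of_nat (m choose k) * (a * H ^ m * (d ^^ k) (b * H ^ n))) * dy ^ (m - k + n)"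
    for k
  have "op (monom a m) * op (monom b n) = \<mu> (a * H ^ m) * (dy ^ m * \<mu> (b * H ^ n)) * dy ^ n"
    by (simp add: op_monom mult.assoc)
  also have "\<dots> = (\<Sum>k\<le>m. T k)"
    unfolding dy_power_\<mu> sum_distrib_left sum_distrib_right T_def power_add
  proof (rule sum.cong[OF refl])
    fix k
    have "\<mu> (a * H ^ m) * (\<mu> (of_nat (m choose k) * (d ^^ k) (b * H ^ n)) * dy ^ (m - k)) * dy ^ n
      = (\<mu> (a * H ^ m) * \<mu> (of_nat (m choose k) * (d ^^ k) (b * H ^ n))) * (dy ^ (m - k) * dy ^ n)"
      by (simp only: mult.assoc)
    also have "\<mu> (a * H ^ m) * \<mu> (of_nat (m choose k) * (d ^^ k) (b * H ^ n))
      = \<mu> (of_nat (m choose k) * (a * H ^ m * (d ^^ k) (b * H ^ n)))"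
      unfolding \<mu>_mult[symmetric] by (simp only: mult_ac)
    finally show "\<mu> (a * H ^ m) * (\<mu> (of_nat (m choose k) * (d ^^ k) (b * H ^ n)) * dy ^ (m - k)) * dy ^ n
      = \<mu> (of_nat (m choose k) * (a * H ^ m * (d ^^ k) (b * H ^ n))) * (dy ^ (m - k) * dy ^ n)" .
  qed
  finally have prod: "op (monom a m) * op (monom b n) = (\<Sum>k\<le>m. T k)" .
  have T0: "T 0 = \<mu> (a * b * H ^ (m + n)) * dy ^ (m + n)" by (simp add: T_def power_add mult_ac)
  show ?thesis
  proof (cases m)
    case 0
    then show ?thesis unfolding prod using T0 by (simp add: op_Ac_0)
  next
    case (Suc m')
    have T1: "T 1 = \<mu> (of_nat m * a * H ^ m * d (b * H ^ n)) * dy ^ (m + n - 1)"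
      using Suc by (simp add: T_def mult.assoc del: of_nat_Suc)
    have "{..m} = insert 0 (insert 1 {2..m})" using Suc by auto
    then have "(\<Sum>k\<le>m. T k) = T 0 + (T 1 + (\<Sum>k\<in>{2..m}. T k))" by simp
    moreover have "(\<Sum>k\<in>{2..m}. T k) \<in> op ` Ac"
    proof (rule op_Ac_sum)
      fix k assume k: "k \<in> {2..m}"
      define k' where "k' = k - 2"
      from k have "2 \<le> k" by simp
      then have k': "k = Suc (Suc k')" unfolding k'_def by linarith
      have "a * H ^ m * (d ^^ Suc (Suc k')) (b * H ^ n) \<in> J (int m + int n - 2 - int k')"
        using assms k unfolding k' small_def by auto
      moreover have "int m + int n - 2 - int k' = int (m - k + n)" using k k' by (simp add: of_nat_diff)
      ultimately have "a * H ^ m * (d ^^ k) (b * H ^ n) \<in> J (int (m - k + n))" unfolding k' by simp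
      then show "T k \<in> op ` Ac" unfolding T_def by (rule \<mu>_dy_in_op_Ac[OF J_R_mult[OF R_of_nat]])
    qed
    ultimately show ?thesis unfolding prod T0[symmetric] T1[symmetric] by simp
  qed
qed

lemma PB_monom: "PB (monom a m) (monom b n)
    = monom (H * (of_nat m * a * d b - of_nat n * d a * b)) (m + n - 1)"
  by (cases m; cases n) (simp_all add: PB_def pderiv_monom dx_monom mult_monom diff_monom smult_monom minus_monom
     mult_ac add_ac algebra_simps del: of_nat_Suc)

lemma PB_add_left: "PB (p + p') s = PB p s + PB p' s"
  and PB_add_right: "PB p (s + s') = PB p s + PB p s'"
  by (simp_all add: PB_def dx_add pderiv_add ring_distribs smult_add_right smult_diff_right)
lemma PB_0 [simp]: "PB 0 s = 0" "PB p 0 = 0" by (simp_all add: PB_def dx_def)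
lemma PB_sum_left: "PB (sum f A) s = (\<Sum>x\<in>A. PB (f x) s)"
  by (induction A rule: infinite_finite_induct) (simp_all add: PB_add_left)
lemma PB_sum_right: "PB p (sum f A) = (\<Sum>x\<in>A. PB p (f x))"
  by (induction A rule: infinite_finite_induct) (simp_all add: PB_add_right)

lemma commutator_monom:
  assumes "small a m b n" "small b n a m"
  shows "op (monom a m) * op (monom b n) - op (monom b n) * op (monom a m)
      - op (PB (monom a m) (monom b n)) \<in> op ` Ac"
proof -
  let ?c = "\<mu> (of_nat m * a * H ^ m * d (b * H ^ n)) * dy ^ (m
      + n - 1) - \<mu> (of_nat n * b * H ^ n * d (a * H ^ m)) * dy ^ (m + n - 1)"
  have "of_nat m * a * H ^ m * d (b * H ^ n) - of_nat n * b * H ^ n * d (a * H ^ m)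
      = H * (of_nat m * a * d b - of_nat n * d a * b) * H ^ (m + n - 1)"
    unfolding d_mult[of _ "H ^ _"] d_power
    by (cases m; cases n) (simp_all add: power_add algebra_simps del: of_nat_Suc)
  then have c: "op (PB (monom a m) (monom b n)) = ?c"
    unfolding PB_monom op_monom by (simp add: \<mu>_diff[symmetric] left_diff_distrib[symmetric])
  have "(op (monom a m) * op (monom b n) - \<mu> (a * b * H ^ (m + n)) * dy ^ (m + n)
     - \<mu> (of_nat m * a * H ^ m * d (b * H ^ n)) * dy ^ (m + n - 1))
   - (op (monom b n) * op (monom a m) - \<mu> (b * a * H ^ (n + m)) * dy ^ (n + m)
     - \<mu> (of_nat n * b * H ^ n * d (a * H ^ m)) * dy ^ (n + m - 1)) \<in> op ` Ac" (is "?l \<in> _")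
    by (intro op_Ac_diff op_monom_mult assms)
  also have "?l = op (monom a m) * op (monom b n) - op (monom b n) * op (monom a m) - ?c"
    by (simp add: mult.commute[of a b] add.commute[of m n])
  finally show ?thesis unfolding c .
qed

lemma commutator_op:
  assumes "\<And>m n. small (coeff p m) m (coeff s n) n" "\<And>m n. small (coeff s n) n (coeff p m) m"
  shows "op p * op s - op s * op p - op (PB p s) \<in> op ` Ac"
proof -
  let ?p = "\<lambda>m. monom (coeff p m) m" and ?s = "\<lambda>n. monom (coeff s n) n"
  have p: "p = (\<Sum>m\<le>degree p. ?p m)" and s: "s = (\<Sum>n\<le>degree s. ?s n)"
    by (simp_all add: poly_as_sum_of_monoms)
  have op: "op p = (\<Sum>m\<le>degree p. op (?p m))" "op s = (\<Sum>n\<le>degree s. op (?s n))"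
    using arg_cong[OF p, of op] arg_cong[OF s, of op] by (simp_all only: op_sum)
  have "PB p s = (\<Sum>m\<le>degree p. \<Sum>n\<le>degree s. PB (?p m) (?s n))"
  proof -
    have "PB p s = (\<Sum>n\<le>degree s. \<Sum>m\<le>degree p. PB (?p m) (?s n))"
      using arg_cong2[OF p s, of PB] by (simp only: PB_sum_left PB_sum_right)
    also have "\<dots> = (\<Sum>m\<le>degree p. \<Sum>n\<le>degree s. PB (?p m) (?s n))" by (rule sum.swap)
    finally show ?thesis .
  qed
  then have PB: "op (PB p s) = (\<Sum>m\<le>degree p. \<Sum>n\<le>degree s. op (PB (?p m) (?s n)))" by (simp add: op_sum)
  have "op s * op p = (\<Sum>m\<le>degree p. \<Sum>n\<le>degree s. op (?s n) * op (?p m))"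
    unfolding op sum_product by (rule sum.swap)
  then have "op p * op s - op s * op p - op (PB p s) = (\<Sum>m\<le>degree p. \<Sum>n\<le>degree s.
     op (?p m) * op (?s n) - op (?s n) * op (?p m) - op (PB (?p m) (?s n)))"
    unfolding PB by (simp add: op sum_product sum_subtractf)
  also have "\<dots> \<in> op ` Ac" by (intro op_Ac_sum commutator_monom assms)
  finally show ?thesis .
qed

section \<open>The normaliser of \<open>A\<^sub>h\<close> and its Poisson bracket\<close>

text \<open>
  The conditions on the right say that the commutators with \<open>x\<close> and \<open>y h\<close> lie in \<open>A\<^sub>h\<close>. For
  \<open>p\<^sub>n = s/h\<close> the second one reads \<open>s' - s h'/h \<in> F[x]\<close>, that is \<open>h dvd h' s\<close>, that is \<open>\<pi>\<^sub>h dvd s\<close>.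
\<close>

lemma Mc_iff: "p \<in> Mc \<longleftrightarrow> (\<forall>n\<ge>1. H * coeff p n \<in> R) \<and> (\<forall>n. H * d (coeff p n) \<in> R)"
proof safe
  assume p: "p \<in> Mc"
  have Pi_R: "Pi \<in> R" by (simp add: Pi_def)
  fix n
  show "H * coeff p n \<in> R" if "n \<ge> 1"
    using p that R_mult[OF Pi_R, of "Q * coeff p n"] unfolding H_eq Mc_def by (simp add: mult_ac)
  show "H * d (coeff p n) \<in> R"
  proof (cases n)
    case (Suc n')
    then obtain r where r: "Q * coeff p n = \<iota> r" using p by (auto simp: Mc_def R_def)
    obtain k where k: "pderiv q * pi_poly h = q * k"
      using divisor_dvd_pi_poly_mult_pderiv[OF q_dvd_h h_nonzero] by blast
    have "\<iota> (pderiv q * pi_poly h) = \<iota> (q * k)" using k by (rule arg_cong)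
    then have k': "d Q * Pi = Q * \<iota> k" by (simp only: Q_def Pi_def \<iota>_mult d_\<iota>)
    have "d Q * coeff p n + Q * d (coeff p n) = d (\<iota> r)" using r by (metis d_mult)
    then have "H * d (coeff p n) = Pi * d (\<iota> r) - d Q * Pi * coeff p n"
    proof -
      assume "d Q * coeff p n + Q * d (coeff p n) = d (\<iota> r)"
      then have "Pi * (d Q * coeff p n + Q * d (coeff p n)) = Pi * d (\<iota> r)" by (rule arg_cong)
      then show ?thesis unfolding H_eq by (simp add: algebra_simps)
    qed
    also have "\<dots> = Pi * d (\<iota> r) - \<iota> k * \<iota> r" unfolding k' r[symmetric] by (simp add: mult_ac)
    also have "\<dots> \<in> R" by (intro R_diff R_mult R_d Pi_R) simp_all
    finally show ?thesis .
  qed (use p in \<open>simp add: Mc_def\<close>)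
next
  assume p1: "\<forall>n\<ge>1. H * coeff p n \<in> R" and p2: "\<forall>n. H * d (coeff p n) \<in> R"
  show "p \<in> Mc" unfolding Mc_def
  proof safe
    fix n :: nat assume "n \<ge> 1"
    then obtain s where s: "H * coeff p n = \<iota> s" using p1 by (auto simp: R_def)
    obtain t where t: "H * d (coeff p n) = \<iota> t" using p2 by (auto simp: R_def)
    have "d H * coeff p n + H * d (coeff p n) = d (\<iota> s)" using s by (metis d_mult)
    then have "d H * (H * coeff p n) + H * (H * d (coeff p n)) = H * d (\<iota> s)"
      by (metis distrib_left mult.left_commute)
    then have "\<iota> (pderiv h * s) = \<iota> (h * (pderiv s - t))"
      unfolding s t by (simp add: d_H d_\<iota> \<iota>_mult \<iota>_diff H_def[symmetric] algebra_simps)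
    then have "h dvd pderiv h * s" by (simp add: \<iota>_eq_iff)
    then have "pi_poly h dvd s" using dvd_pderiv_mult_iff[OF h_nonzero] by blast
    then have "\<iota> s / Pi \<in> R" unfolding Pi_def using \<iota>_div_in_R pi_poly_nonzero[OF h_nonzero] by simp
    moreover have "Q * coeff p n = \<iota> s / Pi" unfolding s[symmetric] H_eq using Pi_nonzero by simp
    ultimately show "Q * coeff p n \<in> R" by simp
  qed (use p2 in blast)
qed

lemma Ac_subset_Mc: "p \<in> Ac \<Longrightarrow> p \<in> Mc"
  by (auto simp: Ac_def Mc_iff intro!: R_mult R_d)

lemma Mc_monom: "p \<in> Mc \<Longrightarrow> monom (coeff p n) n \<in> Mc"
  by (auto simp: Mc_def)
lemma Mc_0 [simp]: "0 \<in> Mc" by (simp add: Mc_def)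
lemma Mc_add: "p \<in> Mc \<Longrightarrow> s \<in> Mc \<Longrightarrow> p + s \<in> Mc"
  by (auto simp: Mc_def d_add ring_distribs intro: R_add)
lemma Mc_uminus: "p \<in> Mc \<Longrightarrow> - p \<in> Mc"
  by (auto simp: Mc_def d_uminus dest: R_uminus)
lemma Mc_diff: "p \<in> Mc \<Longrightarrow> s \<in> Mc \<Longrightarrow> p - s \<in> Mc"
  using Mc_add[OF _ Mc_uminus] by (metis uminus_add_conv_diff add.commute)

text \<open>
  One of the two factors supplies \<open>\<pi>\<^sub>h\<close> through \<open>a = u/q = u \<pi>\<^sub>h / h\<close>, the other one has
  \<open>(b h\<^sup>n)' \<in> h\<^sup>n\<^sup>-\<^sup>1 F[x]\<close>, so that \<open>higher_derivative_bounds\<close> applies.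
\<close>

lemma small_Mc:
  assumes p: "p \<in> Mc" and s: "s \<in> Mc"
  shows "small (coeff p m) m (coeff s n) n"
  unfolding small_def
proof
  fix k
  show "coeff p m * H ^ m * (d ^^ Suc (Suc k)) (coeff s n * H ^ n) \<in> J (int m
      + int n - 2 - int k) \<or> m < Suc (Suc k)"
  proof (cases "m < Suc (Suc k)")
    case False
    let ?f = "coeff s n * H ^ n"
    have "of_nat n * coeff s n * d H \<in> R"
    proof (cases n)
      case (Suc n')
      obtain c where c: "pderiv h = q * c" using q_dvd_pderiv_h by blast
      have "of_nat n * coeff s n * d H = of_nat n * ((Q * coeff s n) * \<iota> c)"
        unfolding d_H c \<iota>_mult Q_def by (simp only: mult_ac)
      moreover have "Q * coeff s n \<in> R" using s Suc by (simp add: Mc_def)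
      ultimately show ?thesis by (simp only: R_mult R_of_nat \<iota>_in_R)
    qed simp
    moreover have "H * d (coeff s n) \<in> R" using s by (simp add: Mc_iff)
    ultimately have "(H * d (coeff s n) + of_nat n * coeff s n * d H) * H powi (int n - 1) \<in> J (int n - 1)"
      by (intro J_intro R_add)
    also have "(H * d (coeff s n) + of_nat n * coeff s n * d H) * H powi (int n - 1) = d ?f"
    proof (cases n)
      case 0 then show ?thesis using H_nonzero by (simp add: power_int_minus)
    next
      case (Suc n')
      then have "H powi (int n - 1) = H ^ n'" by (simp add: power_int_of_nat)
      moreover have "H ^ n = H * H ^ n'" using Suc by simp
      ultimately show ?thesis unfolding d_mult[of _ "H ^ _"] d_power using Suc
        by (simp add: algebra_simps)
    qed
    finally have "Pi * (d ^^ Suc (Suc k)) ?f \<in> J (int n - 1 - int k)"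
      by (rule higher_derivative_bounds(2))
    moreover have "(Q * coeff p m) \<in> R" using False p by (simp add: Mc_def)
    ultimately have "(Q * coeff p m) * (Pi * (d ^^ Suc (Suc k)) ?f) \<in> J (int n - 1 - int k)"
      by (intro J_R_mult[of "Q * coeff p m"])
    then have "H ^ (m - 1) * ((Q * coeff p m) * (Pi * (d ^^ Suc (Suc k)) ?f)) \<in> J (int (m - 1)
        + (int n - 1 - int k))"
      by (intro J_mult H_power_in_J)
    moreover have "H ^ m = H ^ (m - 1) * (Q * Pi)" using False H_eq by (cases m) simp_all
    ultimately show ?thesis using False by (simp add: mult_ac algebra_simps of_nat_diff)
  qed simp
qed

lemma commutator_Mc:
  assumes "p \<in> Mc" "s \<in> Mc" shows "op p * op s - op s * op p - op (PB p s) \<in> op ` Ac"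
  using assms by (intro commutator_op small_Mc)

definition Ypoly :: "'k poly" where "Ypoly = monom 1 1 + [:\<iota> (pderiv h):]"

lemma Yop_eq: "Yop = op Ypoly"
  by (simp add: Yop_def Ypoly_def op_add op_monom op_const dy_\<mu> d_H)

text \<open>
  The hypothesis is weaker than membership in the normaliser: for the classification of derivations the
  lemma is needed before \<open>r\<close> is known to belong to it.
\<close>

lemma commutator_Yop:
  assumes r: "\<And>n. n \<ge> 1 \<Longrightarrow> H * coeff r n \<in> R"
  shows "op r * Yop - Yop * op r + op (Polynomial.smult H (dx r)) \<in> op ` Ac"
proof -
  have d_R: "(d ^^ k) c \<in> R" if "c \<in> R" for c k using that by (induction k) (auto intro: R_d)
  have s1: "small (coeff r m) m (coeff Ypoly n) n" for m n
    unfolding small_def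
  proof
    fix k
    show "coeff r m * H ^ m * (d ^^ Suc (Suc k)) (coeff Ypoly n * H ^ n) \<in> J (int m
        + int n - 2 - int k) \<or> m < Suc (Suc k)"
    proof (cases "m < Suc (Suc k)")
      case False
      have "coeff Ypoly n * H ^ n \<in> R"
        by (cases n) (auto simp: Ypoly_def coeff_pCons one_pCons H_in_R split: nat.split intro!: R_mult R_power)
      then have "(H * coeff r m) * (d ^^ Suc (Suc k)) (coeff Ypoly n * H ^ n) \<in> J 0"
        using r[of m] False unfolding J_0_iff by (intro R_mult[of "H * coeff r m"] d_R) simp_all
      then have "H ^ (m - 1) * ((H * coeff r m) * (d ^^ Suc (Suc k)) (coeff Ypoly n * H ^ n))
          \<in> J (int (m - 1) + 0)"
        by (intro J_mult H_power_in_J)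
      moreover have "H ^ m = H ^ (m - 1) * H" using False by (cases m) simp_all
      ultimately have 1: "coeff r m * H ^ m * (d ^^ Suc (Suc k)) (coeff Ypoly n * H ^ n) \<in> J (int (m - 1))"
        by (simp add: mult_ac)
      show ?thesis
      proof (cases "n \<le> 1")
        case True then show ?thesis using J_antimono[OF 1, of "int m + int n - 2 - int k"] False
          by (simp add: of_nat_diff)
      next
        case False
        have "coeff Ypoly n = 0" using False by (auto simp: Ypoly_def coeff_pCons split: nat.split)
        then have "(d ^^ Suc (Suc k)) (coeff Ypoly n * H ^ n) = 0" by (induction k) simp_all
        then show ?thesis by simp
      qed
    qed simp
  qed
  have s2: "small (coeff Ypoly n) n (coeff r m) m" for m n
  proof (cases "n \<le> 1")
    case False
    then have "coeff Ypoly n = 0" by (auto simp: Ypoly_def coeff_pCons split: nat.split)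
    then show ?thesis by (simp add: small_def)
  qed (simp add: small_def)
  have "op r * op Ypoly - op Ypoly * op r - op (PB r Ypoly) \<in> op ` Ac"
    by (rule commutator_op) (rule s1 s2)+
  moreover have PB_eq: "PB r Ypoly
      = Polynomial.smult (\<iota> (pderiv (pderiv h))) (Polynomial.smult H (pderiv r)) - Polynomial.smult H (dx r)"
    by (simp add: PB_def Ypoly_def dx_add pderiv_add pderiv_monom dx_monom monom_0 one_pCons[symmetric] d_\<iota>
       poly_eq_iff coeff_pCons algebra_simps split: nat.splits)
       (simp add: dx_def map_poly_pCons d_\<iota>)
  moreover have "Polynomial.smult (\<iota> (pderiv (pderiv h))) (Polynomial.smult H (pderiv r)) \<in> Ac"
  proof (rule Ac_smult)
    have "of_nat (Suc n) * (H * coeff r (Suc n)) \<in> R" for n using r[of "Suc n"]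
      by (intro R_mult[OF R_of_nat]) simp
    then show "Polynomial.smult H (pderiv r) \<in> Ac"
      by (simp add: Ac_def coeff_pderiv mult_ac del: of_nat_Suc)
  qed simp
  ultimately have "(op r * op Ypoly - op Ypoly * op r - op (PB r Ypoly))
      + op (Polynomial.smult (\<iota> (pderiv (pderiv h))) (Polynomial.smult H (pderiv r))) \<in> op ` Ac"
    and "op (PB r Ypoly) = op (Polynomial.smult (\<iota> (pderiv (pderiv h))) (Polynomial.smult H (pderiv r)))
      - op (Polynomial.smult H (dx r))"
    by (blast intro: op_Ac_add) (simp add: op_diff PB_eq)
  then show ?thesis unfolding Yop_eq by (simp add: algebra_simps)
qed

end

section \<open>Algebras parametrised by concrete structures\<close>

text \<open>
  Elements of presented algebras, derivation algebras and their quotients are cosets or functions. Such a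
  record is handled through a surjection \<open>\<delta>\<close> from a subset \<open>M\<close> of an ordinary type that respects the
  operations; the vector space axioms then pass from \<open>M\<close> to the record. The product \<open>pr\<close> is only
  required to be correct modulo the kernel of \<open>\<delta>\<close>, so that the Poisson bracket can take the place of
  the commutator.
\<close>

locale parametrized_algebra =
  fixes L :: "('a::field, 'b) module"
    and M :: "'m::ab_group_add set"
    and sc :: "'a \<Rightarrow> 'm \<Rightarrow> 'm"
    and pr :: "'m \<Rightarrow> 'm \<Rightarrow> 'm"
    and \<delta> :: "'m \<Rightarrow> 'b"
  assumes M_0: "0 \<in> M"
    and M_add: "x \<in> M \<Longrightarrow> y \<in> M \<Longrightarrow> x + y \<in> M"
    and M_uminus: "x \<in> M \<Longrightarrow> - x \<in> M"
    and M_sc: "x \<in> M \<Longrightarrow> sc c x \<in> M"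
    and M_pr: "x \<in> M \<Longrightarrow> y \<in> M \<Longrightarrow> pr x y \<in> M"
    and sc_add_right: "sc c (x + y) = sc c x + sc c y"
    and sc_add_left: "sc (c + c') x = sc c x + sc c' x"
    and sc_mult: "sc (c * c') x = sc c (sc c' x)"
    and sc_1: "sc 1 x = x"
    and carrier_eq: "carrier L = \<delta> ` M"
    and \<delta>_0: "\<delta> 0 = \<zero>\<^bsub>L\<^esub>"
    and \<delta>_add: "x \<in> M \<Longrightarrow> y \<in> M \<Longrightarrow> \<delta> (x + y) = \<delta> x \<oplus>\<^bsub>L\<^esub> \<delta> y"
    and \<delta>_sc: "x \<in> M \<Longrightarrow> \<delta> (sc c x) = c \<odot>\<^bsub>L\<^esub> \<delta> x"
    and \<delta>_pr: "x \<in> M \<Longrightarrow> y \<in> M \<Longrightarrow> \<delta> (pr x y) = \<delta> x \<otimes>\<^bsub>L\<^esub> \<delta> y"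
begin

lemma M_diff: "x \<in> M \<Longrightarrow> y \<in> M \<Longrightarrow> x - y \<in> M"
  using M_add[OF _ M_uminus] by (metis add_uminus_conv_diff)

lemma sc_0 [simp]: "sc c 0 = 0" using sc_add_right[of c 0 0] by simp
lemma sc_zero [simp]: "sc 0 x = 0" using sc_add_left[of 0 0 x] by simp

lemma \<delta>_closed: "x \<in> M \<Longrightarrow> \<delta> x \<in> carrier L" by (simp add: carrier_eq)

lemma abelian_group: "abelian_group L"
proof (rule abelian_groupI)
  fix u v w assume u: "u \<in> carrier L" and v: "v \<in> carrier L" and w: "w \<in> carrier L"
  then obtain x y z where xyz: "x \<in> M" "y \<in> M" "z \<in> M" "u = \<delta> x" "v = \<delta> y" "w = \<delta> z"
    by (auto simp: carrier_eq)
  then show "u \<oplus>\<^bsub>L\<^esub> v \<in> carrier L" by (auto simp: \<delta>_add[symmetric] M_add \<delta>_closed)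
  show "u \<oplus>\<^bsub>L\<^esub> v \<oplus>\<^bsub>L\<^esub> w = u \<oplus>\<^bsub>L\<^esub> (v \<oplus>\<^bsub>L\<^esub> w)" using xyz by (simp add: \<delta>_add[symmetric] M_add add.assoc)
  show "u \<oplus>\<^bsub>L\<^esub> v = v \<oplus>\<^bsub>L\<^esub> u" using xyz by (simp add: \<delta>_add[symmetric] M_add add.commute)
next
  show "\<zero>\<^bsub>L\<^esub> \<in> carrier L" using \<delta>_closed[OF M_0] by (simp add: \<delta>_0)
next
  fix u assume u: "u \<in> carrier L"
  then obtain x where x: "x \<in> M" "u = \<delta> x" by (auto simp: carrier_eq)
  then show "\<zero>\<^bsub>L\<^esub> \<oplus>\<^bsub>L\<^esub> u = u" by (simp add: \<delta>_0[symmetric] \<delta>_add[symmetric] M_0)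
  show "\<exists>y\<in>carrier L. y \<oplus>\<^bsub>L\<^esub> u = \<zero>\<^bsub>L\<^esub>"
    using x
      by (intro bexI[of _ "\<delta> (- x)"]) (simp_all add: \<delta>_0[symmetric] \<delta>_add[symmetric] M_uminus \<delta>_closed)
qed

lemma \<delta>_uminus: "x \<in> M \<Longrightarrow> \<delta> (- x) = \<ominus>\<^bsub>L\<^esub> \<delta> x"
  using abelian_group.minus_equality[OF abelian_group, of "\<delta> (- x)" "\<delta> x"]
  by (simp add: \<delta>_add[symmetric] \<delta>_0 M_uminus \<delta>_closed)

lemma \<delta>_diff: "x \<in> M \<Longrightarrow> y \<in> M \<Longrightarrow> \<delta> (x - y) = \<delta> x \<ominus>\<^bsub>L\<^esub> \<delta> y"
  using \<delta>_add[of x "- y"] by (simp add: a_minus_def \<delta>_uminus M_uminus)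

lemma \<delta>_eq_iff: assumes "x \<in> M" "y \<in> M" shows "\<delta> x = \<delta> y \<longleftrightarrow> \<delta> (x - y) = \<zero>\<^bsub>L\<^esub>"
proof -
  interpret abelian_group L by (rule abelian_group)
  show ?thesis
  proof
    assume "\<delta> (x - y) = \<zero>\<^bsub>L\<^esub>"
    moreover have "\<delta> x = \<delta> (x - y) \<oplus>\<^bsub>L\<^esub> \<delta> y" using assms \<delta>_add[of "x - y" y] by (simp add: M_diff)
    ultimately show "\<delta> x = \<delta> y" using assms by (simp add: \<delta>_closed)
  qed (use assms in \<open>simp add: \<delta>_diff minus_eq r_neg \<delta>_closed\<close>)
qed

lemma vectorspace: "vectorspace class_ring L"
proof -
  have "module class_ring L"
  proof (rule moduleI)
    show "cring (class_ring :: 'a ring)" by (rule class_cring.is_cring)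
    show "abelian_group L" by (rule abelian_group)
  qed (auto simp: carrier_eq \<delta>_sc[symmetric] \<delta>_add[symmetric] M_sc M_add sc_add_right sc_add_left sc_mult sc_1)
  then show ?thesis by (rule vectorspace.intro) (rule class_field)
qed

lemma module: "module class_ring L"
  using vectorspace by (rule vectorspace.axioms)

definition param_subspace :: "'m set \<Rightarrow> bool" where
  "param_subspace S \<longleftrightarrow> S \<subseteq> M \<and> 0 \<in> S \<and> (\<forall>x\<in>S. \<forall>y\<in>S. x + y \<in> S) \<and> (\<forall>c. \<forall>x\<in>S. sc c x \<in> S)"

lemma submodule_image: assumes "param_subspace S" shows "submodule class_ring (\<delta> ` S) L"
proof -
  have S: "x \<in> S \<Longrightarrow> x \<in> M" for x using assms by (auto simp: param_subspace_def)
  show ?thesis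
  proof (intro submodule.intro module)
    show "\<zero>\<^bsub>L\<^esub> \<in> \<delta> ` S" using assms by (auto simp: param_subspace_def \<delta>_0[symmetric])
    show "v \<oplus>\<^bsub>L\<^esub> w \<in> \<delta> ` S" if "v \<in> \<delta> ` S" "w \<in> \<delta> ` S" for v w
    proof -
      obtain x y where "x \<in> S" "y \<in> S" "v = \<delta> x" "w = \<delta> y" using \<open>v \<in> \<delta> ` S\<close> \<open>w \<in> \<delta> ` S\<close> by blast
      then have "v \<oplus>\<^bsub>L\<^esub> w = \<delta> (x + y)" "x + y \<in> S" using assms by (auto simp: param_subspace_def \<delta>_add S)
      then show ?thesis by blast
    qed
    show "c \<odot>\<^bsub>L\<^esub> v \<in> \<delta> ` S" if "v \<in> \<delta> ` S" for c v
    proof -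
      obtain x where "x \<in> S" "v = \<delta> x" using \<open>v \<in> \<delta> ` S\<close> by blast
      then have "c \<odot>\<^bsub>L\<^esub> v = \<delta> (sc c x)" "sc c x \<in> S" using assms by (auto simp: param_subspace_def \<delta>_sc S)
      then show ?thesis by blast
    qed
  qed (auto simp: carrier_eq S)
qed

lemma subspace_image: "param_subspace S \<Longrightarrow> VectorSpace.subspace class_ring (\<delta> ` S) L"
  by (intro subspace.intro submodule_image vectorspace)

lemma sub_preimage: assumes "VectorSpace.subspace class_ring I L" shows "param_subspace {x \<in> M. \<delta> x \<in> I}"
proof -
  interpret submodule class_ring I L using assms by (rule subspace.submod)
  show ?thesis using m_closed smult_closed zero_closed
    by (auto simp: param_subspace_def M_0 M_add M_sc \<delta>_0 \<delta>_add \<delta>_sc)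
qed

lemma lspan_subset: "X \<subseteq> \<delta> ` S \<Longrightarrow> param_subspace S \<Longrightarrow> lspan L X \<subseteq> \<delta> ` S"
  using module.span_is_subset[OF module] submodule_image by blast
lemma in_lspan: "u \<in> X \<Longrightarrow> X \<subseteq> carrier L \<Longrightarrow> u \<in> lspan L X"
  using module.in_own_span[OF module] by blast
lemma lspan_submodule: "X \<subseteq> carrier L \<Longrightarrow> submodule class_ring (lspan L X) L"
  using module.span_is_submodule[OF module] by blast

lemma coset_eq: assumes "J \<subseteq> M" "x \<in> M" shows "\<delta> ` J +>\<^bsub>L\<^esub> \<delta> x = (\<lambda>j. \<delta> (j + x)) ` J"
  using assms by (auto simp: a_r_coset_def' \<delta>_add subset_eq)

lemma coset_eq_iff:
  assumes J: "param_subspace J" and ker: "\<And>x. x \<in> M \<Longrightarrow> \<delta> x = \<zero>\<^bsub>L\<^esub> \<Longrightarrow> x \<in> J" and xy: "x \<in> M" "y \<in> M"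
  shows "\<delta> ` J +>\<^bsub>L\<^esub> \<delta> x = \<delta> ` J +>\<^bsub>L\<^esub> \<delta> y \<longleftrightarrow> x - y \<in> J"
proof -
  have JM: "J \<subseteq> M" and J0: "0 \<in> J" and J_add: "\<And>a b. a \<in> J \<Longrightarrow> b \<in> J \<Longrightarrow> a + b \<in> J"
    and J_sc: "\<And>c a. a \<in> J \<Longrightarrow> sc c a \<in> J" using J by (auto simp: param_subspace_def)
  have sc_m1: "sc (- 1) a = - a" for a
    using sc_add_left[of 1 "- 1" a] by (simp add: sc_1 eq_neg_iff_add_eq_0 add.commute)
  have J_uminus: "a \<in> J \<Longrightarrow> - a \<in> J" for a using J_sc[of a "- 1"] by (simp add: sc_m1)
  show ?thesis unfolding coset_eq[OF JM xy(1)] coset_eq[OF JM xy(2)]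
  proof
    assume "(\<lambda>j. \<delta> (j + x)) ` J = (\<lambda>j. \<delta> (j + y)) ` J"
    then have "\<delta> (0 + x) \<in> (\<lambda>j. \<delta> (j + y)) ` J" using J0 by blast
    then obtain j where j: "j \<in> J" "\<delta> x = \<delta> (j + y)" by auto
    then have jM: "j + y \<in> M" using JM xy by (auto intro: M_add)
    have "x - (j + y) \<in> J" using \<delta>_eq_iff[OF xy(1) jM] j(2) ker[OF M_diff[OF xy(1) jM]] by simp
    then show "x - y \<in> J" using J_add[OF j(1)]
      by (metis add_diff_cancel_left' diff_add_eq_diff_diff_swap add.commute diff_add_cancel)
  next
    assume xy': "x - y \<in> J"
    have "\<delta> (j + x) \<in> (\<lambda>j. \<delta> (j + y)) ` J" if "j \<in> J" for j
      by (rule image_eqI[of _ _ "j + (x - y)"]) (use J_add[OF that xy'] in simp_all)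
    moreover have "\<delta> (j + y) \<in> (\<lambda>j. \<delta> (j + x)) ` J" if "j \<in> J" for j
      by (rule image_eqI[of _ _ "j + - (x - y)"]) (use J_add[OF that J_uminus[OF xy']] in simp_all)
    ultimately show "(\<lambda>j. \<delta> (j + x)) ` J = (\<lambda>j. \<delta> (j + y)) ` J" by blast
  qed
qed

text \<open>
  The same \<open>M\<close> parametrises the quotient by the image of \<open>J\<close>. This covers the quotient by the relations
  of a presentation as well as the quotient by inner derivations.
\<close>

lemma quotient:
  assumes J: "param_subspace J" and ker: "\<And>x. x \<in> M \<Longrightarrow> \<delta> x = \<zero>\<^bsub>L\<^esub> \<Longrightarrow> x \<in> J"
    and pr_add_left: "\<And>x y z. pr (x + y) z = pr x z + pr y z"
    and pr_add_right: "\<And>x y z. pr x (y + z) = pr x y + pr x z"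
    and pr_J: "\<And>j x. j \<in> J \<Longrightarrow> x \<in> M \<Longrightarrow> pr j x \<in> J" "\<And>j x. j \<in> J \<Longrightarrow> x \<in> M \<Longrightarrow> pr x j \<in> J"
  shows "parametrized_algebra (quot_alg L (\<delta> ` J)) M sc pr (\<lambda>x. \<delta> ` J +>\<^bsub>L\<^esub> \<delta> x)"
proof -
  have JM: "J \<subseteq> M" and J0: "0 \<in> J" and J_add: "\<And>a b. a \<in> J \<Longrightarrow> b \<in> J \<Longrightarrow> a + b \<in> J"
    and J_sc: "\<And>c a. a \<in> J \<Longrightarrow> sc c a \<in> J" using J by (auto simp: param_subspace_def)
  note coset = coset_eq[OF JM] and eq_iff = coset_eq_iff[OF J ker]
  show ?thesis
  proof (unfold_locales, goal_cases)
    case 10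
    show ?case by (auto simp: quot_alg_def A_RCOSETS_def' carrier_eq)
  next
    case 11
    show ?case using coset[OF M_0] by (simp add: quot_alg_def)
  next
    case (12 x y)
    have "(\<delta> ` J +>\<^bsub>L\<^esub> \<delta> x) <+>\<^bsub>L\<^esub> (\<delta> ` J +>\<^bsub>L\<^esub> \<delta> y) = (\<lambda>j. \<delta> (j + (x + y))) ` J" (is "?l = ?r")
    proof (intro equalityI subsetI)
      fix u assume "u \<in> ?l"
      then obtain i j where ij: "i \<in> J" "j \<in> J" "u = \<delta> (i + x) \<oplus>\<^bsub>L\<^esub> \<delta> (j + y)"
        unfolding coset[OF 12(1)] coset[OF 12(2)] set_add_def' by blast
      then have "u = \<delta> ((i + j) + (x + y))" using JM 12
        by (simp add: \<delta>_add[symmetric] M_add subset_eq add_ac)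
      then show "u \<in> ?r" using J_add ij by blast
    next
      fix u assume "u \<in> ?r"
      then obtain j where j: "j \<in> J" "u = \<delta> (j + (x + y))" by blast
      then have "u = \<delta> (j + x) \<oplus>\<^bsub>L\<^esub> \<delta> (0 + y)" using JM 12
        by (simp add: \<delta>_add[symmetric] M_add subset_eq add_ac)
      then show "u \<in> ?l" unfolding coset[OF 12(1)] coset[OF 12(2)] set_add_def' using j(1) J0 by blast
    qed
    then show ?case using coset[of "x + y"] 12 by (simp add: quot_alg_def M_add)
  next
    case (13 x c)
    have "\<delta> ` J +>\<^bsub>L\<^esub> (c \<odot>\<^bsub>L\<^esub> u) = \<delta> ` J +>\<^bsub>L\<^esub> \<delta> (sc c x)" if "u \<in> \<delta> ` J +>\<^bsub>L\<^esub> \<delta> x" for u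
    proof -
      from that obtain j where j: "j \<in> J" "u = \<delta> (j + x)" unfolding coset[OF 13] by blast
      then have "j + x \<in> M" using JM 13 by (auto intro: M_add)
      moreover have "sc c (j + x) - sc c x \<in> J" using J_sc[OF j(1)] by (simp add: sc_add_right)
      ultimately have "\<delta> ` J +>\<^bsub>L\<^esub> \<delta> (sc c (j + x)) = \<delta> ` J +>\<^bsub>L\<^esub> \<delta> (sc c x)" using 13
        by (subst eq_iff) (simp_all add: M_sc)
      then show ?thesis using j \<open>j + x \<in> M\<close> by (simp add: \<delta>_sc)
    qed
    moreover have "\<delta> ` J +>\<^bsub>L\<^esub> \<delta> x \<noteq> {}" unfolding coset[OF 13] using J0 by blast
    ultimately show ?case by (auto simp: quot_alg_def)
  next
    case (14 x y)
    have "\<delta> ` J +>\<^bsub>L\<^esub> (u \<otimes>\<^bsub>L\<^esub> v) = \<delta> ` J +>\<^bsub>L\<^esub> \<delta> (pr x y)"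
      if "u \<in> \<delta> ` J +>\<^bsub>L\<^esub> \<delta> x" "v \<in> \<delta> ` J +>\<^bsub>L\<^esub> \<delta> y" for u v
    proof -
      from that(1) obtain i where i: "i \<in> J" "u = \<delta> (i + x)" unfolding coset[OF 14(1)] by blast
      from that(2) obtain j where j: "j \<in> J" "v = \<delta> (j + y)" unfolding coset[OF 14(2)] by blast
      have M: "i \<in> M" "j \<in> M" "i + x \<in> M" "j + y \<in> M" using i j JM 14 by (auto intro: M_add)
      have "pr (i + x) (j + y) - pr x y = pr i j + pr i y + pr x j"
        by (simp add: pr_add_left pr_add_right)
      moreover have "pr i j + pr i y + pr x j \<in> J" by (intro J_add pr_J) (use i j M 14 in auto)
      ultimately have "\<delta> ` J +>\<^bsub>L\<^esub> \<delta> (pr (i + x) (j + y)) = \<delta> ` J +>\<^bsub>L\<^esub> \<delta> (pr x y)" using 14 M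
        by (subst eq_iff) (simp_all add: M_pr)
      then show ?thesis using i j M by (simp add: \<delta>_pr)
    qed
    moreover have "\<delta> ` J +>\<^bsub>L\<^esub> \<delta> x \<noteq> {}" "\<delta> ` J +>\<^bsub>L\<^esub> \<delta> y \<noteq> {}"
      unfolding coset[OF 14(1)] coset[OF 14(2)] using J0 by blast+
    ultimately have "(\<Union>u\<in>\<delta> ` J +>\<^bsub>L\<^esub> \<delta> x. \<Union>v\<in>\<delta> ` J +>\<^bsub>L\<^esub> \<delta> y. \<delta> ` J +>\<^bsub>L\<^esub> (u \<otimes>\<^bsub>L\<^esub> v))
        = \<delta> ` J +>\<^bsub>L\<^esub> \<delta> (pr x y)"
      by blast
    then show ?case by (simp add: quot_alg_def rcoset_mult_def)
  qed (simp_all add: M_0 M_add M_uminus M_sc M_pr sc_add_right sc_add_left sc_mult sc_1)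
qed

end

lemma (in parametrized_algebra) lincomb_image:
  assumes "finite X" "X \<subseteq> M" "inj_on \<delta> X"
  shows "module.lincomb L a (\<delta> ` X) = \<delta> (\<Sum>x\<in>X. sc (a (\<delta> x)) x)"
proof -
  interpret V: vectorspace class_ring L by (rule vectorspace)
  have M_sum: "sum F Y \<in> M" if "\<And>x. x \<in> Y \<Longrightarrow> F x \<in> M" for F :: "'m \<Rightarrow> 'm" and Y
    using that by (induction Y rule: infinite_finite_induct) (simp_all add: M_0 M_add)
  have "finsum L (\<lambda>v. a v \<odot>\<^bsub>L\<^esub> v) (\<delta> ` X) = \<delta> (\<Sum>x\<in>X. sc (a (\<delta> x)) x)"
    using assms
  proof (induction X rule: finite_induct)
    case empty then show ?case by (simp add: \<delta>_0)
  next
    case (insert x X)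
    have "\<delta> x \<notin> \<delta> ` X" using insert by (auto simp: inj_on_def)
    moreover have "(\<lambda>v. a v \<odot>\<^bsub>L\<^esub> v) \<in> \<delta> ` X \<rightarrow> carrier L"
      using insert by (auto simp: \<delta>_sc[symmetric] M_sc intro!: \<delta>_closed)
    moreover have "a (\<delta> x) \<odot>\<^bsub>L\<^esub> \<delta> x = \<delta> (sc (a (\<delta> x)) x)" "sc (a (\<delta> x)) x \<in> M" using insert
      by (simp_all add: \<delta>_sc M_sc)
    moreover have "(\<Sum>x\<in>X. sc (a (\<delta> x)) x) \<in> M" using insert by (intro M_sum) (auto intro: M_sc)
    ultimately show ?case using insert by (simp add: \<delta>_add \<delta>_closed)
  qed
  then show ?thesis by (simp add: V.lincomb_def)
qed

lemma (in parametrized_algebra) dim_eq_card: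
  assumes B: "finite B" "B \<subseteq> M" and inj: "\<And>x. x \<in> M \<Longrightarrow> \<delta> x = \<zero>\<^bsub>L\<^esub> \<Longrightarrow> x = 0"
    and indep: "\<And>a. (\<Sum>x\<in>B. sc (a x) x) = 0 \<Longrightarrow> \<forall>x\<in>B. a x = 0"
    and span: "\<And>S x. param_subspace S \<Longrightarrow> B \<subseteq> S \<Longrightarrow> x \<in> M \<Longrightarrow> x \<in> S"
  shows "vectorspace.fin_dim class_ring L" "vectorspace.dim class_ring L = card B"
proof -
  interpret V: vectorspace class_ring L by (rule vectorspace)
  have inj': "inj_on \<delta> M"
  proof (rule inj_onI)
    fix x y assume "x \<in> M" "y \<in> M" "\<delta> x = \<delta> y"
    then have "x - y = 0" using \<delta>_eq_iff inj M_diff by blast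
    then show "x = y" by simp
  qed
  have injB: "inj_on \<delta> B" using inj' B(2) by (rule inj_on_subset)
  have BL: "\<delta> ` B \<subseteq> carrier L" using B(2) \<delta>_closed by blast
  have fin: "finite (\<delta> ` B)" using B(1) by simp
  have M_sum: "sum F Y \<in> M" if "\<And>x. x \<in> Y \<Longrightarrow> F x \<in> M" for F :: "'m \<Rightarrow> 'm" and Y
    using that by (induction Y rule: infinite_finite_induct) (simp_all add: M_0 M_add)
  have "\<not> V.lin_dep (\<delta> ` B)"
  proof (rule V.finite_lin_indpt2[OF fin BL])
    fix a assume "V.lincomb a (\<delta> ` B) = \<zero>\<^bsub>L\<^esub>"
    then have "\<delta> (\<Sum>x\<in>B. sc (a (\<delta> x)) x) = \<zero>\<^bsub>L\<^esub>" using lincomb_image[OF B injB] by simp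
    moreover have "(\<Sum>x\<in>B. sc (a (\<delta> x)) x) \<in> M" using B by (intro M_sum) (auto intro: M_sc)
    ultimately have "(\<Sum>x\<in>B. sc (a (\<delta> x)) x) = 0" using inj by blast
    then have "\<forall>x\<in>B. a (\<delta> x) = 0" by (rule indep)
    then show "\<forall>v\<in>\<delta> ` B. a v = \<zero>\<^bsub>class_ring\<^esub>" by simp
  qed
  moreover have gen: "V.gen_set (\<delta> ` B)"
  proof
    show "lspan L (\<delta> ` B) \<subseteq> carrier L" using lspan_submodule[OF BL] by (rule submodule.subset)
    have s: "param_subspace {x \<in> M. \<delta> x \<in> lspan L (\<delta> ` B)}"
      by (intro sub_preimage subspace.intro vectorspace lspan_submodule BL)
    have "B \<subseteq> {x \<in> M. \<delta> x \<in> lspan L (\<delta> ` B)}" using in_lspan[OF _ BL] B(2) by blast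
    then show "carrier L \<subseteq> lspan L (\<delta> ` B)" unfolding carrier_eq using span[OF s] by blast
  qed
  ultimately have "V.basis (\<delta> ` B)" using BL by (simp add: V.basis_def)
  then have "V.dim = card (\<delta> ` B)" by (rule V.dim_basis[OF fin])
  then show "V.dim = card B" using card_image[OF injB] by simp
  show "V.fin_dim" unfolding V.fin_dim_def using fin BL gen by blast
qed

section \<open>Free algebras\<close>

lemma single_eq_word: "Poly_Mapping.single (Word ws) c = fconst c * prod_list (map fvar ws)"
  for c :: "'a::field"
proof (induction ws arbitrary: c rule: rev_induct)
  case Nil then show ?case by (simp add: fconst_def zero_free_word_def)
next
  case (snoc g ws)
  have "Poly_Mapping.single (Word (ws @ [g])) c = Poly_Mapping.single (Word ws) c * fvar g"
    by (simp add: fvar_def mult_single plus_free_word_def)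
  then show ?case using snoc by (simp add: mult.assoc)
qed

lemma fconst_add: "fconst (a + b) = fconst a + fconst b"
  and fconst_mult: "fconst (a * b) = fconst a * fconst b"
  and fconst_1: "fconst 1 = 1" and fconst_0: "fconst 0 = 0"
  by (simp_all add: fconst_def single_add mult_single)

lemma sum_singles: "(\<Sum>w\<in>Poly_Mapping.keys u. Poly_Mapping.single w (Poly_Mapping.lookup u w)) = u"
  by (rule poly_mapping_eqI) (auto simp: lookup_sum lookup_single when_def in_keys_iff)

lemma fconst_central:
  fixes u :: "('g, 'a::field) free_alg"
  shows "fconst c * u = u * fconst c"
proof -
  have "fconst c * Poly_Mapping.single w a = Poly_Mapping.single w a * fconst c"
    for w :: "'g free_word" and a
    by (simp add: fconst_def mult_single mult.commute)
  then have "fconst c * (\<Sum>w\<in>Poly_Mapping.keys u. Poly_Mapping.single w (Poly_Mapping.lookup u w))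
     = (\<Sum>w\<in>Poly_Mapping.keys u. Poly_Mapping.single w (Poly_Mapping.lookup u w)) * fconst c"
    by (simp add: sum_distrib_left sum_distrib_right)
  then show ?thesis by (simp only: sum_singles)
qed

lemma free_alg_induct [case_names one add const var]:
  fixes u :: "('g, 'a::field) free_alg"
  assumes "P 1" "\<And>u v. P u \<Longrightarrow> P v \<Longrightarrow> P (u + v)" "\<And>c u. P u \<Longrightarrow> P (fconst c * u)"
    "\<And>g u. P u \<Longrightarrow> P (fvar g * u)"
  shows "P u"
proof -
  have P0: "P 0" using assms(3)[OF assms(1), of 0] by (simp add: fconst_0)
  have "P (prod_list (map fvar ws))" for ws by (induction ws) (simp_all add: assms)
  then have "P (Poly_Mapping.single w c)" for w c
    using assms(3) by (cases w) (simp add: single_eq_word)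
  then have "P (\<Sum>w\<in>A. Poly_Mapping.single w (Poly_Mapping.lookup u w))" for A
    by (induction A rule: infinite_finite_induct) (simp_all add: P0 assms(2))
  then show ?thesis using sum_singles by metis
qed

text \<open>
  The scalars \<open>\<sigma> a\<close> commute with the values of the generators, but not necessarily with all of the target
  ring: in a ring of additive maps they are not central.
\<close>

locale free_alg_eval =
  fixes \<sigma> :: "'a::field \<Rightarrow> 'r::ring_1" and \<gamma> :: "'g \<Rightarrow> 'r"
  assumes \<sigma>_add: "\<sigma> (a + b) = \<sigma> a + \<sigma> b" and \<sigma>_mult: "\<sigma> (a * b) = \<sigma> a * \<sigma> b" and \<sigma>_1: "\<sigma> 1 = 1"
    and \<sigma>_central: "\<sigma> a * \<gamma> g = \<gamma> g * \<sigma> a"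
begin

definition ev :: "('g, 'a) free_alg \<Rightarrow> 'r" where
  "ev u = (\<Sum>w\<in>Poly_Mapping.keys u. \<sigma> (Poly_Mapping.lookup u w) * prod_list (map \<gamma> (letters w)))"

lemma \<sigma>_0: "\<sigma> 0 = 0" using \<sigma>_add[of 0 0] by simp

lemma ev_add: "ev (u + v) = ev u + ev v"
  unfolding ev_def by (rule setsum_keys_plus_distrib) (simp_all add: \<sigma>_0 \<sigma>_add distrib_right)
lemma ev_0: "ev 0 = 0" by (simp add: ev_def)
lemma ev_uminus: "ev (- u) = - ev u" using ev_add[of u "- u"]
  by (simp add: ev_0 eq_neg_iff_add_eq_0 add.commute)
lemma ev_diff: "ev (u - v) = ev u - ev v" using ev_add[of u "- v"] by (simp add: ev_uminus)
lemma ev_sum: "ev (sum f A) = (\<Sum>x\<in>A. ev (f x))"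
  by (induction A rule: infinite_finite_induct) (simp_all add: ev_add ev_0)
lemma ev_single: "ev (Poly_Mapping.single w c) = \<sigma> c * prod_list (map \<gamma> (letters w))"
  by (simp add: ev_def \<sigma>_0)
lemma ev_fconst: "ev (fconst c) = \<sigma> c" by (simp add: fconst_def ev_single zero_free_word_def)
lemma ev_fvar: "ev (fvar g) = \<gamma> g" by (simp add: fvar_def ev_single \<sigma>_1)
lemma ev_1: "ev 1 = 1" using ev_fconst[of 1] by (simp add: fconst_1 \<sigma>_1)

lemma ev_mult: "ev (u * v) = ev u * ev v"
proof (induction u rule: free_alg_induct)
  case (const c u)
  have "ev (fconst c * v) = \<sigma> c * ev v" for v
  proof -
    have "ev (fconst c * (\<Sum>w\<in>Poly_Mapping.keys v. Poly_Mapping.single w (Poly_Mapping.lookup v w)))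
      = \<sigma> c * ev (\<Sum>w\<in>Poly_Mapping.keys v. Poly_Mapping.single w (Poly_Mapping.lookup v w))"
      by (simp add: sum_distrib_left ev_sum ev_single fconst_def mult_single \<sigma>_mult mult.assoc)
    then show ?thesis by (simp only: sum_singles)
  qed
  then show ?case using const by (simp add: mult.assoc)
next
  case (var g u)
  have "ev (fvar g * v) = \<gamma> g * ev v" for v
  proof -
    have "ev (fvar g * Poly_Mapping.single w c) = \<gamma> g * ev (Poly_Mapping.single w c)" for w c
    proof -
      have "ev (fvar g * Poly_Mapping.single w c) = \<sigma> c * (\<gamma> g * prod_list (map \<gamma> (letters w)))"
        by (simp add: ev_single fvar_def mult_single plus_free_word_def)
      also have "\<dots> = \<gamma> g * (\<sigma> c * prod_list (map \<gamma> (letters w)))"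
        unfolding mult.assoc[symmetric] \<sigma>_central[of c g] ..
      finally show ?thesis by (simp only: ev_single)
    qed
    then have "ev (fvar g * (\<Sum>w\<in>Poly_Mapping.keys v. Poly_Mapping.single w (Poly_Mapping.lookup v w)))
      = \<gamma> g * ev (\<Sum>w\<in>Poly_Mapping.keys v. Poly_Mapping.single w (Poly_Mapping.lookup v w))"
      by (simp add: sum_distrib_left ev_sum)
    then show ?thesis by (simp only: sum_singles)
  qed
  then show ?case using var by (simp add: mult.assoc)
qed (simp_all add: ev_1 ev_add distrib_right)

lemma ev_power: "ev (u ^ n) = ev u ^ n" by (induction n) (simp_all add: ev_1 ev_mult)

end

lemma fpoly_eq_sum: "degree p \<le> n \<Longrightarrow> fpoly p u = (\<Sum>i\<le>n. fconst (coeff p i) * u ^ i)"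
  unfolding fpoly_def by (rule sum.mono_neutral_left) (auto simp: coeff_eq_0 not_le fconst_0)
lemma fpoly_0: "fpoly 0 u = 0" by (simp add: fpoly_def fconst_0)
lemma fpoly_const: "fpoly [:c:] u = fconst c" by (simp add: fpoly_def)
lemma fpoly_1: "fpoly 1 u = 1" using fpoly_const[of 1 u] by (simp add: fconst_1 one_pCons)
lemma fpoly_add: "fpoly (p + q) u = fpoly p u + fpoly q u"
proof -
  let ?n = "max (degree p) (degree q)"
  have "degree (p + q) \<le> ?n" by (rule degree_add_le_max)
  note 1 = fpoly_eq_sum[OF this, of u]
  have 2: "fpoly p u = (\<Sum>i\<le>?n. fconst (coeff p i) * u ^ i)" "fpoly q u = (\<Sum>i\<le>?n. fconst (coeff q i) * u ^ i)"
    by (rule fpoly_eq_sum, simp)+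
  show ?thesis unfolding 1 2 by (simp add: distrib_right fconst_add sum.distrib)
qed
lemma fpoly_pCons: "fpoly (pCons a p) u = fconst a + u * fpoly p u"
proof -
  have "fpoly (pCons a p) u = (\<Sum>i\<le>Suc (degree p). fconst (coeff (pCons a p) i) * u ^ i)"
    by (rule fpoly_eq_sum) (rule degree_pCons_le)
  also have "\<dots> = fconst a + (\<Sum>i\<le>degree p. fconst (coeff p i) * (u * u ^ i))"
    by (subst sum.atMost_Suc_shift) simp
  also have "(\<Sum>i\<le>degree p. fconst (coeff p i) * (u * u ^ i)) = u * fpoly p u"
    unfolding fpoly_def sum_distrib_left
    by (rule sum.cong) (simp_all only: mult.assoc[symmetric] fconst_central[of _ u])
  finally show ?thesis .
qed
lemma fpoly_smult: "fpoly (Polynomial.smult c p) u = fconst c * fpoly p u"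
proof (induction p)
  case (pCons a p)
  have "fconst c * (u * fpoly p u) = u * (fconst c * fpoly p u)"
    unfolding mult.assoc[symmetric] fconst_central[of c u] ..
  then show ?case using pCons by (simp add: fpoly_pCons fconst_mult distrib_left)
qed (simp add: fpoly_0)
lemma fpoly_mult: "fpoly (p * q) u = fpoly p u * fpoly q u"
proof (induction p)
  case (pCons a p)
  then show ?case
    by (simp add: fpoly_add fpoly_smult fpoly_pCons fconst_0 distrib_right mult.assoc)
qed (simp add: fpoly_0)
lemma fpoly_X: "fpoly [:0, 1:] u = u" by (simp add: fpoly_pCons fpoly_0 fconst_0 fconst_1)
lemma fpoly_commute: "fpoly p u * fpoly q u = fpoly q u * fpoly p u"
  by (simp only: fpoly_mult[symmetric] mult.commute)

lemma fpoly_power: "fpoly (p ^ n) u = fpoly p u ^ n"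
  by (induction n) (simp_all add: fpoly_1 fpoly_mult)

section \<open>Presented algebras\<close>

lemma free_algebra_simps [simp]:
  "carrier free_algebra = UNIV" "mult free_algebra = (*)" "one free_algebra = 1"
  "zero free_algebra = 0" "add free_algebra = (+)" "module.smult free_algebra = (\<lambda>c u. fconst c * u)"
  by (simp_all add: free_algebra_def)

lemma ring_free_algebra: "ring free_algebra"
proof (rule ringI)
  show "abelian_group free_algebra"
    by (rule abelian_groupI) (auto simp: add_ac intro: exI[of _ "- _"] left_minus)
  show "monoid free_algebra" by (rule monoidI) (auto simp: mult.assoc)
qed (auto simp: distrib_left distrib_right)

lemma ideal_free_algebraI:
  assumes "0 \<in> I" "\<And>u v. u \<in> I \<Longrightarrow> v \<in> I \<Longrightarrow> u + v \<in> I" "\<And>u v. u \<in> I \<Longrightarrow> v * u \<in> I" "\<And>u v. u \<in> I \<Longrightarrow> u * v \<in> I"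
  shows "ideal I free_algebra"
proof (rule idealI[OF ring_free_algebra])
  interpret ring free_algebra by (rule ring_free_algebra)
  have um: "- u \<in> I" if "u \<in> I" for u using assms(3)[OF that, of "- 1"] by simp
  have "\<ominus>\<^bsub>free_algebra\<^esub> u = - u" for u by (rule minus_equality) simp_all
  then have inv: "inv\<^bsub>add_monoid free_algebra\<^esub> u = - u" for u unfolding a_inv_def .
  show "subgroup I (add_monoid free_algebra)"
  proof (rule subgroup.intro)
    show "inv\<^bsub>add_monoid free_algebra\<^esub> u \<in> I" if "u \<in> I" for u unfolding inv using um[OF that] .
  qed (simp_all add: assms)
qed (use assms in auto)

lemma
  shows rel_ideal_superset: "u \<in> S \<Longrightarrow> u \<in> rel_ideal S"
    and rel_ideal_0: "0 \<in> rel_ideal S"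
    and rel_ideal_add: "u \<in> rel_ideal S \<Longrightarrow> v \<in> rel_ideal S \<Longrightarrow> u + v \<in> rel_ideal S"
    and rel_ideal_lmult: "u \<in> rel_ideal S \<Longrightarrow> v * u \<in> rel_ideal S"
    and rel_ideal_rmult: "u \<in> rel_ideal S \<Longrightarrow> u * v \<in> rel_ideal S"
proof -
  interpret ring free_algebra by (rule ring_free_algebra)
  interpret ideal "rel_ideal S" free_algebra unfolding rel_ideal_def by (rule genideal_ideal) simp
  show "u \<in> S \<Longrightarrow> u \<in> rel_ideal S" using genideal_self[of S] by (auto simp: rel_ideal_def)
  show "0 \<in> rel_ideal S" using zero_closed by simp
  show "u \<in> rel_ideal S \<Longrightarrow> v \<in> rel_ideal S \<Longrightarrow> u + v \<in> rel_ideal S" using a_closed by simp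
  show "u \<in> rel_ideal S \<Longrightarrow> v * u \<in> rel_ideal S" using I_l_closed by simp
  show "u \<in> rel_ideal S \<Longrightarrow> u * v \<in> rel_ideal S" using I_r_closed by simp
qed

lemma rel_ideal_uminus: "u \<in> rel_ideal S \<Longrightarrow> - u \<in> rel_ideal S"
  using rel_ideal_lmult[of u S "- 1"] by simp
lemma rel_ideal_diff: "u \<in> rel_ideal S \<Longrightarrow> v \<in> rel_ideal S \<Longrightarrow> u - v \<in> rel_ideal S"
  using rel_ideal_add[OF _ rel_ideal_uminus] by (metis add_uminus_conv_diff)

lemma (in free_alg_eval) ev_rel_ideal:
  assumes "\<And>u. u \<in> S \<Longrightarrow> ev u = 0" "u \<in> rel_ideal S"
  shows "ev u = 0"
proof -
  interpret ring free_algebra by (rule ring_free_algebra)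
  have "ideal {u. ev u = 0} free_algebra"
    by (rule ideal_free_algebraI) (auto simp: ev_0 ev_add ev_mult)
  then have "rel_ideal S \<subseteq> {u. ev u = 0}" unfolding rel_ideal_def
    using genideal_minimal assms(1) by blast
  then show ?thesis using assms(2) by blast
qed

interpretation free_algebra: parametrized_algebra free_algebra UNIV "\<lambda>c u. fconst c * u" "(*)" "\<lambda>u. u"
  by unfold_locales (auto simp: fconst_add fconst_mult fconst_1 ring_distribs mult.assoc)

lemma parametrized_presented: "parametrized_algebra (presented S) UNIV (\<lambda>c u. fconst c * u) (*) (cls S)"
  and cls_eq_iff: "cls S u = cls S v \<longleftrightarrow> u - v \<in> rel_ideal S"
proof -
  have J: "free_algebra.param_subspace (rel_ideal S)"
    by (auto simp: free_algebra.param_subspace_def rel_ideal_0 rel_ideal_add rel_ideal_lmult)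
  show "parametrized_algebra (presented S) UNIV (\<lambda>c u. fconst c * u) (*) (cls S)"
    using free_algebra.quotient[OF J]
    by (simp add: presented_def cls_def[abs_def] rel_ideal_0 distrib_left distrib_right rel_ideal_lmult rel_ideal_rmult)
  show "cls S u = cls S v \<longleftrightarrow> u - v \<in> rel_ideal S"
    using free_algebra.coset_eq_iff[OF J, of u v] by (simp add: cls_def rel_ideal_0)
qed

lemma one_presented: "\<one>\<^bsub>presented S\<^esub> = cls S 1"
  by (simp add: presented_def quot_alg_def cls_def)

context free_alg_eval
begin

text \<open>
  If the kernel of the evaluation is the ideal of relations, this is the inverse of the induced
  isomorphism from the presented algebra to the range of the evaluation.
\<close>

definition lift :: "('g, 'a) free_alg set \<Rightarrow> 'r \<Rightarrow> ('g, 'a) free_alg set" where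
  "lift S e = cls S (SOME u. ev u = e)"

context
  fixes S :: "('g, 'a) free_alg set"
  assumes ker: "\<And>u. ev u = 0 \<longleftrightarrow> u \<in> rel_ideal S"
begin

lemma lift_ev: "lift S (ev u) = cls S u"
proof -
  have "ev (SOME v. ev v = ev u) = ev u" by (rule someI) simp
  then show ?thesis unfolding lift_def cls_eq_iff ker[symmetric] by (simp add: ev_diff)
qed

lemma inj_lift: "inj_on (lift S) (range ev)"
  by (rule inj_onI) (auto simp: lift_ev cls_eq_iff ker[symmetric] ev_diff)

lemma parametrized_lift: "parametrized_algebra (presented S) (range ev) (\<lambda>c e. \<sigma> c * e) (*) (lift S)"
proof -
  interpret P: parametrized_algebra "presented S" UNIV "\<lambda>c u. fconst c * u" "(*)" "cls S"
    by (rule parametrized_presented)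
  show ?thesis
  proof (unfold_locales, goal_cases)
    case 1 show ?case using ev_0 by (metis rangeI)
  next
    case (2 x y) then show ?case by (auto simp: ev_add[symmetric])
  next
    case (3 x) then show ?case by (auto simp: ev_uminus[symmetric])
  next
    case (4 x c) then show ?case by (auto simp: ev_fconst[symmetric] ev_mult[symmetric])
  next
    case (5 x y) then show ?case by (auto simp: ev_mult[symmetric])
  next
    case 10 show ?case by (auto simp: P.carrier_eq lift_ev image_def)
  next
    case 11 show ?case using lift_ev[of 0] by (simp add: ev_0 P.\<delta>_0)
  next
    case (12 x y) then show ?case by (auto simp: ev_add[symmetric] lift_ev P.\<delta>_add)
  next
    case (13 x c) then show ?case by (auto simp: ev_fconst[symmetric] ev_mult[symmetric] lift_ev P.\<delta>_sc)
  next
    case (14 x y) then show ?case by (auto simp: ev_mult[symmetric] lift_ev P.\<delta>_pr)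
  qed (simp_all add: \<sigma>_add \<sigma>_mult \<sigma>_1 distrib_left distrib_right mult.assoc)
qed

end

end

section \<open>Normal forms in \<open>A\<^sub>h\<close> and in the localised Weyl algebra\<close>

text \<open>
  If \<open>[y, x] = g(x)\<close>, then \<open>[y, r(x)] = g(x) r'(x)\<close>.
\<close>

lemma derivation_relation:
  assumes "y * x - x * y - fpoly g x \<in> rel_ideal S"
  shows "y * fpoly r x - fpoly r x * y - fpoly (g * pderiv r) x \<in> rel_ideal S"
proof (induction r)
  case (pCons a r)
  have gx: "fpoly g x * x = x * fpoly g x" using fpoly_commute[of g x "[:0, 1:]"] by (simp add: fpoly_X)
  have "y * fpoly (pCons a r) x - fpoly (pCons a r) x * y - fpoly (g * pderiv (pCons a r)) x
    = (y * x - x * y - fpoly g x) * fpoly r x + x * (y * fpoly r x - fpoly r x * y - fpoly (g * pderiv r) x)"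
    by (simp add: pderiv_pCons fpoly_pCons fpoly_add fpoly_mult fconst_0 algebra_simps fconst_central gx[symmetric])
  then show ?case using pCons assms by (simp only: rel_ideal_add rel_ideal_lmult rel_ideal_rmult)
qed (simp add: fpoly_0 rel_ideal_0)

definition nf :: "('g, 'a::field) free_alg \<Rightarrow> (nat \<Rightarrow> ('g, 'a) free_alg) \<Rightarrow> 'a poly poly \<Rightarrow> ('g,
    'a) free_alg" where
  "nf x b P = (\<Sum>i\<le>degree P. fpoly (coeff P i) x * b i)"

lemma nf_eq_sum: "degree P \<le> n \<Longrightarrow> nf x b P = (\<Sum>i\<le>n. fpoly (coeff P i) x * b i)"
  unfolding nf_def by (rule sum.mono_neutral_left) (auto simp: coeff_eq_0 not_le fpoly_0)
lemma nf_0: "nf x b 0 = 0" by (simp add: nf_def fpoly_0)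
lemma nf_add: "nf x b (P + P') = nf x b P + nf x b P'"
proof -
  let ?n = "max (degree P) (degree P')"
  have "degree (P + P') \<le> ?n" by (rule degree_add_le_max)
  note 1 = nf_eq_sum[OF this, of x b]
  have 2: "nf x b P = (\<Sum>i\<le>?n. fpoly (coeff P i) x * b i)" "nf x b P' = (\<Sum>i\<le>?n. fpoly (coeff P' i) x * b i)"
    by (rule nf_eq_sum, simp)+
  show ?thesis unfolding 1 2 by (simp add: distrib_right fpoly_add sum.distrib)
qed
lemma nf_smult: "nf x b (Polynomial.smult r P) = fpoly r x * nf x b P"
proof -
  have "nf x b (Polynomial.smult r P) = (\<Sum>i\<le>degree P. fpoly (coeff (Polynomial.smult r P) i) x * b i)"
    by (rule nf_eq_sum) (rule degree_smult_le)
  then show ?thesis by (simp add: nf_def fpoly_mult sum_distrib_left mult.assoc)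
qed
lemma nf_monom: "nf x b (monom r n) = fpoly r x * b n"
proof -
  have "nf x b (monom r n) = (\<Sum>i\<le>n. if i = n then fpoly r x * b n else 0)"
    unfolding nf_eq_sum[OF degree_monom_le] by (rule sum.cong) (auto simp: fpoly_0)
  then show ?thesis by simp
qed

lemma lmult_nf:
  assumes "\<And>r i. \<exists>P. y * (fpoly r x * b i) - nf x b P \<in> rel_ideal S"
  shows "\<exists>P'. y * nf x b P - nf x b P' \<in> rel_ideal S"
proof -
  have "\<exists>P'. y * (\<Sum>i\<in>A. fpoly (coeff P i) x * b i) - nf x b P' \<in> rel_ideal S" for A
  proof (induction A rule: infinite_finite_induct)
    case (insert i F)
    obtain P1 where P1: "y * (\<Sum>i\<in>F. fpoly (coeff P i) x * b i) - nf x b P1 \<in> rel_ideal S" using insert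
      by blast
    obtain P2 where P2: "y * (fpoly (coeff P i) x * b i) - nf x b P2 \<in> rel_ideal S" using assms by blast
    from rel_ideal_add[OF P2 P1]
    have "y * (\<Sum>i\<in>insert i F. fpoly (coeff P i) x * b i) - nf x b (P2 + P1) \<in> rel_ideal S"
      using insert by (simp add: nf_add distrib_left algebra_simps)
    then show ?case by blast
  qed (auto intro!: exI[of _ 0] simp: nf_0 rel_ideal_0)
  then show ?thesis by (simp add: nf_def)
qed

context weyl_calculus
begin

definition \<kappa> :: "'a \<Rightarrow> 'e" where "\<kappa> c = \<mu> (\<iota> [:c:])"

lemma d_const: "d (\<iota> [:c:]) = 0" by (simp add: d_\<iota>)

lemma \<kappa>_add: "\<kappa> (a + b) = \<kappa> a + \<kappa> b" unfolding \<kappa>_def by (simp add: \<mu>_add[symmetric] \<iota>_add[symmetric])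
lemma \<kappa>_mult: "\<kappa> (a * b) = \<kappa> a * \<kappa> b" unfolding \<kappa>_def
  by (simp add: \<mu>_mult[symmetric] \<iota>_mult[symmetric] mult.commute)
lemma \<kappa>_1: "\<kappa> 1 = 1" using \<iota>_1 \<mu>_1 by (simp add: \<kappa>_def one_pCons)
lemma \<kappa>_\<mu>: "\<kappa> c * \<mu> x = \<mu> x * \<kappa> c" by (simp add: \<kappa>_def \<mu>_mult[symmetric] mult.commute)
lemma \<kappa>_dy: "\<kappa> c * dy = dy * \<kappa> c" by (simp add: \<kappa>_def dy_\<mu> d_const)
lemma \<kappa>_Xop: "\<kappa> c * Xop = Xop * \<kappa> c" by (simp add: Xop_def \<kappa>_\<mu>)
lemma \<kappa>_Yop: "\<kappa> c * Yop = Yop * \<kappa> c"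
  by (simp only: Yop_def mult.assoc[symmetric] \<kappa>_dy) (simp only: mult.assoc \<kappa>_\<mu>)

definition A_gen :: "Ah_gen \<Rightarrow> 'e" where "A_gen g = (case g of Ah_x \<Rightarrow> Xop | Ah_y \<Rightarrow> Yop)"
definition W_gen :: "Wloc_gen \<Rightarrow> 'e" where
  "W_gen g = (case g of W_x \<Rightarrow> Xop | W_y \<Rightarrow> dy | W_hinv \<Rightarrow> \<mu> (inverse H))"

lemma A_gen_simps: "A_gen Ah_x = Xop" "A_gen Ah_y = Yop"
  and W_gen_simps: "W_gen W_x = Xop" "W_gen W_y = dy" "W_gen W_hinv = \<mu> (inverse H)"
  by (simp_all add: A_gen_def W_gen_def)

sublocale A: free_alg_eval \<kappa> A_gen
  by unfold_locales (auto simp: \<kappa>_add \<kappa>_mult \<kappa>_1 A_gen_def \<kappa>_Xop \<kappa>_Yop split: Ah_gen.split)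
sublocale W: free_alg_eval \<kappa> W_gen
  by unfold_locales (auto simp: \<kappa>_add \<kappa>_mult \<kappa>_1 W_gen_def \<kappa>_Xop \<kappa>_dy \<kappa>_\<mu> split: Wloc_gen.split)

lemma \<mu>_\<iota>_pCons: "\<mu> (\<iota> (pCons a p)) = \<kappa> a + Xop * \<mu> (\<iota> p)"
proof -
  have "pCons a p = [:a:] + [:0, 1:] * p" by simp
  then show ?thesis unfolding \<kappa>_def Xop_def
    by (simp only: \<mu>_add[symmetric] \<mu>_mult[symmetric] \<iota>_add[symmetric] \<iota>_mult[symmetric])
qed

lemma A_ev_fpoly: "A.ev (fpoly p (fvar Ah_x)) = \<mu> (\<iota> p)"
proof (induction p)
  case (pCons a p)
  then show ?case
    by (simp add: fpoly_pCons A.ev_add A.ev_mult A.ev_fconst A.ev_fvar A_gen_simps \<mu>_\<iota>_pCons)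
qed (simp add: fpoly_0 A.ev_0)

lemma W_ev_fpoly: "W.ev (fpoly p (fvar W_x)) = \<mu> (\<iota> p)"
proof (induction p)
  case (pCons a p)
  then show ?case
    by (simp add: fpoly_pCons W.ev_add W.ev_mult W.ev_fconst W.ev_fvar W_gen_simps \<mu>_\<iota>_pCons)
qed (simp add: fpoly_0 W.ev_0)

lemma sum_\<mu>_dy_eq_0:
  assumes "(\<Sum>i\<le>n. \<mu> (c i) * dy ^ i) = 0" "i \<le> n" shows "c i = 0"
proof -
  have "op (\<Sum>i\<le>n. monom (c i / H ^ i) i) = 0" using assms(1) by (simp add: op_sum \<mu>_dy_eq_op[symmetric])
  then have "(\<Sum>i\<le>n. monom (c i / H ^ i) i) = 0" by (rule op_eq_0)
  then have "coeff (\<Sum>i\<le>n. monom (c i / H ^ i) i) i = 0" by simp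
  then have "c i / H ^ i = 0" using assms(2) by (simp add: coeff_sum if_distrib cong: if_cong)
  then show ?thesis using H_nonzero by simp
qed

lemma A_ev_rels: "u \<in> Ah_rels h \<Longrightarrow> A.ev u = 0"
proof -
  have "Yop * Xop = Xop * Yop + \<mu> H"
  proof -
    have "\<mu> H * Xop = Xop * \<mu> H" by (simp add: Xop_def \<mu>_mult[symmetric] mult.commute)
    then have "Yop * Xop = dy * Xop * \<mu> H" by (simp add: Yop_def mult.assoc)
    also have "dy * Xop = Xop * dy + 1" using dy_power_Xop[of 1] by simp
    finally show ?thesis by (simp add: Yop_def distrib_right mult.assoc)
  qed
  then show "u \<in> Ah_rels h \<Longrightarrow> A.ev u = 0"
    by (simp add: Ah_rels_def A.ev_diff A.ev_mult A.ev_fvar A_ev_fpoly A_gen_simps H_def[symmetric])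
qed

lemma W_ev_rels: "u \<in> Wloc_rels h \<Longrightarrow> W.ev u = 0"
proof -
  have "dy * Xop = Xop * dy + 1" using dy_power_Xop[of 1] by simp
  moreover have "\<mu> H * \<mu> (inverse H) = 1" "\<mu> (inverse H) * \<mu> H = 1"
    using H_nonzero by (simp_all add: \<mu>_mult[symmetric] \<mu>_1)
  ultimately show "u \<in> Wloc_rels h \<Longrightarrow> W.ev u = 0"
    by (auto simp: Wloc_rels_def W.ev_diff W.ev_mult W.ev_fvar W.ev_1 W_ev_fpoly W_gen_simps H_def[symmetric])
qed

abbreviation ax where "ax \<equiv> (fvar Ah_x :: (Ah_gen, 'a) free_alg)"
abbreviation ay where "ay \<equiv> (fvar Ah_y :: (Ah_gen, 'a) free_alg)"

text \<open>
  These words represent \<open>h\<^sup>n \<partial>\<^sup>n\<close>, because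
  \<open>(\<partial> h - (n+1) h') h\<^sup>n \<partial>\<^sup>n = h\<^sup>n\<^sup>+\<^sup>1 \<partial>\<^sup>n\<^sup>+\<^sup>1\<close>. So the coefficients of a normal form are those of the symbol.
\<close>

primrec a_word :: "nat \<Rightarrow> (Ah_gen, 'a) free_alg" where
  "a_word 0 = 1"
| "a_word (Suc n) = (ay - fpoly (of_nat (Suc n) * pderiv h) ax) * a_word n"

lemma A_ev_a_word: "A.ev (a_word n) = \<mu> (H ^ n) * dy ^ n"
proof (induction n)
  case (Suc n)
  have "\<iota> (of_nat (Suc n) * pderiv h) = of_nat (Suc n) * d H" by (simp only: \<iota>_mult \<iota>_of_nat d_H)
  then have "A.ev (a_word (Suc n)) = (dy * \<mu> H - \<mu> (of_nat (Suc n) * d H)) * \<mu> (H ^ n) * dy ^ n"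
    by (simp add: A.ev_mult A.ev_diff A.ev_fvar A_ev_fpoly Suc A_gen_simps Yop_def mult.assoc del: of_nat_Suc)
  also have "(dy * \<mu> H - \<mu> (of_nat (Suc n) * d H)) * \<mu> (H ^ n) = \<mu> (H ^ Suc n) * dy"
  proof -
    have "dy * \<mu> H * \<mu> (H ^ n) = dy * \<mu> (H ^ Suc n)"
      by (simp only: mult.assoc \<mu>_mult[symmetric] power_Suc)
    also have "\<dots> = \<mu> (H ^ Suc n) * dy + \<mu> (of_nat (Suc n) * d H * H ^ n)"
      unfolding dy_\<mu> d_power by (simp only: diff_Suc_1 mult_ac)
    finally show ?thesis by (simp add: left_diff_distrib \<mu>_mult[symmetric] del: of_nat_Suc power_Suc)
  qed
  finally show ?case by (simp add: mult.assoc)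
qed (simp add: A.ev_1 \<mu>_1)

lemma A_ev_nf: "A.ev (nf ax a_word P) = op (map_poly \<iota> P)"
proof -
  have "degree (map_poly \<iota> P) \<le> degree P" by (rule degree_le) (auto simp: coeff_map_poly coeff_eq_0)
  then show ?thesis
    by (simp add: nf_def A.ev_sum A.ev_mult A_ev_fpoly A_ev_a_word op_eq_sum coeff_map_poly \<mu>_mult mult.assoc)
qed

lemma Ah_normal_form: "\<exists>P. u - nf ax a_word P \<in> rel_ideal (Ah_rels h)"
proof (induction u rule: free_alg_induct)
  case one
  have "nf ax a_word 1 = 1" using nf_monom[of ax a_word 1 0] by (simp add: fpoly_1)
  then show ?case by (metis diff_self rel_ideal_0)
next
  case (add u v)
  then obtain P P' where "u - nf ax a_word P \<in> rel_ideal (Ah_rels h)" "v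
      - nf ax a_word P' \<in> rel_ideal (Ah_rels h)" by blast
  from rel_ideal_add[OF this] show ?case by (intro exI[of _ "P + P'"]) (simp add: nf_add algebra_simps)
next
  case (const c u)
  then obtain P where "u - nf ax a_word P \<in> rel_ideal (Ah_rels h)" by blast
  from rel_ideal_lmult[OF this, of "fconst c"] show ?case
    by (intro exI[of _ "Polynomial.smult [:c:] P"]) (simp add: nf_smult fpoly_const right_diff_distrib)
next
  case (var g u)
  then obtain P where P: "u - nf ax a_word P \<in> rel_ideal (Ah_rels h)" by blast
  from rel_ideal_lmult[OF P, of "fvar g"]
  have 1: "fvar g * u - fvar g * nf ax a_word P \<in> rel_ideal (Ah_rels h)"
    by (simp add: right_diff_distrib)
  have "\<exists>P'. fvar g * nf ax a_word P - nf ax a_word P' \<in> rel_ideal (Ah_rels h)"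
  proof (cases g)
    case Ah_x
    then show ?thesis
      by (intro exI[of _ "Polynomial.smult [:0,1:] P"]) (simp add: nf_smult fpoly_X rel_ideal_0)
  next
    case Ah_y
    have "\<exists>P'. ay * nf ax a_word P - nf ax a_word P' \<in> rel_ideal (Ah_rels h)"
    proof (rule lmult_nf)
      fix r i
      have "ay * ax - ax * ay - fpoly h ax \<in> rel_ideal (Ah_rels h)"
        by (rule rel_ideal_superset) (simp add: Ah_rels_def)
      from rel_ideal_rmult[OF derivation_relation[OF this, of r], of "a_word i"]
      have "(ay * fpoly r ax - fpoly r ax * ay
          - fpoly (h * pderiv r) ax) * a_word i \<in> rel_ideal (Ah_rels h)" .
      also have "(ay * fpoly r ax - fpoly r ax * ay - fpoly (h * pderiv r) ax) * a_word i
        = ay * (fpoly r ax * a_word i) - nf ax a_word (monom r (Suc i)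
            + monom (r * (of_nat (Suc i) * pderiv h)) i + monom (h * pderiv r) i)"
        by (simp only: nf_add nf_monom fpoly_mult[of r] a_word.simps left_diff_distrib right_diff_distrib
           distrib_left mult.assoc) (simp add: algebra_simps)
      finally show "\<exists>P. ay * (fpoly r ax * a_word i) - nf ax a_word P \<in> rel_ideal (Ah_rels h)" by blast
    qed
    then show ?thesis using Ah_y by simp
  qed
  then obtain P' where "fvar g * nf ax a_word P - nf ax a_word P' \<in> rel_ideal (Ah_rels h)" by blast
  from rel_ideal_add[OF 1 this] show ?case by auto
qed

text \<open>
  Modulo the relations every element is a normal form, and a normal form that acts as zero has the symbol
  zero. Hence \<open>A\<^sub>h\<close> acts faithfully.
\<close>

lemma A_ev_eq_0_iff: "A.ev u = 0 \<longleftrightarrow> u \<in> rel_ideal (Ah_rels h)"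
proof
  assume 0: "A.ev u = 0"
  obtain P where P: "u - nf ax a_word P \<in> rel_ideal (Ah_rels h)" using Ah_normal_form by blast
  then have "A.ev (u - nf ax a_word P) = 0" using A.ev_rel_ideal A_ev_rels by blast
  then have "op (map_poly \<iota> P) = 0" using 0 by (simp add: A.ev_diff A_ev_nf)
  then have "map_poly \<iota> P = 0" by (rule op_eq_0)
  then have "P = 0" by (auto simp: poly_eq_iff coeff_map_poly \<iota>_eq_0_iff)
  then show "u \<in> rel_ideal (Ah_rels h)" using P by (simp add: nf_0)
qed (use A.ev_rel_ideal A_ev_rels in blast)

lemma range_A_ev: "range A.ev = op ` Ac"
proof (intro equalityI subsetI)
  fix e assume "e \<in> range A.ev"
  then obtain u where u: "e = A.ev u" by blast
  obtain P where P: "u - nf ax a_word P \<in> rel_ideal (Ah_rels h)" using Ah_normal_form by blast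
  then have "A.ev (u - nf ax a_word P) = 0" using A.ev_rel_ideal A_ev_rels by blast
  then have "e = op (map_poly \<iota> P)" using u by (simp add: A.ev_diff A_ev_nf)
  then show "e \<in> op ` Ac" by (auto simp: Ac_def coeff_map_poly)
next
  fix e assume "e \<in> op ` Ac"
  then obtain p where p: "e = op p" "\<And>n. coeff p n \<in> R" by (auto simp: Ac_def)
  then have "\<And>n. \<exists>r. coeff p n = \<iota> r" by (auto simp: R_def)
  then obtain r where r: "\<And>n. coeff p n = \<iota> (r n)" by metis
  have "e = A.ev (\<Sum>i\<le>degree p. fpoly (r i) ax * a_word i)"
    by (simp add: p(1) op_def A.ev_sum A.ev_mult A_ev_fpoly A_ev_a_word r \<mu>_mult mult.assoc)
  then show "e \<in> range A.ev" by blast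
qed

abbreviation wx where "wx \<equiv> (fvar W_x :: (Wloc_gen, 'a) free_alg)"
abbreviation wy where "wy \<equiv> (fvar W_y :: (Wloc_gen, 'a) free_alg)"
abbreviation wi where "wi \<equiv> (fvar W_hinv :: (Wloc_gen, 'a) free_alg)"
abbreviation wh where "wh \<equiv> (fpoly h wx :: (Wloc_gen, 'a) free_alg)"

lemma W_derivation: "wy * fpoly r wx - fpoly r wx * wy - fpoly (pderiv r) wx \<in> rel_ideal (Wloc_rels h)"
proof -
  have "wy * wx - wx * wy - fpoly 1 wx \<in> rel_ideal (Wloc_rels h)"
    by (rule rel_ideal_superset) (simp add: Wloc_rels_def fpoly_1)
  from derivation_relation[OF this, of r] show ?thesis by simp
qed

lemma wy_nf: "\<exists>P'. wy * nf wx ((^) wy) P - nf wx ((^) wy) P' \<in> rel_ideal (Wloc_rels h)"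
proof (rule lmult_nf)
  fix r i
  from rel_ideal_rmult[OF W_derivation[of r], of "wy ^ i"]
  have "wy * (fpoly r wx * wy ^ i) - nf wx ((^) wy) (monom r (Suc i)
      + monom (pderiv r) i) \<in> rel_ideal (Wloc_rels h)"
    by (simp add: nf_add nf_monom algebra_simps)
  then show "\<exists>P. wy * (fpoly r wx * wy ^ i) - nf wx ((^) wy) P \<in> rel_ideal (Wloc_rels h)" by blast
qed

text \<open>
  Powers of \<open>h\<close> are cleared on the left, so that no normal form with inverses of \<open>h\<close> is needed.
\<close>

lemma Wloc_normal_form: "\<exists>k P. wh ^ k * u - nf wx ((^) wy) P \<in> rel_ideal (Wloc_rels h)"
proof (induction u rule: free_alg_induct)
  case one
  have "nf wx ((^) wy) 1 = 1" using nf_monom[of wx "(^) wy" 1 0] by (simp add: fpoly_1)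
  then have "wh ^ 0 * 1 - nf wx ((^) wy) 1 = 0" by simp
  then show ?case using rel_ideal_0 by metis
next
  case (add u v)
  then obtain k P k' P' where u: "wh ^ k * u - nf wx ((^) wy) P \<in> rel_ideal (Wloc_rels h)"
    and v: "wh ^ k' * v - nf wx ((^) wy) P' \<in> rel_ideal (Wloc_rels h)" by blast
  have c: "wh ^ k' * wh ^ k = wh ^ (k + k')" "wh ^ k * wh ^ k' = wh ^ (k + k')"
    by (simp_all add: power_add[symmetric] add.commute)
  from rel_ideal_add[OF rel_ideal_lmult[OF u, of "wh ^ k'"] rel_ideal_lmult[OF v, of "wh ^ k"]]
  have "wh ^ (k + k') * (u + v) - nf wx ((^) wy) (Polynomial.smult (h ^ k') P
      + Polynomial.smult (h ^ k) P') \<in> rel_ideal (Wloc_rels h)"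
    by (simp add: nf_add nf_smult fpoly_power right_diff_distrib distrib_left mult.assoc[symmetric] c)
       (simp add: algebra_simps)
  then show ?case by blast
next
  case (const c u)
  then obtain k P where u: "wh ^ k * u - nf wx ((^) wy) P \<in> rel_ideal (Wloc_rels h)" by blast
  have "fconst c * (wh ^ k * u) = wh ^ k * (fconst c * u)"
    by (simp only: mult.assoc[symmetric] fconst_central[of c "wh ^ k"])
  then have "wh ^ k * (fconst c * u) - nf wx ((^) wy) (Polynomial.smult [:c:] P) \<in> rel_ideal (Wloc_rels h)"
    using rel_ideal_lmult[OF u, of "fconst c"] by (simp add: nf_smult fpoly_const right_diff_distrib)
  then show ?case by blast
next
  case (var g u)
  then obtain k P where u: "wh ^ k * u - nf wx ((^) wy) P \<in> rel_ideal (Wloc_rels h)" by blast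
  show ?case
  proof (cases g)
    case W_x
    have "wx * (wh ^ k * u) = wh ^ k * (wx * u)"
      using fpoly_commute[of "[:0, 1:]" wx "h ^ k"]
        by (simp add: fpoly_X fpoly_power mult.assoc[symmetric])
    then have "wh ^ k * (wx * u) - nf wx ((^) wy) (Polynomial.smult [:0,1:] P) \<in> rel_ideal (Wloc_rels h)"
      using rel_ideal_lmult[OF u, of wx] by (simp add: nf_smult fpoly_X right_diff_distrib)
    then show ?thesis using W_x by blast
  next
    case W_y
    let ?c = "fpoly (of_nat (Suc k) * pderiv h) wx"
    obtain P1 where P1: "wy * nf wx ((^) wy) (Polynomial.smult h P)
        - nf wx ((^) wy) P1 \<in> rel_ideal (Wloc_rels h)"
      using wy_nf by blast
    have "pderiv (h ^ Suc k) = (of_nat (Suc k) * pderiv h) * h ^ k"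
      unfolding pderiv_power_Suc by (simp add: of_nat_poly mult_ac del: of_nat_Suc)
    then have c: "fpoly (pderiv (h ^ Suc k)) wx = ?c * wh ^ k" by (simp only: fpoly_mult fpoly_power)
    have "(wy * fpoly (h ^ Suc k) wx - fpoly (h ^ Suc k) wx * wy
        - fpoly (pderiv (h ^ Suc k)) wx) * u \<in> rel_ideal (Wloc_rels h)" (is "?t1 \<in> _")
      by (rule rel_ideal_rmult[OF W_derivation])
    moreover have "(wy * wh - ?c) * (wh ^ k * u - nf wx ((^) wy) P) \<in> rel_ideal (Wloc_rels h)" (is "?t2 \<in> _")
      by (rule rel_ideal_lmult[OF u])
    ultimately have "?t2 - ?t1
        + (wy * nf wx ((^) wy) (Polynomial.smult h P) - nf wx ((^) wy) P1) \<in> rel_ideal (Wloc_rels h)"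
      using P1 by (blast intro: rel_ideal_add rel_ideal_diff)
    also have "?t2 - ?t1 + (wy * nf wx ((^) wy) (Polynomial.smult h P) - nf wx ((^) wy) P1)
      = wh ^ Suc k * (wy * u) - nf wx ((^) wy) (P1 - Polynomial.smult (of_nat (Suc k) * pderiv h) P)"
    proof -
      have "nf wx ((^) wy) P1
          = nf wx ((^) wy) (P1 - Polynomial.smult (of_nat (Suc k) * pderiv h) P) + ?c * nf wx ((^) wy) P"
        by (simp only: nf_add[symmetric] nf_smult[symmetric] diff_add_cancel)
      then show ?thesis unfolding c fpoly_power by (simp add: nf_smult algebra_simps power_Suc)
    qed
    finally show ?thesis using W_y by blast
  next
    case W_hinv
    have "wh * wi - 1 \<in> rel_ideal (Wloc_rels h)" by (rule rel_ideal_superset) (simp add: Wloc_rels_def)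
    from rel_ideal_add[OF rel_ideal_rmult[OF rel_ideal_lmult[OF this, of "wh ^ k"], of u] u]
    have "wh ^ Suc k * (wi * u) - nf wx ((^) wy) P \<in> rel_ideal (Wloc_rels h)"
      unfolding power_Suc2 by (simp add: algebra_simps)
    then show ?thesis using W_hinv by blast
  qed
qed

lemma W_ev_eq_0_iff: "W.ev u = 0 \<longleftrightarrow> u \<in> rel_ideal (Wloc_rels h)"
proof
  assume 0: "W.ev u = 0"
  obtain k P where P: "wh ^ k * u - nf wx ((^) wy) P \<in> rel_ideal (Wloc_rels h)" using Wloc_normal_form
    by blast
  then have "W.ev (wh ^ k * u - nf wx ((^) wy) P) = 0" using W.ev_rel_ideal W_ev_rels by blast
  then have "(\<Sum>i\<le>degree P. \<mu> (\<iota> (coeff P i)) * dy ^ i) = 0" using 0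
    by (simp add: W.ev_diff W.ev_mult nf_def W.ev_sum W_ev_fpoly W.ev_power W.ev_fvar W_gen_simps)
  then have "\<iota> (coeff P i) = 0" if "i \<le> degree P" for i using sum_\<mu>_dy_eq_0[of "\<lambda>i. \<iota> (coeff P i)"] that
    by blast
  then have "lead_coeff P = 0" using \<iota>_inj by blast
  then have "P = 0" by simp
  then have whu: "wh ^ k * u \<in> rel_ideal (Wloc_rels h)" using P by (simp add: nf_0)
  have "wi * wh - 1 \<in> rel_ideal (Wloc_rels h)" by (rule rel_ideal_superset) (simp add: Wloc_rels_def)
  then have step: "v \<in> rel_ideal (Wloc_rels h)" if "wh * v \<in> rel_ideal (Wloc_rels h)" for v
    using rel_ideal_diff[OF rel_ideal_lmult[OF that, of wi] rel_ideal_rmult[of "wi * wh - 1" _ v]]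
    by (simp add: algebra_simps)
  show "u \<in> rel_ideal (Wloc_rels h)" using whu
    by (induction k) (auto simp: mult.assoc intro: step)
qed (use W.ev_rel_ideal W_ev_rels in blast)

section \<open>Derivations of \<open>A\<^sub>h\<close>\<close>

definition \<beta>A :: "'e \<Rightarrow> (Ah_gen, 'a) free_alg set" where "\<beta>A = A.lift (Ah_rels h)"
definition \<beta>W :: "'e \<Rightarrow> (Wloc_gen, 'a) free_alg set" where "\<beta>W = W.lift (Wloc_rels h)"

lemma \<beta>A_ev: "\<beta>A (A.ev u) = cls (Ah_rels h) u"
  unfolding \<beta>A_def by (rule A.lift_ev[OF A_ev_eq_0_iff])
lemma \<beta>W_ev: "\<beta>W (W.ev u) = cls (Wloc_rels h) u"
  unfolding \<beta>W_def by (rule W.lift_ev[OF W_ev_eq_0_iff])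
lemma inj_\<beta>A: "inj_on \<beta>A (op ` Ac)"
  unfolding \<beta>A_def range_A_ev[symmetric] by (rule A.inj_lift[OF A_ev_eq_0_iff])
lemma inj_\<beta>W: "inj_on \<beta>W (range W.ev)"
  unfolding \<beta>W_def by (rule W.inj_lift[OF W_ev_eq_0_iff])

sublocale Ahp: parametrized_algebra "Ah h" "op ` Ac" "\<lambda>c e. \<kappa> c * e" "(*)" \<beta>A
  using A.parametrized_lift[OF A_ev_eq_0_iff] unfolding \<beta>A_def Ah_def range_A_ev .
sublocale Wp: parametrized_algebra "Wloc h" "range W.ev" "\<lambda>c e. \<kappa> c * e" "(*)" \<beta>W
  using W.parametrized_lift[OF W_ev_eq_0_iff] unfolding \<beta>W_def Wloc_def .

definition \<alpha> :: "(Ah_gen, 'a) free_alg set \<Rightarrow> 'e" where "\<alpha> = inv_into (op ` Ac) \<beta>A"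

lemma \<alpha>_\<beta>A: "a \<in> op ` Ac \<Longrightarrow> \<alpha> (\<beta>A a) = a"
  unfolding \<alpha>_def by (rule inv_into_f_f[OF inj_\<beta>A])
lemma \<beta>A_\<alpha>: "U \<in> carrier (Ah h) \<Longrightarrow> \<beta>A (\<alpha> U) = U"
  unfolding \<alpha>_def Ahp.carrier_eq by (rule f_inv_into_f)
lemma \<alpha>_in: "U \<in> carrier (Ah h) \<Longrightarrow> \<alpha> U \<in> op ` Ac"
  unfolding \<alpha>_def Ahp.carrier_eq by (rule inv_into_into)
lemma A_ev_in: "A.ev u \<in> op ` Ac" using range_A_ev by blast
lemma one_in: "1 \<in> op ` Ac" using A_ev_in[of 1] by (simp add: A.ev_1)
lemma Xop_in: "Xop \<in> op ` Ac" using A_ev_in[of ax] by (simp add: A.ev_fvar A_gen_simps)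
lemma Yop_in: "Yop \<in> op ` Ac" using A_ev_in[of ay] by (simp add: A.ev_fvar A_gen_simps)
lemma \<kappa>_in: "\<kappa> c \<in> op ` Ac" using A_ev_in[of "fconst c"] by (simp add: A.ev_fconst)
lemma \<mu>_\<iota>_in: "\<mu> (\<iota> p) \<in> op ` Ac" using A_ev_in[of "fpoly p ax"] by (simp add: A_ev_fpoly)
lemma op_Ac_mult: "a \<in> op ` Ac \<Longrightarrow> b \<in> op ` Ac \<Longrightarrow> a * b \<in> op ` Ac" by (rule Ahp.M_pr)

lemma \<kappa>_op: "\<kappa> c * op p = op (Polynomial.smult (\<iota> [:c:]) p)"
proof -
  have "degree (Polynomial.smult (\<iota> [:c:]) p) \<le> degree p" by (rule degree_smult_le)
  from op_eq_sum[OF this] show ?thesis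
    by (simp add: op_def sum_distrib_left \<kappa>_def mult.assoc[symmetric] \<mu>_mult[symmetric])
qed

lemma \<kappa>_commutes_op: "\<kappa> c * op p = op p * \<kappa> c"
proof -
  have "\<kappa> c * dy ^ i = dy ^ i * \<kappa> c" for i
  proof (induction i)
    case (Suc i)
    have "\<kappa> c * dy ^ Suc i = dy * (\<kappa> c * dy ^ i)" by (simp add: mult.assoc[symmetric] \<kappa>_dy)
    then show ?case by (simp only: Suc power_Suc mult.assoc)
  qed simp
  then have "\<kappa> c * (\<mu> x * dy ^ i) = \<mu> x * dy ^ i * \<kappa> c" for x i
    by (simp only: mult.assoc[symmetric] \<kappa>_\<mu>) (simp only: mult.assoc)
  then show ?thesis by (simp add: op_def sum_distrib_left sum_distrib_right)
qed

definition comm :: "'e \<Rightarrow> 'e \<Rightarrow> 'e" where "comm e f = e * f - f * e"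

lemma comm_add_left: "comm (e + e') f = comm e f + comm e' f"
  and comm_add_right: "comm e (f + f') = comm e f + comm e f'"
  and comm_mult: "comm e (a * b) = comm e a * b + a * comm e b"
  and jacobi: "comm (comm e f) a = comm e (comm f a) - comm f (comm e a)"
  by (simp_all add: comm_def algebra_simps)
lemma comm_0 [simp]: "comm 0 f = 0" "comm e 0 = 0" by (simp_all add: comm_def)
lemma comm_\<kappa>: "comm (op p) (\<kappa> c) = 0" by (simp add: comm_def \<kappa>_commutes_op)
lemma comm_\<kappa>_mult: "comm (op p) (\<kappa> c * a) = \<kappa> c * comm (op p) a" by (simp add: comm_mult comm_\<kappa>)
lemma comm_\<kappa>_mult_left: assumes "a \<in> op ` Ac" shows "comm (\<kappa> c * e) a = \<kappa> c * comm e a"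
proof -
  have "a * (\<kappa> c * e) = \<kappa> c * (a * e)" using assms \<kappa>_commutes_op by (auto simp: mult.assoc[symmetric])
  then show ?thesis by (simp add: comm_def right_diff_distrib mult.assoc)
qed

lemma comm_Xop: "comm (op r) Xop = op (Polynomial.smult H (pderiv r))"
  by (simp add: comm_def commutator_Xop)

lemma comm_const_Yop: "comm (op [:w:]) Yop = \<mu> (- (H * d w))"
proof -
  have "comm (op [:w:]) Yop = (\<mu> w * dy - dy * \<mu> w) * \<mu> H"
    by (simp add: op_const comm_def Yop_def left_diff_distrib mult.assoc \<mu>_mult[symmetric] mult.commute[of H])
  also have "\<dots> = \<mu> (- (H * d w))" by (simp add: dy_\<mu> \<mu>_mult[symmetric] \<mu>_uminus mult.commute)
  finally show ?thesis .
qed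

lemma pderiv_H_in_Ac_iff: "Polynomial.smult H (pderiv r) \<in> Ac \<longleftrightarrow> (\<forall>n\<ge>1. H * coeff r n \<in> R)"
proof
  assume r: "Polynomial.smult H (pderiv r) \<in> Ac"
  show "\<forall>n\<ge>1. H * coeff r n \<in> R"
  proof safe
    fix n :: nat assume "n \<ge> 1"
    then obtain m where n: "n = Suc m" by (cases n) auto
    have "of_nat n * (H * coeff r n) \<in> R" using r unfolding n
      by (simp add: Ac_def coeff_pderiv mult.left_commute del: of_nat_Suc)
    then show "H * coeff r n \<in> R" using \<open>n \<ge> 1\<close> by (rule R_div_of_nat)
  qed
next
  assume r: "\<forall>n\<ge>1. H * coeff r n \<in> R"
  have "of_nat (Suc n) * (H * coeff r (Suc n)) \<in> R" for n using r by (intro R_mult[OF R_of_nat]) simp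
  then show "Polynomial.smult H (pderiv r) \<in> Ac"
    by (simp add: Ac_def coeff_pderiv mult_ac del: of_nat_Suc)
qed

lemma op_in_iff: "op p \<in> op ` Ac \<longleftrightarrow> p \<in> Ac"
  by (auto simp: op_eq_iff image_iff)

text \<open>
  Together with the two lemmas that follow: membership in the normaliser can be tested on the generators
  \<open>x\<close> and \<open>y h\<close>.
\<close>

lemma Mc_if_comm_gens:
  assumes "comm (op r) Xop \<in> op ` Ac" "comm (op r) Yop \<in> op ` Ac"
  shows "r \<in> Mc"
proof -
  have r: "\<forall>n\<ge>1. H * coeff r n \<in> R" using assms(1) by (simp add: comm_Xop op_in_iff pderiv_H_in_Ac_iff)
  have "op r * Yop - Yop * op r + op (Polynomial.smult H (dx r)) \<in> op ` Ac"
    by (rule commutator_Yop) (use r in simp)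
  from op_Ac_diff[OF this assms(2)] have "op (Polynomial.smult H (dx r)) \<in> op ` Ac"
    by (simp add: comm_def)
  then have "Polynomial.smult H (dx r) \<in> Ac" by (simp only: op_in_iff)
  then show ?thesis using r by (simp add: Mc_iff Ac_def)
qed

lemma comm_gens_if_Mc:
  assumes "r \<in> Mc" shows "comm (op r) Xop \<in> op ` Ac" "comm (op r) Yop \<in> op ` Ac"
proof -
  have r: "\<forall>n\<ge>1. H * coeff r n \<in> R" and r': "Polynomial.smult H (dx r) \<in> Ac" using assms
    by (simp_all add: Mc_iff Ac_def)
  then show "comm (op r) Xop \<in> op ` Ac" by (simp add: comm_Xop op_in_iff pderiv_H_in_Ac_iff)
  have "op r * Yop - Yop * op r + op (Polynomial.smult H (dx r)) \<in> op ` Ac"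
    by (rule commutator_Yop) (use r in simp)
  from op_Ac_diff[OF this imageI[OF r', of op]] show "comm (op r) Yop \<in> op ` Ac" by (simp add: comm_def)
qed

lemma comm_normalises: assumes e: "e \<in> op ` Mc" and a: "a \<in> op ` Ac" shows "comm e a \<in> op ` Ac"
proof -
  obtain r where r: "e = op r" "r \<in> Mc" using e by blast
  obtain u where "a = A.ev u" using a range_A_ev by blast
  moreover have "comm e (A.ev u) \<in> op ` Ac"
  proof (induction u rule: free_alg_induct)
    case one then show ?case by (simp add: A.ev_1 comm_def op_Ac_0)
  next
    case (add u v) then show ?case by (simp add: A.ev_add comm_add_right op_Ac_add)
  next
    case (const c u) then show ?case
      by (simp add: A.ev_mult A.ev_fconst r(1) comm_\<kappa>_mult op_Ac_mult \<kappa>_in)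
  next
    case (var g u)
    have "comm e (A_gen g) \<in> op ` Ac" using comm_gens_if_Mc[OF r(2)]
      by (cases g) (simp_all add: r(1) A_gen_simps)
    moreover have "A_gen g \<in> op ` Ac" using A_ev_in[of "fvar g"] by (simp add: A.ev_fvar)
    ultimately show ?case using var
      by (simp add: A.ev_mult A.ev_fvar comm_mult op_Ac_add op_Ac_mult A_ev_in)
  qed
  ultimately show ?thesis by simp
qed

lemma op_Ac_subset: "op ` Ac \<subseteq> op ` Mc" using Ac_subset_Mc by blast

text \<open>
  By the Jacobi identity the commutator of two normalising operators normalises \<open>A\<^sub>h\<close>.
\<close>

lemma comm_op_Mc: assumes "p \<in> Mc" "s \<in> Mc" shows "\<exists>t\<in>Mc. comm (op p) (op s) = op t \<and> t - PB p s \<in> Ac"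
proof -
  obtain a where a: "a \<in> Ac" "comm (op p) (op s) - op (PB p s) = op a"
    using commutator_Mc[OF assms] by (auto simp: comm_def)
  then have eq: "comm (op p) (op s) = op (PB p s + a)" by (simp add: op_add algebra_simps)
  have "comm (comm (op p) (op s)) f \<in> op ` Ac" if "f \<in> op ` Ac" for f
    unfolding jacobi by (intro op_Ac_diff comm_normalises imageI assms that)
  then have "PB p s + a \<in> Mc" unfolding eq by (intro Mc_if_comm_gens) (simp_all add: Xop_in Yop_in)
  then show ?thesis using eq a by auto
qed

lemma PB_in_Mc: assumes "p \<in> Mc" "s \<in> Mc" shows "PB p s \<in> Mc"
proof -
  obtain t where t: "t \<in> Mc" "t - PB p s \<in> Ac" using comm_op_Mc[OF assms] by blast
  then have "t - (t - PB p s) \<in> Mc" by (intro Mc_diff[OF t(1) Ac_subset_Mc[OF t(2)]])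
  then show ?thesis by simp
qed

definition \<delta> :: "'e \<Rightarrow> (Ah_gen, 'a) free_alg set \<Rightarrow> (Ah_gen, 'a) free_alg set" where
  "\<delta> e = (\<lambda>U\<in>carrier (Ah h). \<beta>A (comm e (\<alpha> U)))"

lemma Ah_closed: "a \<in> op ` Ac \<Longrightarrow> \<beta>A a \<in> carrier (Ah h)" by (rule Ahp.\<delta>_closed)
lemma \<delta>_\<beta>A: "a \<in> op ` Ac \<Longrightarrow> \<delta> e (\<beta>A a) = \<beta>A (comm e a)"
  by (simp add: \<delta>_def Ah_closed \<alpha>_\<beta>A)
lemma \<beta>A_eq_iff: "a \<in> op ` Ac \<Longrightarrow> b \<in> op ` Ac \<Longrightarrow> \<beta>A a = \<beta>A b \<longleftrightarrow> a = b"
  using inj_\<beta>A by (auto dest: inj_onD)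
lemma Ah_ext:
  assumes "D \<in> extensional (carrier (Ah h))" "E \<in> extensional (carrier (Ah h))"
    and "\<And>a. a \<in> op ` Ac \<Longrightarrow> D (\<beta>A a) = E (\<beta>A a)"
  shows "D = E"
  using assms by (intro extensionalityI[of _ "carrier (Ah h)"]) (auto simp: Ahp.carrier_eq)
lemma \<delta>_extensional [simp]: "\<delta> e \<in> extensional (carrier (Ah h))" by (simp add: \<delta>_def)

lemma \<delta>_derivation: assumes e: "e \<in> op ` Mc" shows "\<delta> e \<in> derivations (Ah h)"
proof -
  obtain p where p: "e = op p" using e by blast
  note cl = comm_normalises[OF e]
  have "\<delta> e \<in> carrier (Ah h) \<rightarrow>\<^sub>E carrier (Ah h)"
    by (auto simp: PiE_iff \<delta>_def intro!: Ah_closed cl \<alpha>_in)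
  moreover have "\<delta> e \<in> LinearCombinations.module_hom class_ring (Ah h) (Ah h)"
  proof -
    have "\<delta> e (\<beta>A a \<oplus>\<^bsub>Ah h\<^esub> \<beta>A b) = \<delta> e (\<beta>A a) \<oplus>\<^bsub>Ah h\<^esub> \<delta> e (\<beta>A b)"
      if "a \<in> op ` Ac" "b \<in> op ` Ac" for a b
      using that by (simp add: \<delta>_\<beta>A Ahp.\<delta>_add[symmetric] op_Ac_add cl comm_add_right)
    moreover have "\<delta> e (c \<odot>\<^bsub>Ah h\<^esub> \<beta>A a) = c \<odot>\<^bsub>Ah h\<^esub> \<delta> e (\<beta>A a)" if "a \<in> op ` Ac" for c a
      using that cl[OF that] by (simp add: \<delta>_\<beta>A Ahp.\<delta>_sc[symmetric] Ahp.M_sc comm_\<kappa>_mult p)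
    moreover have "\<delta> e (\<beta>A a) \<in> carrier (Ah h)" if "a \<in> op ` Ac" for a
      using that by (simp add: \<delta>_\<beta>A Ah_closed cl)
    ultimately show ?thesis unfolding LinearCombinations.module_hom_def Ahp.carrier_eq by blast
  qed
  moreover have "\<delta> e (U \<otimes>\<^bsub>Ah h\<^esub> V) = (\<delta> e U \<otimes>\<^bsub>Ah h\<^esub> V) \<oplus>\<^bsub>Ah h\<^esub> (U \<otimes>\<^bsub>Ah h\<^esub> \<delta> e V)"
    if U: "U \<in> carrier (Ah h)" and V: "V \<in> carrier (Ah h)" for U V
  proof -
    obtain a b where ab: "a \<in> op ` Ac" "b \<in> op ` Ac" "U = \<beta>A a" "V = \<beta>A b" using U V
      unfolding Ahp.carrier_eq by blast
    then show ?thesis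
      by (simp add: Ahp.\<delta>_pr[symmetric] \<delta>_\<beta>A cl op_Ac_mult Ahp.\<delta>_add[symmetric] comm_mult)
  qed
  ultimately show ?thesis by (simp add: derivations_def)
qed

lemma ex_antiderivative_Y: "\<exists>r. Polynomial.smult H (pderiv r) = p \<and> coeff r 0 = 0"
proof -
  obtain r where r: "pderiv r = p" "coeff r 0 = 0" using ex_pderiv_eq .
  have "Polynomial.smult H (pderiv (Polynomial.smult (1 / H) r)) = p" using H_nonzero r
    by (simp add: pderiv_smult)
  moreover have "coeff (Polynomial.smult (1 / H) r) 0 = 0" using r by simp
  ultimately show ?thesis by blast
qed

text \<open>
  Let \<open>D\<close> be a derivation. In characteristic 0 there is a symbol \<open>r\<close> with \<open>h r\<^sub>Y\<close> equal to the symbol of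
  \<open>D(x)\<close>, so \<open>G = D - [r, -]\<close> kills \<open>x\<close>. Then \<open>G(y h)\<close> commutes with \<open>x\<close> and is multiplication by some
  \<open>k\<close>. Since \<open>D(y h)\<close> lies in \<open>A\<^sub>h\<close>, all \<open>h r\<^sub>n'\<close> with \<open>n \<ge> 1\<close> and \<open>k\<close> itself are polynomials. An
  antiderivative \<open>w\<close> of \<open>-k/h\<close> removes \<open>k\<close>, and \<open>D\<close> is the commutator with the symbol \<open>r + w\<close>.
\<close>

lemma derivation_is_\<delta>: assumes D: "D \<in> derivations (Ah h)" shows "\<exists>e\<in>op ` Mc. D = \<delta> e"
proof -
  have D_carrier: "D U \<in> carrier (Ah h)" if "U \<in> carrier (Ah h)" for U
    using D that by (auto simp: derivations_def PiE_iff)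
  have D_ext: "D \<in> extensional (carrier (Ah h))" using D by (auto simp: derivations_def PiE_iff)
  have D_hom: "D \<in> LinearCombinations.module_hom class_ring (Ah h) (Ah h)" using D
    by (simp add: derivations_def)
  define F where "F a = \<alpha> (D (\<beta>A a))" for a
  have F_in: "F a \<in> op ` Ac" if "a \<in> op ` Ac" for a unfolding F_def
    by (intro \<alpha>_in D_carrier Ah_closed that)
  have D_F: "D (\<beta>A a) = \<beta>A (F a)" if "a \<in> op ` Ac" for a unfolding F_def
    by (intro \<beta>A_\<alpha>[symmetric] D_carrier Ah_closed that)
  have F_add: "F (a + b) = F a + F b" if "a \<in> op ` Ac" "b \<in> op ` Ac" for a b
  proof -
    have "\<beta>A (F (a + b)) = \<beta>A (F a + F b)"
      using LinearCombinations.module_hom_add[OF D_hom Ah_closed[OF that(1)] Ah_closed[OF that(2)]] that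
      by (simp add: D_F[symmetric] Ahp.\<delta>_add F_in op_Ac_add)
    then show ?thesis using \<beta>A_eq_iff F_in that op_Ac_add by simp
  qed
  have F_\<kappa>: "F (\<kappa> c * a) = \<kappa> c * F a" if "a \<in> op ` Ac" for a c
  proof -
    have "\<beta>A (F (\<kappa> c * a)) = \<beta>A (\<kappa> c * F a)"
      using LinearCombinations.module_hom_smult[OF D_hom _ Ah_closed[OF that], of c] that
      by (simp add: D_F[symmetric] Ahp.\<delta>_sc F_in Ahp.M_sc)
    then show ?thesis using \<beta>A_eq_iff F_in that Ahp.M_sc by simp
  qed
  have F_mult: "F (a * b) = F a * b + a * F b" if ab: "a \<in> op ` Ac" "b \<in> op ` Ac" for a b
  proof -
    have "D (\<beta>A a \<otimes>\<^bsub>Ah h\<^esub> \<beta>A b) = (D (\<beta>A a) \<otimes>\<^bsub>Ah h\<^esub> \<beta>A b) \<oplus>\<^bsub>Ah h\<^esub> (\<beta>A a \<otimes>\<^bsub>Ah h\<^esub> D (\<beta>A b))"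
      using D Ah_closed ab by (simp add: derivations_def)
    then have "\<beta>A (F (a * b)) = \<beta>A (F a * b + a * F b)"
      using ab by (simp add: D_F Ahp.\<delta>_pr[symmetric] Ahp.\<delta>_add[symmetric] F_in op_Ac_mult)
    then show ?thesis using \<beta>A_eq_iff F_in ab op_Ac_mult op_Ac_add by simp
  qed
  have F1: "F 1 = 0" using F_mult[of 1 1] one_in by simp
  have F_\<kappa>0: "F (\<kappa> c) = 0" for c using F_\<kappa>[OF one_in, of c] F1 by simp
  \<comment> \<open>subtract an inner derivation of the localisation to kill \<open>x\<close>\<close>
  obtain p where p: "p \<in> Ac" "F Xop = op p" using F_in[OF Xop_in] by blast
  obtain r where r: "Polynomial.smult H (pderiv r) = p" and r0: "coeff r 0 = 0"
    using ex_antiderivative_Y by blast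
  have rR: "H * coeff r n \<in> R" if "n \<ge> 1" for n using p(1) that pderiv_H_in_Ac_iff[of r] r by simp
  define G where "G a = F a - comm (op r) a" for a
  have GX: "G Xop = 0" by (simp add: G_def p(2) comm_Xop r)
  have G_mult: "G (a * b) = G a * b + a * G b" if "a \<in> op ` Ac" "b \<in> op ` Ac" for a b
    using F_mult[OF that] by (simp add: G_def comm_mult algebra_simps)
  have G_add: "G (a + b) = G a + G b" if "a \<in> op ` Ac" "b \<in> op ` Ac" for a b
    using F_add[OF that] by (simp add: G_def comm_add_right)
  have G\<mu>: "G (\<mu> (\<iota> s)) = 0" for s
  proof (induction s)
    case 0 show ?case using F_\<kappa>0[of 0] by (simp add: G_def \<kappa>_def)
  next
    case (pCons a s)
    then show ?case
      using G_add[OF \<kappa>_in[of a] op_Ac_mult[OF Xop_in \<mu>_\<iota>_in[of s]]] G_mult[OF Xop_in \<mu>_\<iota>_in[of s]]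
      by (simp add: \<mu>_\<iota>_pCons GX) (simp add: G_def F_\<kappa>0 comm_\<kappa>)
  qed
  have YX: "Yop * Xop = Xop * Yop + \<mu> (\<iota> h)"
  proof -
    have "A.ev (ay * ax - ax * ay - fpoly h ax) = 0" by (rule A_ev_rels) (simp add: Ah_rels_def)
    then have "Yop * Xop - Xop * Yop - \<mu> (\<iota> h) = 0"
      unfolding A.ev_diff A.ev_mult A.ev_fvar A_ev_fpoly A_gen_simps .
    then show ?thesis by (simp add: algebra_simps)
  qed
  have "G (Yop * Xop) = G (Xop * Yop) + G (\<mu> (\<iota> h))"
    unfolding YX by (rule G_add) (intro op_Ac_mult Xop_in Yop_in \<mu>_\<iota>_in)+
  then have GY_comm: "comm (G Yop) Xop = 0"
    using G_mult[OF Yop_in Xop_in] G_mult[OF Xop_in Yop_in] GX G\<mu>[of h] by (simp add: comm_def)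
  obtain fy where fy: "fy \<in> Ac" "F Yop = op fy" using F_in[OF Yop_in] by blast
  obtain a where a: "a \<in> Ac" "op r * Yop - Yop * op r + op (Polynomial.smult H (dx r)) = op a"
    using commutator_Yop[OF rR] by blast
  define s where "s = fy - a + Polynomial.smult H (dx r)"
  have commY: "comm (op r) Yop = op a - op (Polynomial.smult H (dx r))"
    using a(2) by (simp add: comm_def algebra_simps)
  have GY: "G Yop = op s" by (simp add: G_def fy commY s_def op_add op_diff)
  have "Polynomial.smult H (pderiv s) = 0" using GY_comm op_eq_0[of "Polynomial.smult H (pderiv s)"]
    by (simp add: GY comm_Xop)
  then have "degree s = 0" using H_nonzero by (simp add: pderiv_eq_0_iff)
  then obtain k where k: "s = [:k:]" by (rule degree_eq_zeroE)
  have fa: "fy - a \<in> Ac" using fy a by (intro Ac_diff)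
  have Hd: "H * d (coeff r n) \<in> R" if "n \<ge> 1" for n
  proof -
    have "H * d (coeff r n) = coeff s n - coeff (fy - a) n" by (simp add: s_def)
    also have "coeff s n = 0" using that by (simp add: k coeff_pCons split: nat.split)
    finally have "H * d (coeff r n) = 0 - coeff (fy - a) n" .
    moreover have "0 - coeff (fy - a) n \<in> R" using fa
      by (intro R_diff[OF R_0]) (simp only: Ac_def mem_Collect_eq)
    ultimately show ?thesis by (simp only:)
  qed
  have "k = coeff (fy - a) 0" using arg_cong[OF k, of "\<lambda>s. coeff s 0"] by (simp add: s_def r0)
  then have "k \<in> R" using fa by (simp add: Ac_def)
  from R_uminus[OF this] obtain g where g: "- k = \<iota> g" by (auto simp: R_def)
  then obtain w where w: "H * d w = - k" using antiderivative[of g] unfolding g H_def by blast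
  define t where "t = r + [:w:]"
  have tM: "t \<in> Mc"
    unfolding Mc_iff
  proof safe
    show "H * coeff t n \<in> R" if "n \<ge> 1" for n using rR[OF that] that by (cases n) (simp_all add: t_def)
    show "H * d (coeff t n) \<in> R" for n
      using Hd[of n] \<open>k \<in> R\<close> by (cases n) (simp_all add: t_def r0 w R_uminus)
  qed
  have commw: "comm (op [:w:]) Yop = \<mu> k" by (simp add: comm_const_Yop w)
  have tX: "comm (op t) Xop = F Xop" by (simp add: comm_Xop t_def pderiv_add r p(2) pderiv_pCons)
  have tY: "comm (op t) Yop = F Yop"
  proof -
    have "comm (op t) Yop = comm (op r) Yop + \<mu> k" by (simp only: t_def op_add comm_add_left commw)
    moreover have "F Yop - comm (op r) Yop = \<mu> k" using GY by (simp only: G_def k op_const)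
    ultimately show ?thesis by (simp add: diff_eq_eq add.commute)
  qed
  have "F (A.ev u) = comm (op t) (A.ev u)" for u
  proof (induction u rule: free_alg_induct)
    case one then show ?case by (simp add: A.ev_1 F1 comm_def)
  next
    case (add u v) then show ?case by (simp add: A.ev_add comm_add_right F_add A_ev_in)
  next
    case (const c u) then show ?case by (simp add: A.ev_mult A.ev_fconst comm_\<kappa>_mult F_\<kappa> A_ev_in)
  next
    case (var g u)
    have "F (A_gen g) = comm (op t) (A_gen g)" by (cases g) (simp_all add: A_gen_simps tX tY)
    moreover have "A_gen g \<in> op ` Ac" using A_ev_in[of "fvar g"] by (simp add: A.ev_fvar)
    ultimately show ?case using var by (simp add: A.ev_mult A.ev_fvar comm_mult F_mult A_ev_in)
  qed
  then have eq: "D (\<beta>A (A.ev u)) = \<delta> (op t) (\<beta>A (A.ev u))" for u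
    by (simp add: D_F \<delta>_\<beta>A A_ev_in)
  have "D (\<beta>A a) = \<delta> (op t) (\<beta>A a)" if "a \<in> op ` Ac" for a
    using that eq unfolding range_A_ev[symmetric] by blast
  then have "D = \<delta> (op t)" using D_ext by (intro Ah_ext) simp_all
  then show ?thesis using tM by blast
qed

lemma Der_simps: "carrier (Der (Ah h)) = derivations (Ah h)"
  "mult (Der (Ah h)) = (\<lambda>D E. \<lambda>u\<in>carrier (Ah h). D (E u) \<ominus>\<^bsub>Ah h\<^esub> E (D u))"
  "zero (Der (Ah h)) = (\<lambda>u\<in>carrier (Ah h). \<zero>\<^bsub>Ah h\<^esub>)"
  "add (Der (Ah h)) = (\<lambda>D E. \<lambda>u\<in>carrier (Ah h). D u \<oplus>\<^bsub>Ah h\<^esub> E u)"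
  "module.smult (Der (Ah h)) = (\<lambda>c D. \<lambda>u\<in>carrier (Ah h). c \<odot>\<^bsub>Ah h\<^esub> D u)"
  by (simp_all add: Der_def)

sublocale Derp: parametrized_algebra "Der (Ah h)" "op ` Mc" "\<lambda>c e. \<kappa> c * e" comm \<delta>
proof (unfold_locales, goal_cases)
  case 1 show ?case by (rule image_eqI[of _ _ 0]) simp_all
next
  case (2 x y) then show ?case by (auto simp: op_add[symmetric] intro!: imageI Mc_add)
next
  case (3 x) then show ?case by (auto simp: op_uminus[symmetric] intro!: imageI Mc_uminus)
next
  case (4 x c)
  have "Polynomial.smult (\<iota> [:c:]) p \<in> Mc" if "p \<in> Mc" for p
  proof -
    have "d (\<iota> [:c:] * z) = \<iota> [:c:] * d z" for z by (simp add: d_mult d_const)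
    then show ?thesis using that R_mult[OF \<iota>_in_R[of "[:c:]"]]
      by (auto simp: Mc_def mult.left_commute[of _ "\<iota> [:c:]"])
  qed
  then show ?case using 4 by (auto simp: \<kappa>_op)
next
  case (5 x y)
  then obtain p s where ps: "p \<in> Mc" "s \<in> Mc" "x = op p" "y = op s" by blast
  obtain t where "t \<in> Mc" "comm (op p) (op s) = op t" using comm_op_Mc[OF ps(1,2)] by blast
  then show ?case unfolding ps by simp
next
  case 10 show ?case unfolding Der_simps using derivation_is_\<delta> \<delta>_derivation by blast
next
  case 11 show ?case by (rule Ah_ext) (simp_all add: Der_simps \<delta>_\<beta>A Ahp.\<delta>_0 Ah_closed)
next
  case (12 x y) then show ?case
    by (intro Ah_ext) (simp_all add: Der_simps \<delta>_\<beta>A Ah_closed comm_add_left Ahp.\<delta>_add comm_normalises)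
next
  case (13 x c) then show ?case
    by (intro Ah_ext) (simp_all add: Der_simps \<delta>_\<beta>A Ah_closed comm_\<kappa>_mult_left Ahp.\<delta>_sc comm_normalises)
next
  case (14 x y) then show ?case
    by (intro Ah_ext) (simp_all add: Der_simps \<delta>_\<beta>A Ah_closed comm_normalises jacobi Ahp.\<delta>_diff)
qed (simp_all add: \<kappa>_add \<kappa>_mult \<kappa>_1 distrib_left distrib_right mult.assoc)

text \<open>
  A normalising operator that commutes with \<open>x\<close> is an element \<open>w\<close> of \<open>K\<close>; if it commutes with \<open>y h\<close> too,
  then \<open>w' = 0\<close>.
\<close>

lemma \<delta>_eq_0_D: assumes e: "e \<in> op ` Mc" and 0: "\<delta> e = \<zero>\<^bsub>Der (Ah h)\<^esub>"
  shows "\<exists>c. e = op [:\<iota> [:c:]:]"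
proof -
  have c0: "comm e a = 0" if "a \<in> op ` Ac" for a
  proof -
    have "\<delta> e (\<beta>A a) = \<beta>A 0" unfolding 0 using that by (simp add: Der_simps Ah_closed Ahp.\<delta>_0)
    then show ?thesis using that \<beta>A_eq_iff[OF comm_normalises[OF e that] op_Ac_0] by (simp add: \<delta>_\<beta>A)
  qed
  obtain r where r: "e = op r" using e by blast
  have "Polynomial.smult H (pderiv r) = 0"
    using c0[OF Xop_in] op_eq_0[of "Polynomial.smult H (pderiv r)"] by (simp add: r comm_Xop)
  then have "degree r = 0" using H_nonzero by (simp add: pderiv_eq_0_iff)
  then obtain w where w: "r = [:w:]" by (rule degree_eq_zeroE)
  have "\<mu> (- (H * d w)) = 0" using c0[OF Yop_in] unfolding r w comm_const_Yop .
  then have "- (H * d w) = 0" by (rule \<mu>_inj)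
  then have "d w = 0" using H_nonzero by simp
  then show ?thesis using d_eq_0 r w by blast
qed

lemma Inder_eq: "Inder (Ah h) = \<delta> ` op ` Ac"
proof -
  have "ad (Ah h) (\<beta>A a) = \<delta> a" if "a \<in> op ` Ac" for a
    using that
      by (intro Ah_ext) (simp_all add: ad_def \<delta>_\<beta>A Ah_closed Ahp.\<delta>_pr[symmetric] Ahp.\<delta>_diff[symmetric] op_Ac_mult comm_def)
  then show ?thesis unfolding Inder_def Ahp.carrier_eq image_image by simp
qed

definition \<Theta> :: "'k poly \<Rightarrow> ((Ah_gen, 'a) free_alg set \<Rightarrow> (Ah_gen, 'a) free_alg set) set" where
  "\<Theta> p = HH1_class (Ah h) (\<delta> (op p))"

lemma sub_op_Ac: "Derp.param_subspace (op ` Ac)"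
  using op_Ac_subset by (auto simp: Derp.param_subspace_def op_Ac_0 op_Ac_add op_Ac_mult \<kappa>_in)

lemma \<Theta>_eq_iff: assumes "p \<in> Mc" "s \<in> Mc" shows "\<Theta> p = \<Theta> s \<longleftrightarrow> p - s \<in> Ac"
proof -
  have "e \<in> op ` Ac" if "e \<in> op ` Mc" "\<delta> e = \<zero>\<^bsub>Der (Ah h)\<^esub>" for e
    using \<delta>_eq_0_D[OF that] by (auto simp: op_in_iff Ac_def coeff_pCons split: nat.split)
  then show ?thesis unfolding \<Theta>_def HH1_class_def Inder_eq using assms
    by (subst Derp.coset_eq_iff[OF sub_op_Ac]) (auto simp: op_diff[symmetric] op_in_iff)
qed

sublocale HHp: parametrized_algebra "HH1 (Ah h)" Mc "\<lambda>c. Polynomial.smult (\<iota> [:c:])" PB \<Theta>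
proof -
  have ker: "e \<in> op ` Ac" if "e \<in> op ` Mc" "\<delta> e = \<zero>\<^bsub>Der (Ah h)\<^esub>" for e
    using \<delta>_eq_0_D[OF that] by (auto simp: op_in_iff Ac_def coeff_pCons split: nat.split)
  have anti: "comm x j = - comm j x" for x j by (simp add: comm_def)
  interpret Q: parametrized_algebra "HH1 (Ah h)" "op ` Mc" "\<lambda>c e. \<kappa> c * e" comm "\<lambda>e. HH1_class (Ah h) (\<delta> e)"
    unfolding HH1_def HH1_class_def Inder_eq
  proof (rule Derp.quotient[OF sub_op_Ac ker])
    fix j x assume j: "j \<in> op ` Ac" and x: "x \<in> op ` Mc"
    show "comm x j \<in> op ` Ac" using comm_normalises[OF x j] .
    then show "comm j x \<in> op ` Ac" using Ahp.M_uminus anti[of j x] by simp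
  qed (simp_all add: comm_add_left comm_add_right)
  show "parametrized_algebra (HH1 (Ah h)) Mc (\<lambda>c. Polynomial.smult (\<iota> [:c:])) PB \<Theta>"
  proof (unfold_locales, goal_cases)
    case (4 x c) then show ?case using Derp.M_sc[of "op x" c] by (auto simp: \<kappa>_op op_eq_iff)
  next
    case (6 c x y) show ?case by (rule smult_add_right)
  next
    case (7 c c' x) have "\<iota> [:c + c':] = \<iota> [:c:] + \<iota> [:c':]" by (simp add: \<iota>_add[symmetric])
    then show ?case by (simp add: smult_add_left)
  next
    case (8 c c' x) have "\<iota> [:c * c':] = \<iota> [:c:] * \<iota> [:c':]"
      by (simp add: \<iota>_mult[symmetric] mult.commute)
    then show ?case by simp
  next
    case (9 x) show ?case using \<iota>_1 by (simp add: one_pCons)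
  next
    case 10 show ?case by (simp add: Q.carrier_eq \<Theta>_def image_image)
  next
    case 11 show ?case using Q.\<delta>_0 by (simp add: \<Theta>_def)
  next
    case (12 x y) then show ?case using Q.\<delta>_add by (simp add: \<Theta>_def op_add)
  next
    case (13 x c) then show ?case using Q.\<delta>_sc by (simp add: \<Theta>_def \<kappa>_op[symmetric])
  next
    case (14 x y)
    obtain t where t: "t \<in> Mc" "comm (op x) (op y) = op t" "t - PB x y \<in> Ac" using comm_op_Mc[OF 14]
      by blast
    have "\<Theta> (PB x y) = \<Theta> t" using \<Theta>_eq_iff[OF t(1) PB_in_Mc[OF 14]] t(3) by simp
    also have "\<dots> = \<Theta> x \<otimes>\<^bsub>HH1 (Ah h)\<^esub> \<Theta> y" using Q.\<delta>_pr[of "op x" "op y"] 14 t(2) by (simp add: \<Theta>_def)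
    finally show ?case .
  qed (auto simp: Mc_add Mc_uminus PB_in_Mc)
qed

section \<open>The centre and its complement\<close>

lemma Q_in_R [simp]: "Q \<in> R" and Pi_in_R [simp]: "Pi \<in> R" by (simp_all add: Q_def Pi_def)

lemma Ac_PB: assumes "p \<in> Ac" "s \<in> Mc" shows "PB p s \<in> Ac" "PB s p \<in> Ac"
proof -
  have 1: "Polynomial.smult H (dx s) \<in> Ac" "Polynomial.smult H (pderiv s) \<in> Ac"
    using assms(2) unfolding pderiv_H_in_Ac_iff by (simp_all add: Mc_iff Ac_def)
  have eq: "PB p s = pderiv p * Polynomial.smult H (dx s) - dx p * Polynomial.smult H (pderiv s)"
    "PB s p = Polynomial.smult H (pderiv s) * dx p - Polynomial.smult H (dx s) * pderiv p"
    by (simp_all add: PB_def smult_diff_right)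
  show "PB p s \<in> Ac" "PB s p \<in> Ac" unfolding eq by (intro Ac_diff Ac_mult Ac_dx Ac_pderiv 1 assms(1))+
qed

lemma PB_antisym: "PB p s = - PB s p"
  by (simp add: PB_def smult_diff_right[symmetric] smult_minus_right[symmetric] mult.commute del: smult_minus_right smult_diff_right)

lemma \<Theta>_eq_0_iff: "p \<in> Mc \<Longrightarrow> \<Theta> p = \<zero>\<^bsub>HH1 (Ah h)\<^esub> \<longleftrightarrow> p \<in> Ac"
  using \<Theta>_eq_iff[of p 0] HHp.\<delta>_0 by simp

definition Zc :: "'k poly set" where
  "Zc = {p \<in> Mc. (\<forall>n\<ge>1. coeff p n \<in> R) \<and> Pi * d (coeff p 0) \<in> R}"

lemma Zc_subset_Mc: "p \<in> Zc \<Longrightarrow> p \<in> Mc" by (simp add: Zc_def)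
lemma Ac_subset_Zc: "p \<in> Ac \<Longrightarrow> p \<in> Zc"
  by (simp add: Zc_def Ac_subset_Mc) (simp add: Ac_def R_mult R_d)
lemma Zc_add: "p \<in> Zc \<Longrightarrow> s \<in> Zc \<Longrightarrow> p + s \<in> Zc"
  by (auto simp: Zc_def Mc_add R_add d_add distrib_left)
lemma Zc_uminus: "p \<in> Zc \<Longrightarrow> - p \<in> Zc"
  by (auto simp: Zc_def Mc_uminus R_uminus d_uminus)
lemma Zc_diff: "p \<in> Zc \<Longrightarrow> s \<in> Zc \<Longrightarrow> p - s \<in> Zc"
  using Zc_add[OF _ Zc_uminus] by (metis add_uminus_conv_diff)

lemma dx_const [simp]: "dx [:w:] = [:d w:]" by (simp add: poly_eq_iff coeff_pCons split: nat.split)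

lemma PB_const_left: "PB [:w:] s = - Polynomial.smult (H * d w) (pderiv s)"
  by (simp add: PB_def pderiv_pCons)

lemma Zc_PB: assumes "z \<in> Zc" "s \<in> Mc" shows "PB z s \<in> Ac" "PB s z \<in> Ac"
proof -
  define a where "a = z - [:coeff z 0:]"
  have a: "a \<in> Ac" using assms(1) by (auto simp: Zc_def Ac_def a_def coeff_pCons split: nat.split)
  have "Polynomial.smult (H * d (coeff z 0)) (pderiv s)
      = Polynomial.smult (Pi * d (coeff z 0)) (Polynomial.smult Q (pderiv s))"
    by (simp add: H_eq mult_ac)
  also have "\<dots> \<in> Ac"
  proof (rule Ac_smult)
    show "Pi * d (coeff z 0) \<in> R" using assms(1) by (simp add: Zc_def)
    have "of_nat (Suc n) * (Q * coeff s (Suc n)) \<in> R" for n using assms(2)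
      by (intro R_mult[OF R_of_nat]) (simp add: Mc_def)
    then show "Polynomial.smult Q (pderiv s) \<in> Ac"
      by (simp add: Ac_def coeff_pderiv mult_ac del: of_nat_Suc)
  qed
  finally have "PB [:coeff z 0:] s \<in> Ac" unfolding PB_const_left by (rule Ac_uminus)
  moreover have "PB z s = PB a s + PB [:coeff z 0:] s" by (simp add: PB_add_left[symmetric] a_def)
  ultimately show "PB z s \<in> Ac" using Ac_PB(1)[OF a assms(2)] by (simp add: Ac_add)
  then show "PB s z \<in> Ac" unfolding PB_antisym[of s z] by (rule Ac_uminus)
qed

lemma ex_D1: "\<exists>w. H * d w = 1"
  using antiderivative[of 1] by (simp add: H_def \<iota>_1)

lemma const_in_Mc: "H * d w \<in> R \<Longrightarrow> [:w:] \<in> Mc"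
  by (auto simp: Mc_def coeff_pCons split: nat.split)

text \<open>
  For the inclusion from left to right two test elements suffice: \<open>D\<^sub>1\<close> gives \<open>p\<^sub>Y\<close>, and \<open>a\<^sub>1\<close> gives
  \<open>-\<pi>\<^sub>h p\<^sub>0'\<close> as the lowest coefficient.
\<close>

lemma center_eq: "lie_center (HH1 (Ah h)) = \<Theta> ` Zc"
proof (intro equalityI subsetI)
  fix u assume "u \<in> \<Theta> ` Zc"
  then obtain z where z: "u = \<Theta> z" "z \<in> Zc" by blast
  then show "u \<in> lie_center (HH1 (Ah h))"
    using Zc_PB
      by (auto simp: lie_center_def HHp.carrier_eq HHp.\<delta>_pr[symmetric] Zc_subset_Mc \<Theta>_eq_0_iff PB_in_Mc)
next
  fix u assume u: "u \<in> lie_center (HH1 (Ah h))"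
  then obtain p where p: "p \<in> Mc" "u = \<Theta> p" by (auto simp: lie_center_def HHp.carrier_eq)
  have PB: "PB p s \<in> Ac" if "s \<in> Mc" for s
    using u that p by (auto simp: lie_center_def HHp.carrier_eq HHp.\<delta>_pr[symmetric] \<Theta>_eq_0_iff PB_in_Mc)
  obtain w where w: "H * d w = 1" using ex_D1 by blast
  have "PB p [:w:] = pderiv p" using w by (simp add: PB_antisym[of p] PB_const_left)
  moreover have "[:w:] \<in> Mc" by (rule const_in_Mc) (simp add: w)
  ultimately have "pderiv p \<in> Ac" using PB by metis
  then have 1: "coeff p n \<in> R" if "n \<ge> 1" for n
    using that R_div_of_nat[of n "coeff p n"]
      by (cases n) (auto simp: Ac_def coeff_pderiv simp del: of_nat_Suc)
  have "monom (1 / Q) 1 \<in> Mc" using Q_nonzero by (auto simp: Mc_def)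
  then have "PB p (monom (1 / Q) 1) \<in> Ac" by (rule PB)
  then have "coeff (PB p (monom (1 / Q) 1)) 0 \<in> R" by (simp add: Ac_def)
  also have "coeff (PB p (monom (1 / Q) 1)) 0 = - (Pi * d (coeff p 0))"
    using Q_nonzero by (simp add: PB_def coeff_mult pderiv_monom dx_monom H_eq)
  finally have "Pi * d (coeff p 0) \<in> R" using R_uminus by fastforce
  then have "p \<in> Zc" using 1 p by (simp add: Zc_def)
  then show "u \<in> \<Theta> ` Zc" using p by blast
qed

text \<open>
  \<open>Nf f\<close> consists of the symbols of the sums of \<open>r a\<^sub>n\<close> with \<open>f dvd r\<close>.
\<close>

definition Iset :: "'a poly \<Rightarrow> 'k set" where "Iset f = {\<iota> (f * r) / Q | r. True}"
definition Nf :: "'a poly \<Rightarrow> 'k poly set" where "Nf f = {p. \<forall>n. coeff p n \<in> Iset f}"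

lemma Iset_iff: "z \<in> Iset f \<longleftrightarrow> (\<exists>r. f dvd r \<and> z = \<iota> r / Q)" by (auto simp: Iset_def dvd_def)
lemma Iset_\<iota>_iff: "\<iota> r / Q \<in> Iset f \<longleftrightarrow> f dvd r"
  using Q_nonzero by (auto simp: Iset_iff \<iota>_eq_iff)
lemma Iset_0 [simp]: "0 \<in> Iset f" unfolding Iset_def by (rule CollectI, rule exI[of _ 0]) simp
lemma Iset_add: "x \<in> Iset f \<Longrightarrow> y \<in> Iset f \<Longrightarrow> x + y \<in> Iset f"
  unfolding Iset_iff by (metis \<iota>_add add_divide_distrib dvd_add)
lemma Iset_R_mult: "c \<in> R \<Longrightarrow> x \<in> Iset f \<Longrightarrow> c * x \<in> Iset f"
  unfolding Iset_iff R_def by (metis (no_types, lifting) \<iota>_mult dvd_mult imageE times_divide_eq_right)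
lemma Iset_uminus: "x \<in> Iset f \<Longrightarrow> - x \<in> Iset f"
  using Iset_R_mult[OF R_uminus[OF R_1], of x f] by simp
lemma Iset_mono: "g dvd f \<Longrightarrow> x \<in> Iset f \<Longrightarrow> x \<in> Iset g"
  unfolding Iset_iff by (blast intro: dvd_trans)
lemma Iset_in_R: "q dvd f \<Longrightarrow> x \<in> Iset f \<Longrightarrow> x \<in> R"
  unfolding Iset_iff Q_def by (auto simp: \<iota>_div_in_R[OF q_nonzero] intro: dvd_trans)
lemma Iset_1_iff: "x \<in> Iset 1 \<longleftrightarrow> Q * x \<in> R"
  unfolding Iset_iff R_def using Q_nonzero by (auto simp: field_simps)

lemma Nf_0 [simp]: "0 \<in> Nf f" by (simp add: Nf_def)
lemma Nf_add: "x \<in> Nf f \<Longrightarrow> y \<in> Nf f \<Longrightarrow> x + y \<in> Nf f" by (simp add: Nf_def Iset_add)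
lemma Nf_uminus: "x \<in> Nf f \<Longrightarrow> - x \<in> Nf f" by (simp add: Nf_def Iset_uminus)
lemma Nf_smult: "c \<in> R \<Longrightarrow> x \<in> Nf f \<Longrightarrow> Polynomial.smult c x \<in> Nf f" by (simp add: Nf_def Iset_R_mult)
lemma Nf_sum: "(\<And>x. x \<in> A \<Longrightarrow> F x \<in> Nf f) \<Longrightarrow> sum F A \<in> Nf f"
  by (induction A rule: infinite_finite_induct) (simp_all add: Nf_add)
lemma Nf_mono: "g dvd f \<Longrightarrow> x \<in> Nf f \<Longrightarrow> x \<in> Nf g" by (simp add: Nf_def Iset_mono)
lemma Nf_subset_Ac: "q dvd f \<Longrightarrow> x \<in> Nf f \<Longrightarrow> x \<in> Ac" by (simp add: Nf_def Ac_def Iset_in_R)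
lemma Nf_monom: "monom z n \<in> Nf f \<longleftrightarrow> z \<in> Iset f" by (auto simp: Nf_def)

lemma H_d_in_R: assumes "Q * z \<in> R" shows "H * d z \<in> R"
proof -
  have "monom z 1 \<in> Mc" using assms by (auto simp: Mc_def)
  then have "H * d (coeff (monom z 1) 1) \<in> R" unfolding Mc_iff by blast
  then show ?thesis by simp
qed

lemma Nf_subset_Mc: "p \<in> Nf f \<Longrightarrow> p \<in> Mc"
proof -
  assume "p \<in> Nf f"
  then have "Q * coeff p n \<in> R" for n using Iset_mono[of 1 f] by (auto simp: Nf_def Iset_1_iff)
  then show ?thesis by (simp add: Mc_def H_d_in_R)
qed

text \<open>
  For such \<open>f\<close> the condition \<open>f dvd r\<close> implies \<open>f dvd \<pi>\<^sub>h r'\<close>, so brackets do not lose divisibility. It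
  holds for divisors of \<open>h\<close> and for products of them.
\<close>

definition log_dvd :: "'a poly \<Rightarrow> bool" where "log_dvd f \<longleftrightarrow> f dvd pi_poly h * pderiv f"

lemma log_dvd_divisor: "f dvd h \<Longrightarrow> log_dvd f"
  using divisor_dvd_pi_poly_mult_pderiv[OF _ h_nonzero] by (simp add: log_dvd_def mult.commute)
lemma log_dvd_mult: "log_dvd f \<Longrightarrow> f dvd pi_poly h * pderiv (f * r)"
  by (simp add: log_dvd_def pderiv_mult algebra_simps)
lemma log_dvd_power: assumes "log_dvd f" shows "log_dvd (f ^ k)"
proof (cases k)
  case (Suc m)
  have "f ^ m * f dvd f ^ m * (pi_poly h * pderiv f)" using assms
    by (simp add: log_dvd_def mult_dvd_mono)
  then have "f ^ Suc m dvd Polynomial.smult (of_nat (Suc m)) (f ^ m * (pi_poly h * pderiv f))"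
    by (simp add: dvd_smult mult.commute del: of_nat_Suc)
  then show ?thesis unfolding Suc log_dvd_def pderiv_power_Suc
    by (simp add: mult_ac del: of_nat_Suc power_Suc)
qed (simp add: log_dvd_def)

text \<open>
  \<open>\<pi>\<^sub>h\<close> times the logarithmic derivative of \<open>q\<close>.
\<close>

definition k0 :: "'a poly" where "k0 = (pi_poly h * pderiv q) div q"
lemma k0: "pi_poly h * pderiv q = q * k0"
  using log_dvd_divisor[OF q_dvd_h] by (simp add: k0_def log_dvd_def)
lemma Pi_dQ: "Pi * d Q = Q * \<iota> k0"
  using arg_cong[OF k0, of \<iota>] by (simp add: \<iota>_mult Q_def Pi_def d_\<iota>)

lemma Pi_d_quotient: "Pi * d (\<iota> r / Q) = (\<iota> (pi_poly h * pderiv r) - \<iota> (r * k0)) / Q"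
proof -
  have "d (\<iota> r / Q) = d (\<iota> r) / Q - \<iota> r * d Q / Q\<^sup>2"
    unfolding divide_inverse d_mult d_inverse[OF Q_nonzero] by (simp add: power_inverse)
  then have "Pi * d (\<iota> r / Q) = Pi * (d (\<iota> r) / Q - \<iota> r * d Q / Q\<^sup>2)" by (rule arg_cong)
  also have "\<dots> = Pi * d (\<iota> r) / Q - \<iota> r * (Pi * d Q) / Q\<^sup>2" by (simp add: algebra_simps)
  finally show ?thesis unfolding Pi_dQ using Q_nonzero
    by (simp add: \<iota>_mult d_\<iota> Pi_def[symmetric] power2_eq_square diff_divide_distrib)
qed

text \<open>
  The coefficient in \<open>[r a\<^sub>m, s a\<^sub>n] = br m r n s a\<^sub>m\<^sub>+\<^sub>n\<^sub>-\<^sub>1\<close>.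
\<close>

definition br :: "nat \<Rightarrow> 'a poly \<Rightarrow> nat \<Rightarrow> 'a poly \<Rightarrow> 'a poly" where
  "br m r n s = of_nat m * r * (pi_poly h * pderiv s) - of_nat n * (pi_poly h * pderiv r) * s
     - (of_nat m - of_nat n) * (r * s * k0)"

lemma PB_coordinates:
  "PB (monom (\<iota> r / Q) m) (monom (\<iota> s / Q) n) = monom (\<iota> (br m r n s) / Q) (m + n - 1)"
proof -
  have "H * (of_nat m * (\<iota> r / Q) * d (\<iota> s / Q) - of_nat n * d (\<iota> r / Q) * (\<iota> s / Q))
     = of_nat m * \<iota> r * (Pi * d (\<iota> s / Q)) - of_nat n * (Pi * d (\<iota> r / Q)) * \<iota> s"
    unfolding H_eq using Q_nonzero by (simp add: field_simps)
  also have "\<dots> = \<iota> (br m r n s) / Q"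
    unfolding Pi_d_quotient br_def \<iota>_diff \<iota>_mult \<iota>_of_nat using Q_nonzero by (simp add: field_simps)
  finally show ?thesis unfolding PB_monom by simp
qed

lemma br_dvd: assumes "log_dvd f" "log_dvd g" "f dvd r" "g dvd s" shows "f * g dvd br m r n s"
proof -
  have "f dvd pi_poly h * pderiv r" "g dvd pi_poly h * pderiv s"
    using assms log_dvd_mult by (auto elim!: dvdE[of f r] dvdE[of g s])
  then have 1: "f * g dvd r * (pi_poly h * pderiv s)" and 2: "f * g dvd (pi_poly h * pderiv r) * s"
    and 3: "f * g dvd r * s"
    using assms by (simp_all add: mult_dvd_mono)
  have "br m r n s = of_nat m * (r * (pi_poly h * pderiv s)) - of_nat n * ((pi_poly h * pderiv r) * s)
      - (of_nat m - of_nat n) * k0 * (r * s)" unfolding br_def by (simp only: mult_ac)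
  then show ?thesis by (simp only: dvd_diff dvd_mult[OF 1] dvd_mult[OF 2] dvd_mult[OF 3])
qed

lemma PB_Nf: assumes "log_dvd f" "log_dvd g" "x \<in> Nf f" "y \<in> Nf g" shows "PB x y \<in> Nf (f * g)"
proof -
  have "PB (monom (coeff x m) m) (monom (coeff y n) n) \<in> Nf (f * g)" for m n
  proof -
    obtain r s where "coeff x m = \<iota> r / Q" "f dvd r" "coeff y n = \<iota> s / Q" "g dvd s"
      using assms(3,4) by (auto simp: Nf_def Iset_iff) metis
    then show ?thesis using br_dvd[OF assms(1,2)] by (simp add: PB_coordinates Nf_monom Iset_\<iota>_iff)
  qed
  then have "(\<Sum>m\<le>degree x. \<Sum>n\<le>degree y. PB (monom (coeff x m) m) (monom (coeff y n) n)) \<in> Nf (f * g)"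
    by (intro Nf_sum)
  also have "(\<Sum>m\<le>degree x. \<Sum>n\<le>degree y. PB (monom (coeff x m) m) (monom (coeff y n) n)) = PB x y"
    by (simp only: PB_sum_left[symmetric] PB_sum_right[symmetric] poly_as_sum_of_monoms)
  finally show ?thesis .
qed

text \<open>
  The lowest coefficient of \<open>x\<close> is some \<open>r/q\<close> for which \<open>\<pi>\<^sub>h (r/q)'\<close> is a polynomial.
\<close>

lemma Zc_Nf_inter: assumes "x \<in> Zc" "x \<in> Nf 1" shows "x \<in> Ac"
proof -
  obtain r where r: "coeff x 0 = \<iota> r / Q" using assms(2) by (auto simp: Nf_def Iset_iff)
  have "Pi * d (\<iota> r / Q) \<in> R" using assms(1) by (simp add: Zc_def r)
  moreover have "Pi * d (\<iota> r / Q) = \<iota> (pi_poly h * (pderiv r * q - r * pderiv q)) / \<iota> (q * q)"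
    unfolding Pi_d_quotient using Q_nonzero arg_cong[OF k0, of \<iota>]
    by (simp add: \<iota>_mult \<iota>_diff Q_def[symmetric] field_simps)
  ultimately have "q * q dvd pi_poly h * (pderiv r * q - r * pderiv q)"
    using \<iota>_div_in_R[of "q * q"] q_nonzero by simp
  then have "q dvd r" by (rule dvd_if_wronskian_dvd[OF q_dvd_h h_nonzero])
  then have "coeff x 0 \<in> R" unfolding r Q_def using \<iota>_div_in_R[OF q_nonzero] by simp
  then have "coeff x n \<in> R" for n using assms(1) by (cases n) (auto simp: Zc_def)
  then show ?thesis by (simp add: Ac_def)
qed

text \<open>
  The equation \<open>\<pi>\<^sub>h r' - r k0 = -g\<close> is solved modulo larger and larger divisors of \<open>q\<close>. If \<open>r\<close> solves it
  modulo \<open>b\<close> with quotient \<open>u\<close>, then \<open>r + b s\<close> has the quotient \<open>u - s k\<close> modulo the next prime \<open>p\<close>,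
  with \<open>k\<close> prime to \<open>p\<close> by \<open>log_pderiv_unit\<close>, and \<open>s\<close> can be chosen.
\<close>

lemma solve_mod_q: "\<exists>r. q dvd g + pi_poly h * pderiv r - r * k0"
proof -
  let ?P = "\<lambda>b. \<exists>r. b dvd g + pi_poly h * pderiv r - r * k0"
  have "\<exists>c. c \<noteq> 0 \<and> ?P (Polynomial.smult c q)"
  proof (rule divisor_chain_induct[OF q_nonzero, of ?P])
    fix c :: 'a assume "c \<noteq> 0"
    then have "is_unit [:c:]" by (simp add: is_unit_iff_degree)
    then show "?P [:c:]" by (blast intro: unit_imp_dvd)
  next
    fix b p assume p: "irreducible p" and bp: "b * p dvd q" and "?P b"
    then obtain r u where u: "g + pi_poly h * pderiv r - r * k0 = b * u" by (auto elim: dvdE)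
    obtain c' where c': "q = b * p * c'" using bp by blast
    define c where "c = p * c'"
    have qbc: "q = b * c" by (simp add: c' c_def mult.assoc)
    have nz: "b \<noteq> 0" "c \<noteq> 0" using q_nonzero qbc by auto
    have ch: "c dvd h" "b dvd h" using q_dvd_h unfolding qbc
      by (rule dvd_mult_right, rule dvd_mult_left)
    obtain k where k: "pi_poly h * pderiv c = c * k" using log_dvd_divisor[OF ch(1)]
      by (auto simp: log_dvd_def)
    obtain l where l: "pi_poly h * pderiv b = b * l" using log_dvd_divisor[OF ch(2)]
      by (auto simp: log_dvd_def)
    have pc: "p dvd c" by (simp add: c_def)
    have pk: "\<not> p dvd k" by (rule log_pderiv_unit[OF p pc ch(1) h_nonzero k])
    have "b * c * k0 = b * c * (k + l)"
    proof -
      have "b * c * k0 = pi_poly h * pderiv (b * c)" using k0 unfolding qbc ..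
      also have "\<dots> = b * (pi_poly h * pderiv c) + c * (pi_poly h * pderiv b)"
        unfolding pderiv_mult by (simp only: algebra_simps)
      finally show ?thesis unfolding k l by (simp only: algebra_simps)
    qed
    then have k0': "k0 = k + l" using nz by simp
    obtain s where s: "p dvd u - s * k" by (rule bezout_irreducible[OF p pk])
    have "g + pi_poly h * pderiv (r + b * s) - (r + b * s) * k0
      = (g + pi_poly h * pderiv r - r * k0) + s * (pi_poly h * pderiv b)
          + b * (pi_poly h * pderiv s) - b * s * k0"
      unfolding pderiv_add pderiv_mult by (simp only: algebra_simps)
    also have "\<dots> = b * (u - s * k + pi_poly h * pderiv s)" unfolding u l unfolding k0'
      by (simp only: algebra_simps)
    finally have eq: "g + pi_poly h * pderiv (r + b * s) - (r + b * s) * k0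
        = b * (u - s * k + pi_poly h * pderiv s)" .
    have "p dvd pi_poly h" by (rule irreducible_dvd_pi_poly[OF p dvd_trans[OF pc ch(1)] h_nonzero])
    then have "p dvd u - s * k + pi_poly h * pderiv s" using s by (intro dvd_add dvd_mult2)
    then have "b * p dvd g + pi_poly h * pderiv (r + b * s) - (r + b * s) * k0" unfolding eq
      by (rule mult_dvd_mono[OF dvd_refl])
    then show "?P (b * p)" by blast
  qed
  then show ?thesis by (blast dest: smult_dvd_cancel)
qed

text \<open>
  Only the lowest coefficient is in question: for a suitable \<open>r\<close>, provided by \<open>solve_mod_q\<close>, the
  difference \<open>p\<^sub>0 - r/q\<close> is central.
\<close>

lemma Mc_decomposition: assumes "p \<in> Mc" obtains z n where "z \<in> Zc" "n \<in> Nf 1" "p = z + n"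
proof -
  obtain g where g: "H * d (coeff p 0) = \<iota> g" using assms by (auto simp: Mc_def R_def)
  obtain r where r: "q dvd - g + pi_poly h * pderiv r - r * k0" using solve_mod_q by blast
  define n where "n = p - [:coeff p 0:] + [:\<iota> r / Q:]"
  define z where "z = [:coeff p 0 - \<iota> r / Q:]"
  have "n \<in> Nf 1"
  proof -
    have "coeff n i \<in> Iset 1" for i
    proof (cases i)
      case 0 then show ?thesis by (simp add: n_def Iset_\<iota>_iff)
    next
      case (Suc j) then show ?thesis using assms by (simp add: n_def Iset_1_iff Mc_def)
    qed
    then show ?thesis by (simp add: Nf_def)
  qed
  moreover have "p = z + n" by (simp add: n_def z_def poly_eq_iff coeff_pCons split: nat.split)
  moreover have "z \<in> Zc"
  proof -
    have "p - n \<in> Mc" using assms Nf_subset_Mc \<open>n \<in> Nf 1\<close> by (intro Mc_diff)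
    then have "z \<in> Mc" using \<open>p = z + n\<close> by simp
    have "Pi * d (coeff z 0) = Pi * d (coeff p 0) - Pi * d (\<iota> r / Q)"
      by (simp add: z_def d_diff right_diff_distrib)
    also have "\<dots> = (\<iota> g - \<iota> (pi_poly h * pderiv r) + \<iota> (r * k0)) / Q"
      unfolding Pi_d_quotient g[symmetric] H_eq using Q_nonzero by (simp add: field_simps)
    also have "\<dots> = - (\<iota> (- g + pi_poly h * pderiv r - r * k0) / \<iota> q)"
      by (simp add: \<iota>_add \<iota>_diff \<iota>_uminus Q_def minus_divide_left)
    also have "\<dots> \<in> R" using r \<iota>_div_in_R[OF q_nonzero] by (intro R_uminus) simp
    finally show ?thesis using \<open>z \<in> Mc\<close> by (simp add: Zc_def z_def coeff_pCons split: nat.split)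
  qed
  ultimately show thesis using that by blast
qed

section \<open>The embedding into the localised Weyl algebra\<close>

sublocale Apres: parametrized_algebra "Ah h" UNIV "\<lambda>c u. fconst c * u" "(*)" "cls (Ah_rels h)"
  unfolding Ah_def by (rule parametrized_presented)

lemma op_Ac_subset_W: "op ` Ac \<subseteq> range W.ev"
proof -
  have "A.ev u \<in> range W.ev" for u
  proof (induction u rule: free_alg_induct)
    case one then show ?case using W.ev_1 A.ev_1 by (metis rangeI)
  next
    case (add u v) then show ?case by (simp add: A.ev_add Wp.M_add)
  next
    case (const c u) then show ?case by (simp add: A.ev_mult A.ev_fconst Wp.M_sc)
  next
    case (var g u)
    have "A_gen g \<in> range W.ev"
    proof (cases g)
      case Ah_x
      have "A_gen g = W.ev wx" unfolding Ah_x by (simp add: A_gen_simps W_gen_simps W.ev_fvar)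
      then show ?thesis by simp
    next
      case Ah_y
      have "A_gen g = W.ev (wy * wh)" unfolding Ah_y
        by (simp add: A_gen_simps W_gen_simps W.ev_fvar W.ev_mult W_ev_fpoly Yop_def H_def)
      then show ?thesis by simp
    qed
    then show ?case using var by (simp add: A.ev_mult A.ev_fvar Wp.M_pr)
  qed
  then show ?thesis unfolding range_A_ev[symmetric] by blast
qed

definition emb :: "(Ah_gen, 'a) free_alg set \<Rightarrow> (Wloc_gen, 'a) free_alg set" where
  "emb = (\<lambda>U\<in>carrier (Ah h). \<beta>W (\<alpha> U))"

lemma emb_\<beta>A: "a \<in> op ` Ac \<Longrightarrow> emb (\<beta>A a) = \<beta>W a"
  by (simp add: emb_def Ah_closed \<alpha>_\<beta>A)

lemma one_Ah: "\<one>\<^bsub>Ah h\<^esub> = \<beta>A 1" using \<beta>A_ev[of 1] by (simp add: A.ev_1 Ah_def one_presented)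
lemma one_Wloc: "\<one>\<^bsub>Wloc h\<^esub> = \<beta>W 1" using \<beta>W_ev[of 1] by (simp add: W.ev_1 Wloc_def one_presented)

lemma emb_alg_hom: "emb \<in> alg_hom (Ah h) (Wloc h)"
proof -
  note W_in = subsetD[OF op_Ac_subset_W]
  have "emb \<in> Ring.ring_hom (Ah h) (Wloc h)"
  proof (rule ring_hom_memI)
    fix U V assume "U \<in> carrier (Ah h)" "V \<in> carrier (Ah h)"
    then obtain a b where ab: "a \<in> op ` Ac" "b \<in> op ` Ac" "U = \<beta>A a" "V = \<beta>A b" unfolding Ahp.carrier_eq
      by blast
    then show "emb (U \<otimes>\<^bsub>Ah h\<^esub> V) = emb U \<otimes>\<^bsub>Wloc h\<^esub> emb V" "emb (U \<oplus>\<^bsub>Ah h\<^esub> V) = emb U \<oplus>\<^bsub>Wloc h\<^esub> emb V"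
      by (simp_all add: Ahp.\<delta>_pr[symmetric] Ahp.\<delta>_add[symmetric] emb_\<beta>A op_Ac_mult op_Ac_add W_in Wp.\<delta>_pr Wp.\<delta>_add)
  next
    fix U assume "U \<in> carrier (Ah h)"
    then obtain a where "a \<in> op ` Ac" "U = \<beta>A a" unfolding Ahp.carrier_eq by blast
    then show "emb U \<in> carrier (Wloc h)" by (simp add: emb_\<beta>A W_in Wp.\<delta>_closed)
  qed (simp add: one_Ah one_Wloc emb_\<beta>A one_in)
  moreover have "emb \<in> LinearCombinations.module_hom class_ring (Ah h) (Wloc h)"
  proof -
    have "emb (\<beta>A a \<oplus>\<^bsub>Ah h\<^esub> \<beta>A b) = emb (\<beta>A a) \<oplus>\<^bsub>Wloc h\<^esub> emb (\<beta>A b)" if "a \<in> op ` Ac" "b \<in> op ` Ac"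
      for a b
      using that by (simp add: Ahp.\<delta>_add[symmetric] emb_\<beta>A op_Ac_add W_in Wp.\<delta>_add)
    moreover have "emb (c \<odot>\<^bsub>Ah h\<^esub> \<beta>A a) = c \<odot>\<^bsub>Wloc h\<^esub> emb (\<beta>A a)" if "a \<in> op ` Ac" for c a
      using that by (simp add: Ahp.\<delta>_sc[symmetric] Ahp.M_sc emb_\<beta>A W_in Wp.\<delta>_sc)
    moreover have "emb (\<beta>A a) \<in> carrier (Wloc h)" if "a \<in> op ` Ac" for a
      using that by (simp add: emb_\<beta>A W_in Wp.\<delta>_closed)
    ultimately show ?thesis unfolding LinearCombinations.module_hom_def Ahp.carrier_eq by blast
  qed
  ultimately show ?thesis by (simp add: alg_hom_def)
qed

lemma Ah_embed_eq: "Ah_embed h = emb"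
  unfolding Ah_embed_def
proof (rule the_equality, intro conjI)
  show "emb \<in> alg_hom (Ah h) (Wloc h)" by (rule emb_alg_hom)
  show "emb \<in> extensional (carrier (Ah h))" by (simp add: emb_def)
  have "emb (cls (Ah_rels h) u) = \<beta>W (A.ev u)" for u
    unfolding \<beta>A_ev[symmetric] by (rule emb_\<beta>A[OF A_ev_in])
  moreover have "A.ev ax = W.ev wx" by (simp add: A_gen_simps W_gen_simps W.ev_fvar A.ev_fvar)
  moreover have "A.ev ay = W.ev (wy * wh)"
    by (simp add: A_gen_simps W_gen_simps W.ev_fvar A.ev_fvar W.ev_mult W_ev_fpoly Yop_def H_def)
  ultimately show "emb (cls (Ah_rels h) ax) = cls (Wloc_rels h) wx"
    "emb (cls (Ah_rels h) ay) = cls (Wloc_rels h) (wy * wh)" by (simp_all only: \<beta>W_ev)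
  fix f assume f: "f \<in> alg_hom (Ah h) (Wloc h) \<and> f \<in> extensional (carrier (Ah h)) \<and>
     f (cls (Ah_rels h) ax) = cls (Wloc_rels h) wx \<and> f (cls (Ah_rels h) ay) = cls (Wloc_rels h) (wy * wh)"
  have hom: "f \<in> Ring.ring_hom (Ah h) (Wloc h)" "emb \<in> Ring.ring_hom (Ah h) (Wloc h)"
    and mhom: "f \<in> LinearCombinations.module_hom class_ring (Ah h) (Wloc h)"
      "emb \<in> LinearCombinations.module_hom class_ring (Ah h) (Wloc h)"
    using f emb_alg_hom by (simp_all add: alg_hom_def)
  have cl: "cls (Ah_rels h) u \<in> carrier (Ah h)" for u by (rule Apres.\<delta>_closed) simp
  have "f (cls (Ah_rels h) u) = emb (cls (Ah_rels h) u)" for u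
  proof (induction u rule: free_alg_induct)
    case one
    have "cls (Ah_rels h) 1 = \<one>\<^bsub>Ah h\<^esub>" by (simp add: Ah_def one_presented)
    then show ?case using ring_hom_one[OF hom(1)] ring_hom_one[OF hom(2)] by simp
  next
    case (add u v)
    then show ?case
      by (simp add: Apres.\<delta>_add ring_hom_add[OF hom(1) cl cl] ring_hom_add[OF hom(2) cl cl])
  next
    case (const c u)
    then show ?case
      using LinearCombinations.module_hom_smult[OF mhom(1) _ cl] LinearCombinations.module_hom_smult[OF mhom(2) _ cl]
      by (simp add: Apres.\<delta>_sc)
  next
    case (var g u)
    have "f (cls (Ah_rels h) (fvar g)) = emb (cls (Ah_rels h) (fvar g))"
      using f \<open>emb (cls (Ah_rels h) ax) = cls (Wloc_rels h) wx\<close>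
       \<open>emb (cls (Ah_rels h) ay) = cls (Wloc_rels h) (wy * wh)\<close> by (cases g) simp_all
    then show ?case using var
      by (simp add: Apres.\<delta>_pr ring_hom_mult[OF hom(1) cl cl] ring_hom_mult[OF hom(2) cl cl])
  qed
  then have "f U = emb U" if "U \<in> carrier (Ah h)" for U using that unfolding Apres.carrier_eq by blast
  moreover have "f \<in> extensional (carrier (Ah h))" using f by blast
  ultimately show "f = emb" using \<open>emb \<in> extensional (carrier (Ah h))\<close> by (intro extensionalityI)
qed

lemma ra_elem_eq: "ra_elem h r n
    = \<beta>W (op (monom (\<iota> r / Q) n))" and ra_in: "op (monom (\<iota> r / Q) n) \<in> range W.ev"
proof -
  have "W.ev (fpoly r wx * fpoly (pi_poly h) wx * (case n of 0 \<Rightarrow> wi | Suc m \<Rightarrow> fpoly h wx ^ m * wy ^ n))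
     = op (monom (\<iota> r / Q) n)"
  proof (cases n)
    case 0
    have "\<iota> r * Pi * inverse H = \<iota> r / Q" unfolding H_eq using Q_nonzero Pi_nonzero
      by (simp add: field_simps)
    then show ?thesis unfolding 0
      by (simp add: W.ev_mult W_ev_fpoly W.ev_fvar W_gen_simps op_monom \<mu>_mult[symmetric] Pi_def[symmetric])
  next
    case (Suc m)
    have "\<iota> r * Pi * H ^ m = \<iota> r / Q * H ^ Suc m"
      unfolding power_Suc H_eq[THEN arg_cong[of _ _ "\<lambda>x. x * _"]]
      using Q_nonzero by (simp add: field_simps H_eq)
    moreover have "\<mu> H ^ m = \<mu> (H ^ m)" by (induction m) (simp_all add: \<mu>_mult \<mu>_1)
    ultimately show ?thesis unfolding Suc
      by (simp add: W.ev_mult W_ev_fpoly W.ev_fvar W.ev_power W_gen_simps op_monom H_def[symmetric] Pi_def[symmetric] mult.assoc)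
         (simp add: mult.assoc[symmetric] \<mu>_mult[symmetric])
  qed
  then show "ra_elem h r n = \<beta>W (op (monom (\<iota> r / Q) n))" "op (monom (\<iota> r / Q) n) \<in> range W.ev"
    unfolding ra_elem_def \<beta>W_ev[symmetric] by (simp, metis rangeI)
qed

lemma ad_ra_eq: "ad_ra h r n = \<delta> (op (monom (\<iota> r / Q) n))"
proof (rule Ah_ext)
  fix a assume a: "a \<in> op ` Ac"
  let ?e = "op (monom (\<iota> r / Q) n)"
  have "monom (\<iota> r / Q) n \<in> Nf 1" by (simp add: Nf_monom Iset_\<iota>_iff)
  then have e: "?e \<in> op ` Mc" using Nf_subset_Mc by blast
  have aW: "a \<in> range W.ev" using a op_Ac_subset_W by blast
  have c: "comm ?e a \<in> op ` Ac" by (rule comm_normalises[OF e a])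
  have "ad (Wloc h) (ra_elem h r n) (Ah_embed h (\<beta>A a)) = \<beta>W (comm ?e a)"
    unfolding Ah_embed_eq emb_\<beta>A[OF a] ra_elem_eq ad_def
    using aW ra_in[of r n]
      by (simp add: Wp.\<delta>_closed Wp.\<delta>_pr[symmetric] Wp.\<delta>_diff[symmetric] Wp.M_pr comm_def)
  also have "\<dots> = emb (\<beta>A (comm ?e a))" by (rule emb_\<beta>A[OF c, symmetric])
  finally have "ad_ra h r n (\<beta>A a) = inv_into (carrier (Ah h)) emb (emb (\<beta>A (comm ?e a)))"
    using a by (simp add: ad_ra_def Ah_closed Ah_embed_eq)
  also have "\<dots> = \<beta>A (comm ?e a)"
  proof (rule inv_into_f_f)
    show "inj_on emb (carrier (Ah h))"
      unfolding Ahp.carrier_eq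
    proof (rule inj_onI)
      fix U V assume UV: "U \<in> \<beta>A ` op ` Ac" "V \<in> \<beta>A ` op ` Ac" "emb U = emb V"
      then obtain b c where bc: "b \<in> op ` Ac" "c \<in> op ` Ac" "U = \<beta>A b" "V = \<beta>A c" by blast
      then have "\<beta>W b = \<beta>W c" using UV(3) by (simp add: emb_\<beta>A)
      then have "b = c" using inj_onD[OF inj_\<beta>W, of b c] bc op_Ac_subset_W by blast
      then show "U = V" using bc by simp
    qed
  qed (rule Ah_closed[OF c])
  finally show "ad_ra h r n (\<beta>A a) = \<delta> ?e (\<beta>A a)" using a by (simp add: \<delta>_\<beta>A)
qed (simp_all add: ad_ra_def)

section \<open>Nilpotent ideals of the cohomology Lie algebra\<close>

abbreviation L where "L \<equiv> HH1 (Ah h)"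
abbreviation \<pi>q where "\<pi>q \<equiv> pi_poly q"

text \<open>
  Representatives of the sum of the centre and the classes in \<open>Nf f\<close>, and of the classes in \<open>Nf f\<close>
  alone.
\<close>

definition ZN :: "'a poly \<Rightarrow> 'k poly set" where "ZN f = {z + n | z n. z \<in> Zc \<and> n \<in> Nf f}"
definition AN :: "'a poly \<Rightarrow> 'k poly set" where "AN f = {a + n | a n. a \<in> Ac \<and> n \<in> Nf f}"

lemma ZN_subset_Mc: "x \<in> ZN f \<Longrightarrow> x \<in> Mc"
  by (auto simp: ZN_def intro: Mc_add Zc_subset_Mc Nf_subset_Mc)
lemma AN_subset_ZN: "x \<in> AN f \<Longrightarrow> x \<in> ZN f"
  unfolding AN_def ZN_def using Ac_subset_Zc by blast
lemma Nf_subset_ZN: "x \<in> Nf f \<Longrightarrow> x \<in> ZN f" unfolding ZN_def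
  using Ac_subset_Zc[OF Ac_0] by (metis (mono_tags, lifting) CollectI add.left_neutral)
lemma ZN_0: "0 \<in> ZN f" by (rule Nf_subset_ZN) simp
lemma ZN_add: assumes "x \<in> ZN f" "y \<in> ZN f" shows "x + y \<in> ZN f"
proof -
  obtain z n z' n' where "x = z + n" "y = z' + n'" "z \<in> Zc" "z' \<in> Zc" "n \<in> Nf f" "n' \<in> Nf f" using assms
    by (auto simp: ZN_def)
  then have "x + y = (z + z') + (n + n')" "z + z' \<in> Zc" "n + n' \<in> Nf f"
    by (simp_all add: Zc_add Nf_add add_ac)
  then show ?thesis unfolding ZN_def by blast
qed
lemma AN_add: assumes "x \<in> AN f" "y \<in> AN f" shows "x + y \<in> AN f"
proof -
  obtain z n z' n' where "x = z + n" "y = z' + n'" "z \<in> Ac" "z' \<in> Ac" "n \<in> Nf f" "n' \<in> Nf f" using assms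
    by (auto simp: AN_def)
  then have "x + y = (z + z') + (n + n')" "z + z' \<in> Ac" "n + n' \<in> Nf f"
    by (simp_all add: Ac_add Nf_add add_ac)
  then show ?thesis unfolding AN_def by blast
qed
lemma Ac_subset_AN: "x \<in> Ac \<Longrightarrow> x \<in> AN f" unfolding AN_def
  by (metis (mono_tags, lifting) CollectI Nf_0 add.right_neutral)

lemma Zc_sc: "x \<in> Zc \<Longrightarrow> Polynomial.smult (\<iota> [:c:]) x \<in> Zc"
  using HHp.M_sc[of x c] by (auto simp: Zc_def R_mult d_mult d_const mult.left_commute[of _ "\<iota> [:c:]"])

lemma sub_ZN: "HHp.param_subspace (ZN f)"
proof -
  have "Polynomial.smult (\<iota> [:c:]) x \<in> ZN f" if x: "x \<in> ZN f" for x c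
  proof -
    from x obtain z n where "x = z + n" "z \<in> Zc" "n \<in> Nf f" by (auto simp: ZN_def)
    then have "Polynomial.smult (\<iota> [:c:]) x = Polynomial.smult (\<iota> [:c:]) z + Polynomial.smult (\<iota> [:c:]) n"
      "Polynomial.smult (\<iota> [:c:]) z \<in> Zc" "Polynomial.smult (\<iota> [:c:]) n \<in> Nf f"
        by (simp_all add: smult_add_right Zc_sc Nf_smult)
    then show ?thesis unfolding ZN_def by blast
  qed
  then show ?thesis by (auto simp: HHp.param_subspace_def ZN_add ZN_0 ZN_subset_Mc)
qed
lemma sub_AN: "HHp.param_subspace (AN f)"
proof -
  have "Polynomial.smult (\<iota> [:c:]) x \<in> AN f" if x: "x \<in> AN f" for x c
  proof -
    from x obtain z n where "x = z + n" "z \<in> Ac" "n \<in> Nf f" by (auto simp: AN_def)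
    then have "Polynomial.smult (\<iota> [:c:]) x = Polynomial.smult (\<iota> [:c:]) z + Polynomial.smult (\<iota> [:c:]) n"
      "Polynomial.smult (\<iota> [:c:]) z \<in> Ac" "Polynomial.smult (\<iota> [:c:]) n \<in> Nf f"
        by (simp_all add: smult_add_right Ac_smult Nf_smult)
    then show ?thesis unfolding AN_def by blast
  qed
  then show ?thesis using ZN_subset_Mc[OF AN_subset_ZN] by (auto simp: HHp.param_subspace_def AN_add Ac_subset_AN)
qed
lemma sub_Nf: "HHp.param_subspace (Nf f)"
  by (auto simp: HHp.param_subspace_def Nf_add Nf_smult Nf_subset_Mc)

lemma log_dvd_1: "log_dvd 1" by (simp add: log_dvd_def)
lemma log_dvd_\<pi>q: "log_dvd \<pi>q"
  using pi_poly_dvd_self[OF q_nonzero] q_dvd_h by (intro log_dvd_divisor) (rule dvd_trans)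

lemma PB_ZN: assumes "x \<in> ZN f" "y \<in> ZN g" "log_dvd f" "log_dvd g" shows "PB x y \<in> AN (f * g)"
proof -
  obtain z n where x: "x = z + n" "z \<in> Zc" "n \<in> Nf f" using assms(1) by (auto simp: ZN_def)
  obtain z' n' where y: "y = z' + n'" "z' \<in> Zc" "n' \<in> Nf g" using assms(2) by (auto simp: ZN_def)
  have "PB x y = (PB z y + PB n z') + PB n n'" unfolding x(1) y(1)
    by (simp add: PB_add_left PB_add_right add_ac)
  moreover have "PB z y + PB n z' \<in> Ac"
    using x y assms(2) by (intro Ac_add Zc_PB) (auto intro: ZN_subset_Mc Nf_subset_Mc)
  moreover have "PB n n' \<in> Nf (f * g)" using PB_Nf assms(3,4) x(3) y(3) by blast
  ultimately show ?thesis unfolding AN_def by blast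
qed

lemma Mc_eq_ZN: "Mc = ZN 1"
  using Mc_decomposition ZN_subset_Mc unfolding ZN_def by blast

lemma lie_ideal_ZN: assumes "log_dvd f" shows "lie_ideal L (\<Theta> ` ZN f)"
  unfolding lie_ideal_def
proof (intro conjI ballI)
  show "VectorSpace.subspace class_ring (\<Theta> ` ZN f) L" by (rule HHp.subspace_image[OF sub_ZN])
  fix u v assume "u \<in> carrier L" "v \<in> \<Theta> ` ZN f"
  then obtain x y where xy: "x \<in> Mc" "u = \<Theta> x" "y \<in> ZN f" "v = \<Theta> y" by (auto simp: HHp.carrier_eq)
  then have "PB x y \<in> AN (1 * f)" unfolding Mc_eq_ZN by (intro PB_ZN log_dvd_1 assms)
  then have "PB x y \<in> ZN f" by (simp add: AN_subset_ZN)
  then show "u \<otimes>\<^bsub>L\<^esub> v \<in> \<Theta> ` ZN f" using xy by (simp add: HHp.\<delta>_pr[symmetric] ZN_subset_Mc)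
qed

lemma bracket_set_carrier: assumes "U \<subseteq> carrier L" "V \<subseteq> carrier L"
  shows "{u \<otimes>\<^bsub>L\<^esub> v | u v. u \<in> U \<and> v \<in> V} \<subseteq> carrier L"
proof safe
  fix u v assume "u \<in> U" "v \<in> V"
  then have "u \<in> \<Theta> ` Mc" "v \<in> \<Theta> ` Mc" using assms unfolding HHp.carrier_eq by blast+
  then obtain x y where "x \<in> Mc" "u = \<Theta> x" "y \<in> Mc" "v = \<Theta> y" by blast
  then show "u \<otimes>\<^bsub>L\<^esub> v \<in> carrier L" by (simp add: HHp.\<delta>_pr[symmetric] HHp.\<delta>_closed PB_in_Mc)
qed

lemma commutator_carrier: "U \<subseteq> carrier L \<Longrightarrow> V \<subseteq> carrier L \<Longrightarrow> lie_commutator L U V \<subseteq> carrier L"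
  and zero_in_commutator: "U \<subseteq> carrier L \<Longrightarrow> V \<subseteq> carrier L \<Longrightarrow> \<zero>\<^bsub>L\<^esub> \<in> lie_commutator L U V"
  and in_commutator: "U \<subseteq> carrier L \<Longrightarrow> V \<subseteq> carrier L \<Longrightarrow> u \<in> U \<Longrightarrow> v \<in> V \<Longrightarrow> u \<otimes>\<^bsub>L\<^esub> v \<in> lie_commutator L U V"
proof -
  assume UV: "U \<subseteq> carrier L" "V \<subseteq> carrier L"
  interpret S: submodule class_ring "lie_commutator L U V" L
    unfolding lie_commutator_def by (rule HHp.lspan_submodule[OF bracket_set_carrier[OF UV]])
  show "lie_commutator L U V \<subseteq> carrier L" by (rule S.subset)
  show "\<zero>\<^bsub>L\<^esub> \<in> lie_commutator L U V" by (rule S.zero_closed)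
  show "u \<otimes>\<^bsub>L\<^esub> v \<in> lie_commutator L U V" if "u \<in> U" "v \<in> V"
    unfolding lie_commutator_def
      by (rule HHp.in_lspan[OF _ bracket_set_carrier[OF UV]]) (use that in blast)
qed

lemma commutator_subset:
  assumes "U \<subseteq> \<Theta> ` A" "V \<subseteq> \<Theta> ` B" "A \<subseteq> Mc" "B \<subseteq> Mc" "HHp.param_subspace T"
    and "\<And>a b. a \<in> A \<Longrightarrow> b \<in> B \<Longrightarrow> PB a b \<in> T"
  shows "lie_commutator L U V \<subseteq> \<Theta> ` T"
  unfolding lie_commutator_def
proof (rule HHp.lspan_subset[OF _ assms(5)], safe)
  fix u v assume "u \<in> U" "v \<in> V"
  then obtain a b where ab: "a \<in> A" "b \<in> B" "u = \<Theta> a" "v = \<Theta> b" using assms(1,2) by blast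
  then have "u \<otimes>\<^bsub>L\<^esub> v = \<Theta> (PB a b)" using HHp.\<delta>_pr[of a b] assms(3,4) by auto
  then show "u \<otimes>\<^bsub>L\<^esub> v \<in> \<Theta> ` T" using assms(6) ab by blast
qed

lemma \<Theta>_ZN_carrier: "\<Theta> ` ZN f \<subseteq> carrier L" by (auto simp: HHp.carrier_eq ZN_subset_Mc)

lemma lower_central_carrier: "S \<subseteq> carrier L \<Longrightarrow> lower_central L S n \<subseteq> carrier L"
  by (induction n) (simp_all add: commutator_carrier)

text \<open>
  Each bracket with \<open>Z + N\<close> gains a factor \<open>\<pi>\<^sub>q\<close>, and central parts disappear after the first one.
\<close>

lemma lower_central_ZN: "lower_central L (\<Theta> ` ZN \<pi>q) k \<subseteq> \<Theta> ` ZN (\<pi>q ^ k)"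
  and lower_central_AN: "lower_central L (\<Theta> ` ZN \<pi>q) (Suc k) \<subseteq> \<Theta> ` AN (\<pi>q ^ Suc k)"
proof -
  have step: "lower_central L (\<Theta> ` ZN \<pi>q) (Suc k) \<subseteq> \<Theta> ` AN (\<pi>q ^ Suc k)"
    if "lower_central L (\<Theta> ` ZN \<pi>q) k \<subseteq> \<Theta> ` ZN (\<pi>q ^ k)" for k
    unfolding lower_central.simps power_Suc
  proof (rule commutator_subset[OF subset_refl that])
    show "PB a b \<in> AN (\<pi>q * \<pi>q ^ k)" if "a \<in> ZN \<pi>q" "b \<in> ZN (\<pi>q ^ k)" for a b
      using that by (intro PB_ZN log_dvd_power log_dvd_\<pi>q)
  qed (auto simp: ZN_subset_Mc sub_AN)
  have 1: "lower_central L (\<Theta> ` ZN \<pi>q) k \<subseteq> \<Theta> ` ZN (\<pi>q ^ k)" for k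
  proof (induction k)
    case 0
    show ?case unfolding lower_central.simps power_0 Mc_eq_ZN[symmetric] by (auto simp: ZN_subset_Mc)
  next
    case (Suc k) show ?case using step[OF Suc] AN_subset_ZN by blast
  qed
  show "lower_central L (\<Theta> ` ZN \<pi>q) k \<subseteq> \<Theta> ` ZN (\<pi>q ^ k)" by (rule 1)
  show "lower_central L (\<Theta> ` ZN \<pi>q) (Suc k) \<subseteq> \<Theta> ` AN (\<pi>q ^ Suc k)" by (rule step[OF 1])
qed

lemma nilpotent_ZN: "nilpotent_ideal L (\<Theta> ` ZN \<pi>q)"
proof -
  obtain k where k: "q dvd \<pi>q ^ k" using dvd_pi_poly_power[OF q_nonzero] by blast
  have "x \<in> Ac" if "x \<in> AN (\<pi>q ^ Suc k)" for x
  proof -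
    have "q dvd \<pi>q ^ Suc k" using k by (simp add: dvd_mult)
    then show ?thesis using that Nf_subset_Ac by (auto simp: AN_def intro: Ac_add)
  qed
  then have "\<Theta> ` AN (\<pi>q ^ Suc k) \<subseteq> {\<zero>\<^bsub>L\<^esub>}" using \<Theta>_eq_0_iff Ac_subset_Mc by blast
  with lower_central_AN[of k] have "lower_central L (\<Theta> ` ZN \<pi>q) (Suc k) \<subseteq> {\<zero>\<^bsub>L\<^esub>}" by (rule subset_trans)
  moreover have "\<zero>\<^bsub>L\<^esub> \<in> lower_central L (\<Theta> ` ZN \<pi>q) (Suc k)" unfolding lower_central.simps
    by (intro zero_in_commutator \<Theta>_ZN_carrier lower_central_carrier)
  ultimately have "lower_central L (\<Theta> ` ZN \<pi>q) (Suc k) = {\<zero>\<^bsub>L\<^esub>}" by blast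
  then show ?thesis unfolding nilpotent_ideal_def lie_nilpotent_def using lie_ideal_ZN[OF log_dvd_\<pi>q]
    by blast
qed

lemma calN_eq: "calN h = \<Theta> ` Nf \<pi>q"
proof -
  let ?X = "{HH1_class (Ah h) (ad_ra h r n) | r n. pi_poly (h div pi_poly h) dvd r}"
  have X: "?X = \<Theta> ` {monom (\<iota> r / Q) n | r n. \<pi>q dvd r}"
    unfolding ad_ra_eq \<Theta>_def q_def by blast
  have "{monom (\<iota> r / Q) n | r n. \<pi>q dvd r} \<subseteq> Nf \<pi>q" by (auto simp: Nf_monom Iset_\<iota>_iff)
  then have XN: "?X \<subseteq> \<Theta> ` Nf \<pi>q" unfolding X by blast
  have "\<Theta> ` Nf \<pi>q \<subseteq> carrier L" unfolding HHp.carrier_eq using Nf_subset_Mc by blast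
  with XN have XL: "?X \<subseteq> carrier L" by (rule subset_trans)
  have param_subspace: "HHp.param_subspace {p \<in> Mc. \<Theta> p \<in> lspan L ?X}"
    by (intro HHp.sub_preimage subspace.intro HHp.vectorspace HHp.lspan_submodule XL)
  have "\<Theta> ` Nf \<pi>q \<subseteq> lspan L ?X"
  proof safe
    fix p assume p: "p \<in> Nf \<pi>q"
    have "monom (coeff p i) i \<in> {p \<in> Mc. \<Theta> p \<in> lspan L ?X}" for i
    proof -
      obtain r where r: "\<pi>q dvd r" "coeff p i = \<iota> r / Q" using p by (auto simp: Nf_def Iset_iff)
      have "\<Theta> (monom (coeff p i) i) \<in> ?X" unfolding X using r by auto
      then have "\<Theta> (monom (coeff p i) i) \<in> lspan L ?X" by (rule HHp.in_lspan[OF _ XL])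
      then show ?thesis using Mc_monom[OF Nf_subset_Mc[OF p]] by blast
    qed
    then have "(\<Sum>i\<in>A. monom (coeff p i) i) \<in> {p \<in> Mc. \<Theta> p \<in> lspan L ?X}" for A
      using param_subspace unfolding HHp.param_subspace_def by (induction A rule: infinite_finite_induct) simp_all
    then have "(\<Sum>i\<le>degree p. monom (coeff p i) i) \<in> {p \<in> Mc. \<Theta> p \<in> lspan L ?X}" .
    then show "\<Theta> p \<in> lspan L ?X" by (simp only: poly_as_sum_of_monoms mem_Collect_eq)
  qed
  moreover have "lspan L ?X \<subseteq> \<Theta> ` Nf \<pi>q" by (rule HHp.lspan_subset[OF XN sub_Nf])
  ultimately show ?thesis unfolding calN_def by blast
qed

lemma Z_plus_N: "lie_center L <+>\<^bsub>L\<^esub> calN h = \<Theta> ` ZN \<pi>q"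
proof -
  have "\<Theta> (z + n) = \<Theta> z \<oplus>\<^bsub>L\<^esub> \<Theta> n" if "z \<in> Zc" "n \<in> Nf \<pi>q" for z n
    using that by (intro HHp.\<delta>_add Zc_subset_Mc Nf_subset_Mc)
  then show ?thesis unfolding center_eq calN_eq set_add_def' ZN_def by (auto simp: image_iff) metis+
qed

lemma Z_inter_N: "lie_center L \<inter> calN h = {\<zero>\<^bsub>L\<^esub>}"
proof -
  have "u = \<zero>\<^bsub>L\<^esub>" if u: "u \<in> \<Theta> ` Zc" "u \<in> \<Theta> ` Nf \<pi>q" for u
  proof -
    from u obtain z n where zn: "u = \<Theta> z" "z \<in> Zc" "u = \<Theta> n" "n \<in> Nf \<pi>q" by blast
    then have "z - n \<in> Ac" using \<Theta>_eq_iff[OF Zc_subset_Mc[OF zn(2)] Nf_subset_Mc[OF zn(4)]] by simp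
    then have "z - (z - n) \<in> Zc" by (intro Zc_diff[OF zn(2)] Ac_subset_Zc)
    then have "n \<in> Zc" by simp
    then have "n \<in> Ac" using Zc_Nf_inter Nf_mono[OF _ zn(4), of 1] by simp
    then show ?thesis using zn(3) \<Theta>_eq_0_iff Ac_subset_Mc by blast
  qed
  moreover have "\<zero>\<^bsub>L\<^esub> \<in> \<Theta> ` Zc" "\<zero>\<^bsub>L\<^esub> \<in> \<Theta> ` Nf \<pi>q"
    using HHp.\<delta>_0 Ac_subset_Zc[OF Ac_0] Nf_0 by (metis imageI)+
  ultimately show ?thesis unfolding center_eq calN_eq by blast
qed

section \<open>Ideals modulo a prime\<close>

lemma Iset_div_of_nat: "of_nat (Suc k) * x \<in> Iset f \<Longrightarrow> x \<in> Iset f"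
  using Iset_R_mult[OF inverse_of_nat_in_R[of "Suc k"], of "of_nat (Suc k) * x" f]
    by (simp del: of_nat_Suc)

context
  fixes P :: "'a poly"
  assumes P: "irreducible P" and Pq: "P dvd q"
begin

text \<open>
  Modulo \<open>Z\<close> and the multiples of \<open>P\<close>, these elements are nonzero multiples of \<open>a\<^sub>j\<close>.
\<close>

definition V :: "nat \<Rightarrow> 'k poly set" where
  "V j = {monom (\<iota> r / Q) j + b | r b. \<not> P dvd r \<and> b \<in> ZN P}"

lemma P_prime: "prime_elem P" using P by (rule field_poly_irreducible_imp_prime)
lemma Ph: "P dvd h" using Pq q_dvd_h by (rule dvd_trans)
lemma P_not_unit: "\<not> P dvd 1" using P by (simp add: irreducible_def)

lemma V_subset_Mc: "x \<in> V j \<Longrightarrow> x \<in> Mc"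
proof -
  have "monom (\<iota> r / Q) j \<in> Mc" for r by (rule Nf_subset_Mc[of _ 1]) (simp add: Nf_monom Iset_\<iota>_iff)
  then show "x \<in> V j \<Longrightarrow> x \<in> Mc" by (auto simp: V_def intro: Mc_add ZN_subset_Mc)
qed

text \<open>
  Since \<open>P\<close> divides \<open>\<pi>\<^sub>h\<close>, the two terms with derivatives vanish modulo \<open>P\<close>, and what remains is
  \<open>(m - n) r s k0\<close> up to sign.
\<close>

lemma br_not_dvd: assumes "\<not> P dvd r" "\<not> P dvd s" "m \<noteq> n" shows "\<not> P dvd br m r n s"
proof
  assume a: "P dvd br m r n s"
  have "P dvd pi_poly h" by (rule irreducible_dvd_pi_poly[OF P Ph h_nonzero])
  then have "P dvd of_nat m * r * (pi_poly h * pderiv s) - of_nat n * (pi_poly h * pderiv r) * s"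
    by (intro dvd_diff dvd_mult2 dvd_mult)
  from dvd_diff[OF this a] have "P dvd (of_nat m - of_nat n) * (r * s * k0)" by (simp add: br_def)
  moreover have "\<not> P dvd k0" by (rule log_pderiv_unit[OF P Pq q_dvd_h h_nonzero k0])
  moreover have "\<not> P dvd of_nat m - of_nat n"
  proof
    assume d: "P dvd of_nat m - of_nat n"
    have "(of_nat m - of_nat n :: 'a poly) = [:of_nat m - of_nat n:]" by (simp add: of_nat_poly)
    moreover have "(of_nat m - of_nat n :: 'a) \<noteq> 0" using assms(3) by simp
    ultimately have "is_unit (of_nat m - of_nat n :: 'a poly)" by (simp add: is_unit_iff_degree)
    then show False using d P by (auto simp: irreducible_def dest: dvd_unit_imp_unit)
  qed
  ultimately show False using assms(1,2) P_prime by (simp add: prime_elem_dvd_mult_iff)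
qed

lemma PB_V: assumes "x \<in> V i" "y \<in> V j" "i \<noteq> j" shows "PB x y \<in> V (i + j - 1)"
proof -
  obtain r b where x: "x = monom (\<iota> r / Q) i + b" "\<not> P dvd r" "b \<in> ZN P" using assms(1)
    by (auto simp: V_def)
  obtain s c where y: "y = monom (\<iota> s / Q) j + c" "\<not> P dvd s" "c \<in> ZN P" using assms(2)
    by (auto simp: V_def)
  have P_log: "log_dvd P" by (rule log_dvd_divisor[OF Ph])
  have m: "monom (\<iota> r / Q) i \<in> ZN 1" by (rule Nf_subset_ZN) (simp add: Nf_monom Iset_\<iota>_iff)
  have y1: "y \<in> ZN 1" using V_subset_Mc[OF assms(2)] Mc_eq_ZN by simp
  have "PB b y \<in> AN P" "PB (monom (\<iota> r / Q) i) c \<in> AN P"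
    using PB_ZN[OF x(3) y1 P_log log_dvd_1] PB_ZN[OF m y(3) log_dvd_1 P_log] by simp_all
  then have "PB b y + PB (monom (\<iota> r / Q) i) c \<in> ZN P" by (intro ZN_add) (simp_all add: AN_subset_ZN)
  moreover have "PB x y = monom (\<iota> (br i r j s) / Q) (i + j - 1) + (PB b y + PB (monom (\<iota> r / Q) i) c)"
    unfolding x(1) PB_add_left by (simp add: y(1) PB_add_right PB_coordinates add_ac)
  ultimately show ?thesis using br_not_dvd[OF x(2) y(2) assms(3)] unfolding V_def by blast
qed

lemma V_not_zero: assumes "x \<in> V 0" shows "\<Theta> x \<noteq> \<zero>\<^bsub>L\<^esub>"
proof
  assume "\<Theta> x = \<zero>\<^bsub>L\<^esub>"
  then have xA: "x \<in> Ac" using \<Theta>_eq_0_iff[OF V_subset_Mc[OF assms]] by simp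
  obtain r b where x: "x = monom (\<iota> r / Q) 0 + b" "\<not> P dvd r" "b \<in> ZN P" using assms
    by (auto simp: V_def)
  obtain z n where b: "b = z + n" "z \<in> Zc" "n \<in> Nf P" using x(3) by (auto simp: ZN_def)
  let ?y = "monom (\<iota> r / Q) 0 + n"
  have "?y = x - z" using x(1) b(1) by simp
  then have "?y \<in> Zc" using xA b by (simp add: Zc_diff Ac_subset_Zc)
  moreover have "?y \<in> Nf 1" using b(3)
    by (intro Nf_add) (auto simp: Nf_monom Iset_\<iota>_iff intro: Nf_mono[of 1 P])
  ultimately have "?y \<in> Ac" by (rule Zc_Nf_inter)
  then have c: "\<iota> r / Q + coeff n 0 \<in> R" by (auto simp: Ac_def dest: spec[of _ 0])
  obtain s where s: "P dvd s" "coeff n 0 = \<iota> s / Q" using b(3) by (auto simp: Nf_def Iset_iff)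
  have "\<iota> (r + s) / \<iota> q \<in> R" using c by (simp add: s(2) \<iota>_add Q_def add_divide_distrib)
  then have "q dvd r + s" using \<iota>_div_in_R[OF q_nonzero] by simp
  then have "P dvd r + s" using Pq by (rule dvd_trans[rotated])
  then have "P dvd r" using s(1) dvd_add_left_iff by blast
  then show False using x(2) by blast
qed

text \<open>
  The element \<open>w = [a\<^sub>2, v]\<close> of the ideal is in \<open>V 1\<close>, and brackets with it map \<open>V 0\<close> to itself. So every
  term of the lower central series meets \<open>V 0\<close>.
\<close>

lemma not_nilpotent_if_meets_V:
  assumes I: "lie_ideal L I" and v: "v \<in> V 0" "\<Theta> v \<in> I"
  shows "\<not> lie_nilpotent L I"
proof -
  have IL: "I \<subseteq> carrier L" using I by (auto simp: lie_ideal_def dest!: subspace.submod submodule.subset)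
  have "monom (\<iota> 1 / Q) 2 + 0 \<in> V 2" unfolding V_def using P_not_unit ZN_0 by blast
  then have m: "monom (\<iota> 1 / Q) 2 \<in> V 2" by simp
  define w where "w = PB (monom (\<iota> 1 / Q) 2) v"
  have w: "w \<in> V 1" using PB_V[OF m v(1)] by (simp add: w_def)
  have "\<Theta> w = \<Theta> (monom (\<iota> 1 / Q) 2) \<otimes>\<^bsub>L\<^esub> \<Theta> v"
    unfolding w_def by (intro HHp.\<delta>_pr V_subset_Mc[OF m] V_subset_Mc[OF v(1)])
  then have wI: "\<Theta> w \<in> I" using I v(2) HHp.\<delta>_closed[OF V_subset_Mc[OF m]] by (simp add: lie_ideal_def)
  have "\<exists>u\<in>V 0. \<Theta> u \<in> lower_central L I n" for n
  proof (induction n)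
    case 0 then show ?case using v by auto
  next
    case (Suc n)
    then obtain u where u: "u \<in> V 0" "\<Theta> u \<in> lower_central L I n" by blast
    have "\<Theta> (PB w u) = \<Theta> w \<otimes>\<^bsub>L\<^esub> \<Theta> u" by (intro HHp.\<delta>_pr V_subset_Mc[OF w] V_subset_Mc[OF u(1)])
    also have "\<dots> \<in> lower_central L I (Suc n)"
      unfolding lower_central.simps by (rule in_commutator[OF IL lower_central_carrier[OF IL] wI u(2)])
    finally show ?case using PB_V[OF w u(1)] by auto
  qed
  then show ?thesis unfolding lie_nilpotent_def using V_not_zero by blast
qed

text \<open>
  The bracket with \<open>D\<^sub>1\<close> acts as \<open>d/dY\<close>. It lowers the index of the last coefficient that is nonzero
  modulo \<open>P\<close>; factors \<open>n + 1\<close> are harmless in characteristic 0.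
\<close>

lemma descend_to_V:
  assumes I: "lie_ideal L I"
  shows "z \<in> Zc \<Longrightarrow> n \<in> Nf 1 \<Longrightarrow> \<Theta> (z + n) \<in> I \<Longrightarrow> coeff n i \<notin> Iset P \<Longrightarrow> (\<And>j. j > i \<Longrightarrow> coeff n j \<in> Iset P)
    \<Longrightarrow> \<exists>v\<in>V 0. \<Theta> v \<in> I"
proof (induction i arbitrary: z n)
  case 0
  have "coeff n 0 \<in> Iset 1" using 0(2) by (simp add: Nf_def)
  then obtain r where r: "coeff n 0 = \<iota> r / Q" by (auto simp: Iset_iff)
  define n' where "n' = n - monom (coeff n 0) 0"
  have "coeff n' j \<in> Iset P" for j using 0(5) by (cases j) (simp_all add: n'_def)
  then have "n' \<in> Nf P" by (simp add: Nf_def)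
  then have "z + n' \<in> ZN P" using 0(1) by (auto simp: ZN_def)
  moreover have "\<not> P dvd r" using 0(4) by (simp add: r Iset_\<iota>_iff)
  moreover have "z + n = monom (\<iota> r / Q) 0 + (z + n')" by (simp add: n'_def r)
  ultimately have "z + n \<in> V 0" unfolding V_def by blast
  then show ?case using 0 by blast
next
  case (Suc i)
  obtain w where w: "H * d w = 1" using ex_D1 by blast
  \<comment> \<open>the sign of \<open>w\<close> makes the bracket equal to \<open>d/dY\<close> rather than \<open>-d/dY\<close>\<close>
  have "H * d (- w) = - 1" using w by (simp add: d_uminus)
  then have wM: "[:- w:] \<in> Mc" and PB: "PB [:- w:] p = pderiv p" for p
    by (auto intro!: const_in_Mc R_uminus simp: PB_const_left)
  have zn: "z + n \<in> Mc" using Suc by (intro Mc_add Zc_subset_Mc Nf_subset_Mc)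
  have "pderiv z \<in> Ac"
  proof -
    have "pderiv z \<in> Ac \<longleftrightarrow> pderiv (z - [:coeff z 0:]) \<in> Ac" by (simp add: pderiv_diff pderiv_pCons)
    moreover have "z - [:coeff z 0:] \<in> Ac" using Suc(2)
      by (auto simp: Zc_def Ac_def coeff_pCons split: nat.split)
    ultimately show ?thesis using Ac_pderiv by blast
  qed
  then have z': "pderiv z \<in> Zc" by (rule Ac_subset_Zc)
  have n': "pderiv n \<in> Nf 1" using Suc(3) Iset_R_mult[OF R_of_nat]
    by (auto simp: Nf_def coeff_pderiv simp del: of_nat_Suc)
  have "\<Theta> (pderiv z + pderiv n) = \<Theta> [:- w:] \<otimes>\<^bsub>L\<^esub> \<Theta> (z + n)"
    using HHp.\<delta>_pr[OF wM zn] by (simp only: PB pderiv_add)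
  also have "\<dots> \<in> I" using I HHp.\<delta>_closed[OF wM] Suc(4) by (simp add: lie_ideal_def)
  finally have "\<Theta> (pderiv z + pderiv n) \<in> I" .
  moreover have "coeff (pderiv n) i \<notin> Iset P" using Suc(5) Iset_div_of_nat unfolding coeff_pderiv
    by blast
  moreover have "coeff (pderiv n) j \<in> Iset P" if "j > i" for j
    unfolding coeff_pderiv using Suc(6)[of "Suc j"] that by (intro Iset_R_mult[OF R_of_nat]) simp
  ultimately show ?case using Suc.IH[OF z' n'] by blast
qed

end

lemma nilpotent_ideal_subset: assumes "nilpotent_ideal L I" shows "I \<subseteq> \<Theta> ` ZN \<pi>q"
proof
  fix u assume u: "u \<in> I"
  have I: "lie_ideal L I" and nil: "lie_nilpotent L I" using assms
    by (simp_all add: nilpotent_ideal_def)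
  have "u \<in> carrier L" using I u by (auto simp: lie_ideal_def dest!: subspace.submod submodule.subset)
  then obtain p where p: "p \<in> Mc" "u = \<Theta> p" by (auto simp: HHp.carrier_eq)
  obtain z n where zn: "z \<in> Zc" "n \<in> Nf 1" "p = z + n" by (rule Mc_decomposition[OF p(1)])
  have "n \<in> Nf \<pi>q"
  proof (rule ccontr)
    assume "n \<notin> Nf \<pi>q"
    then obtain i where i: "coeff n i \<notin> Iset \<pi>q" by (auto simp: Nf_def)
    obtain r where r: "coeff n i = \<iota> r / Q" using zn(2) by (auto simp: Nf_def Iset_iff)
    have "\<not> \<pi>q dvd r" using i by (simp add: r Iset_\<iota>_iff)
    then obtain P where P: "irreducible P" "P dvd \<pi>q" "\<not> P dvd r"
      using squarefree_dvd[OF pi_poly_nonzero[OF q_nonzero] pi_poly_squarefree[OF _ q_nonzero], of r]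
        by blast
    have Pq: "P dvd q" using P(2) pi_poly_dvd_self[OF q_nonzero] by (rule dvd_trans)
    define J where "J = {j. coeff n j \<notin> Iset P}"
    have "J \<subseteq> {..degree n}"
    proof
      fix j assume "j \<in> J"
      then have "coeff n j \<noteq> 0" using Iset_0[of P] by (auto simp: J_def)
      then show "j \<in> {..degree n}" by (simp add: le_degree)
    qed
    then have fin: "finite J" by (rule finite_subset) simp
    have "i \<in> J" using P(3) by (simp add: J_def r Iset_\<iota>_iff)
    then have "Max J \<in> J" using fin by (intro Max_in) auto
    then have 1: "coeff n (Max J) \<notin> Iset P" by (simp add: J_def)
    have 2: "coeff n j \<in> Iset P" if "j > Max J" for j
      using that Max_ge[OF fin, of j] unfolding J_def
        by (metis (mono_tags, lifting) mem_Collect_eq not_le)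
    have "\<Theta> (z + n) \<in> I" using u p zn by simp
    then obtain v where "v \<in> V P 0" "\<Theta> v \<in> I"
      using descend_to_V[OF P(1) Pq I zn(1,2) _ 1 2] by blast
    then show False using not_nilpotent_if_meets_V[OF P(1) Pq I] nil by blast
  qed
  then show "u \<in> \<Theta> ` ZN \<pi>q" using zn p by (auto simp: ZN_def)
qed

lemma largest_nilpotent_ideal:
  "lie_center L \<inter> calN h = {\<zero>\<^bsub>L\<^esub>}"
  "maximal_nilpotent_ideal L (lie_center L <+>\<^bsub>L\<^esub> calN h)"
  "maximal_nilpotent_ideal L I \<Longrightarrow> I = lie_center L <+>\<^bsub>L\<^esub> calN h"
proof -
  show "lie_center L \<inter> calN h = {\<zero>\<^bsub>L\<^esub>}" by (rule Z_inter_N)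
  show "maximal_nilpotent_ideal L (lie_center L <+>\<^bsub>L\<^esub> calN h)"
    unfolding Z_plus_N maximal_nilpotent_ideal_def using nilpotent_ZN nilpotent_ideal_subset by blast
  show "I = lie_center L <+>\<^bsub>L\<^esub> calN h" if "maximal_nilpotent_ideal L I"
    using that unfolding Z_plus_N maximal_nilpotent_ideal_def using nilpotent_ZN nilpotent_ideal_subset
      by blast
qed

lemma Mc_eq_Zc_if_q_const: assumes "q = [:c:]" "p \<in> Mc" shows "p \<in> Zc"
proof -
  have c: "c \<noteq> 0" using q_nonzero assms(1) by auto
  then have "\<iota> [:1 / c:] * Q = 1" unfolding Q_def assms(1) \<iota>_mult[symmetric]
    by (simp add: \<iota>_1 one_pCons[symmetric])
  then have x: "x = \<iota> [:1 / c:] * (Q * x)" for x by (simp add: mult.assoc[symmetric])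
  have div: "x \<in> R" if "Q * x \<in> R" for x
    using R_mult[OF \<iota>_in_R[of "[:1 / c:]"] that] x[of x] by simp
  have "Q * (Pi * d (coeff p 0)) \<in> R" using assms(2) by (simp add: Mc_def H_eq mult.assoc)
  then show ?thesis using assms(2) div by (simp add: Zc_def Mc_def)
qed

lemma commutator_zero_if_q_const: assumes "q = [:c:]"
  shows "lie_commutator L (carrier L) (carrier L) = {\<zero>\<^bsub>L\<^esub>}"
proof -
  have "HHp.param_subspace Ac" by (auto simp: HHp.param_subspace_def Ac_add Ac_smult Ac_subset_Mc)
  then have "lie_commutator L (carrier L) (carrier L) \<subseteq> \<Theta> ` Ac"
    using Zc_PB(1) Mc_eq_Zc_if_q_const[OF assms]
    by (intro commutator_subset[of _ Mc _ Mc]) (auto simp: HHp.carrier_eq)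
  moreover have "\<Theta> ` Ac \<subseteq> {\<zero>\<^bsub>L\<^esub>}" using \<Theta>_eq_0_iff Ac_subset_Mc by blast
  ultimately show ?thesis using zero_in_commutator[of "carrier L" "carrier L"] by blast
qed

lemma nilpotent_iff_q_const: "lie_nilpotent L (carrier L) \<longleftrightarrow> (\<exists>c. c \<noteq> 0 \<and> q = [:c:])"
proof
  assume "\<exists>c. c \<noteq> 0 \<and> q = [:c:]"
  then obtain c where "q = [:c:]" by blast
  then have "lower_central L (carrier L) 1 = {\<zero>\<^bsub>L\<^esub>}" by (simp add: commutator_zero_if_q_const)
  then show "lie_nilpotent L (carrier L)" unfolding lie_nilpotent_def by blast
next
  assume nil: "lie_nilpotent L (carrier L)"
  have "degree q = 0"
  proof (rule ccontr)
    assume "degree q \<noteq> 0"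
    then obtain P where P: "irreducible P" "P dvd q" using ex_irreducible_factor[of q] by auto
    have I: "lie_ideal L (carrier L)" using lie_ideal_ZN[OF log_dvd_1]
      unfolding Mc_eq_ZN[symmetric] HHp.carrier_eq .
    have "monom (\<iota> 1 / Q) 0 + 0 \<in> V P 0" unfolding V_def[OF P] using P_not_unit[OF P] ZN_0 by blast
    then show False using not_nilpotent_if_meets_V[OF P I] nil V_subset_Mc[OF P] HHp.\<delta>_closed by blast
  qed
  then obtain c where c: "q = [:c:]" by (rule degree_eq_zeroE)
  then show "\<exists>c. c \<noteq> 0 \<and> q = [:c:]" using q_nonzero by auto
qed

section \<open>The abelian case\<close>

lemma D_der_eq: assumes w: "H * d w = - \<iota> g" shows "D_der h g = \<delta> (op [:w:])" and "op [:w:] \<in> op ` Mc"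
proof -
  have "[:w:] \<in> Mc" by (rule const_in_Mc) (simp add: w R_uminus)
  then show M: "op [:w:] \<in> op ` Mc" by blast
  have clsx: "cls (Ah_rels h) ax = \<beta>A Xop" and clsy: "cls (Ah_rels h) ay = \<beta>A Yop"
    and clsg: "cls (Ah_rels h) (fpoly g ax) = \<beta>A (\<mu> (\<iota> g))"
    unfolding \<beta>A_ev[symmetric] A_ev_fpoly by (simp_all add: A.ev_fvar A_gen_simps)
  have X0: "comm (op [:w:]) Xop = 0" for w by (simp add: comm_Xop pderiv_pCons)
  show "D_der h g = \<delta> (op [:w:])"
    unfolding D_der_def clsx clsy clsg
  proof (rule the_equality, intro conjI)
    show "\<delta> (op [:w:]) \<in> derivations (Ah h)" by (rule \<delta>_derivation[OF M])
    show "\<delta> (op [:w:]) (\<beta>A Xop) = \<zero>\<^bsub>Ah h\<^esub>" by (simp add: \<delta>_\<beta>A Xop_in X0 Ahp.\<delta>_0)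
    show "\<delta> (op [:w:]) (\<beta>A Yop) = \<beta>A (\<mu> (\<iota> g))" by (simp add: \<delta>_\<beta>A Yop_in comm_const_Yop w)
  next
    fix D assume D: "D \<in> derivations (Ah h) \<and> D (\<beta>A Xop) = \<zero>\<^bsub>Ah h\<^esub> \<and> D (\<beta>A Yop) = \<beta>A (\<mu> (\<iota> g))"
    then obtain r where r: "r \<in> Mc" "D = \<delta> (op r)" using derivation_is_\<delta> by blast
    have e: "op r \<in> op ` Mc" using r by blast
    have "\<beta>A (comm (op r) Xop) = \<beta>A 0" using D by (simp add: r(2) \<delta>_\<beta>A Xop_in Ahp.\<delta>_0)
    then have "comm (op r) Xop = 0" using \<beta>A_eq_iff[OF comm_normalises[OF e Xop_in] op_Ac_0] by simp
    then have "Polynomial.smult H (pderiv r) = 0" using op_eq_0[of "Polynomial.smult H (pderiv r)"]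
      by (simp add: comm_Xop)
    then have "degree r = 0" using H_nonzero by (simp add: pderiv_eq_0_iff)
    then obtain w' where w': "r = [:w':]" by (rule degree_eq_zeroE)
    have "\<beta>A (comm (op r) Yop) = \<beta>A (\<mu> (\<iota> g))" using D by (simp add: r(2) \<delta>_\<beta>A Yop_in)
    then have "comm (op r) Yop = \<mu> (\<iota> g)" using \<beta>A_eq_iff[OF comm_normalises[OF e Yop_in] \<mu>_\<iota>_in]
      by simp
    then have "\<mu> (- (H * d w') - \<iota> g) = 0" by (simp add: w' comm_const_Yop \<mu>_diff)
    then have "- (H * d w') - \<iota> g = 0" by (rule \<mu>_inj)
    then have "- (H * d w') = \<iota> g" by simp
    then have "H * d w' = - \<iota> g" by (metis minus_minus)
    then have "H * d (w' - w) = 0" using w by (simp add: d_diff right_diff_distrib)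
    then have "d (w' - w) = 0" using H_nonzero by simp
    then obtain c where "w' - w = \<iota> [:c:]" using d_eq_0 by blast
    then have "w' = w + \<iota> [:c:]" by (simp add: algebra_simps)
    then have "op r = op [:w:] + \<kappa> c" by (simp add: w' op_const \<mu>_add \<kappa>_def)
    moreover have "comm (\<kappa> c) a = 0" if "a \<in> op ` Ac" for a
      using that \<kappa>_commutes_op by (auto simp: comm_def)
    ultimately show "D = \<delta> (op [:w:])" unfolding r(2)
      by (intro Ah_ext) (simp_all add: \<delta>_\<beta>A comm_add_left)
  qed
qed

definition G :: "'a poly set" where "G = {g. g = 0 \<or> degree g < degree (pi_poly h)}"

abbreviation DL where "DL \<equiv> (Der (Ah h))\<lparr>carrier := D_space h\<rparr>"

lemma ex_w: "\<exists>w. H * d w = - \<iota> g" using antiderivative[of "- g"] by (simp add: H_def \<iota>_uminus)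

lemma D_der_add: "D_der h (g + g') = D_der h g \<oplus>\<^bsub>Der (Ah h)\<^esub> D_der h g'"
  and D_der_sc: "D_der h (Polynomial.smult c g) = c \<odot>\<^bsub>Der (Ah h)\<^esub> D_der h g"
  and D_der_0: "D_der h 0 = \<zero>\<^bsub>Der (Ah h)\<^esub>"
  and D_der_bracket: "D_der h g \<otimes>\<^bsub>Der (Ah h)\<^esub> D_der h g' = \<zero>\<^bsub>Der (Ah h)\<^esub>"
proof -
  obtain w where w: "H * d w = - \<iota> g" using ex_w by blast
  obtain w' where w': "H * d w' = - \<iota> g'" using ex_w by blast
  have "H * d (w + w') = - \<iota> (g + g')" using w w' by (simp add: d_add distrib_left \<iota>_add)
  from D_der_eq(1)[OF this] show "D_der h (g + g') = D_der h g \<oplus>\<^bsub>Der (Ah h)\<^esub> D_der h g'"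
    using Derp.\<delta>_add[OF D_der_eq(2)[OF w] D_der_eq(2)[OF w']]
    by (simp add: D_der_eq(1)[OF w] D_der_eq(1)[OF w'] op_add[symmetric])
  have "\<iota> (Polynomial.smult c g) = \<iota> [:c:] * \<iota> g" by (simp add: \<iota>_mult[symmetric])
  then have "H * d (\<iota> [:c:] * w) = - \<iota> (Polynomial.smult c g)" using w
    by (simp add: d_mult d_const mult.left_commute[of H])
  from D_der_eq(1)[OF this] show "D_der h (Polynomial.smult c g) = c \<odot>\<^bsub>Der (Ah h)\<^esub> D_der h g"
    using Derp.\<delta>_sc[OF D_der_eq(2)[OF w], of c] by (simp add: D_der_eq(1)[OF w] \<kappa>_op)
  have "H * d 0 = - \<iota> 0" by simp
  from D_der_eq(1)[OF this] show 0: "D_der h 0 = \<zero>\<^bsub>Der (Ah h)\<^esub>" using Derp.\<delta>_0 by simp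
  have "comm (op [:w:]) (op [:w':]) = 0" by (simp add: comm_def op_const \<mu>_mult[symmetric] mult.commute)
  then show "D_der h g \<otimes>\<^bsub>Der (Ah h)\<^esub> D_der h g' = \<zero>\<^bsub>Der (Ah h)\<^esub>"
    using Derp.\<delta>_pr[OF D_der_eq(2)[OF w] D_der_eq(2)[OF w']] Derp.\<delta>_0
    by (simp add: D_der_eq(1)[OF w] D_der_eq(1)[OF w'])
qed

lemma D_der_inj: assumes "D_der h g = \<zero>\<^bsub>Der (Ah h)\<^esub>" shows "g = 0"
proof -
  obtain w where w: "H * d w = - \<iota> g" using ex_w by blast
  have "\<delta> (op [:w:]) = \<zero>\<^bsub>Der (Ah h)\<^esub>" using assms D_der_eq(1)[OF w] by simp
  then obtain c where "op [:w:] = op [:\<iota> [:c:]:]" using \<delta>_eq_0_D[OF D_der_eq(2)[OF w]] by blast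
  then have "w = \<iota> [:c:]" by (simp add: op_eq_iff)
  then have "\<iota> g = 0" using w by (simp add: d_const)
  then show ?thesis by (rule \<iota>_inj)
qed

lemma D_space_eq: "D_space h = D_der h ` G" by (auto simp: D_space_def G_def)

lemma G_add: "g \<in> G \<Longrightarrow> g' \<in> G \<Longrightarrow> g + g' \<in> G"
  unfolding G_def using degree_add_less[of g "degree (pi_poly h)" g'] by auto
lemma G_smult: "g \<in> G \<Longrightarrow> Polynomial.smult c g \<in> G"
  unfolding G_def using degree_smult_le[of c g] by (auto intro: le_less_trans)

sublocale Dp: parametrized_algebra DL G Polynomial.smult "\<lambda>_ _. 0" "D_der h"
proof (unfold_locales, goal_cases)
  case (3 x) then show ?case using G_smult[of x "- 1"] by simp
qed (simp_all add: G_add G_smult smult_add_right smult_add_left D_space_eq D_der_add D_der_sc D_der_0 D_der_bracket,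
  simp_all add: G_def)

lemma lie_subalgebra_D: "lie_subalgebra (Der (Ah h)) (D_space h)"
proof -
  have "submodule class_ring (D_space h) (Der (Ah h))"
  proof (rule submodule.intro[OF Derp.module])
    have "D_der h g \<in> carrier (Der (Ah h))" for g
    proof -
      obtain w where w: "H * d w = - \<iota> g" using ex_w by blast
      show ?thesis using Derp.\<delta>_closed[OF D_der_eq(2)[OF w]] D_der_eq(1)[OF w] by simp
    qed
    then show "D_space h \<subseteq> carrier (Der (Ah h))" by (auto simp: D_space_eq)
    show "\<zero>\<^bsub>Der (Ah h)\<^esub> \<in> D_space h" unfolding D_space_eq D_der_0[symmetric]
      by (intro imageI) (simp add: G_def)
    show "v \<oplus>\<^bsub>Der (Ah h)\<^esub> w \<in> D_space h" if "v \<in> D_space h" "w \<in> D_space h" for v w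
      using that unfolding D_space_eq by (auto simp: D_der_add[symmetric] G_add)
    show "c \<odot>\<^bsub>Der (Ah h)\<^esub> v \<in> D_space h" if "v \<in> D_space h" for c v
      using that unfolding D_space_eq by (auto simp: D_der_sc[symmetric] G_smult)
  qed
  moreover have "\<zero>\<^bsub>Der (Ah h)\<^esub> \<in> D_space h" unfolding D_space_eq D_der_0[symmetric]
    by (intro imageI) (simp add: G_def)
  then have "u \<otimes>\<^bsub>Der (Ah h)\<^esub> v \<in> D_space h" if "u \<in> D_space h" "v \<in> D_space h" for u v
    using that D_der_bracket by (auto simp: D_space_eq)
  ultimately show ?thesis unfolding lie_subalgebra_def using Derp.vectorspace
    by (auto intro: subspace.intro)
qed

lemma lie_abelian_D: "lie_abelian DL"
  by (auto simp: lie_abelian_def D_space_eq D_der_bracket)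

lemma dim_D: "vectorspace.fin_dim class_ring DL" "vectorspace.dim class_ring DL = degree (pi_poly h)"
proof -
  let ?n = "degree (pi_poly h)"
  let ?B = "monom (1 :: 'a) ` {..<?n}"
  have inj: "inj_on (monom (1 :: 'a)) {..<?n}" by (auto simp: inj_on_def monom_eq_iff')
  have BG: "?B \<subseteq> G" by (auto simp: G_def degree_monom_eq)
  have inj0: "x = 0" if "D_der h x = \<zero>\<^bsub>DL\<^esub>" for x using that D_der_inj by simp
  have indep: "\<forall>x\<in>?B. a x = 0" if "(\<Sum>x\<in>?B. Polynomial.smult (a x) x) = 0" for a :: "'a poly \<Rightarrow> 'a"
  proof safe
      fix i assume i: "i < ?n"
      have "(\<Sum>j<?n. monom (a (monom 1 j)) j) = 0" using that
        by (simp add: sum.reindex[OF inj] smult_monom)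
      then have "coeff (\<Sum>j<?n. monom (a (monom 1 j)) j) i = 0" by simp
      then show "a (monom 1 i) = 0" using i by (simp add: coeff_sum if_distrib cong: if_cong)
  qed
  have span: "x \<in> S" if S: "Dp.param_subspace S" "?B \<subseteq> S" and x: "x \<in> G" for S x
    proof (cases "x = 0")
      case True then show ?thesis using S by (simp add: Dp.param_subspace_def)
    next
      case False
      then have deg: "degree x < ?n" using x by (simp add: G_def)
      have "Polynomial.smult (coeff x i) (monom 1 i) \<in> S" if "i \<le> degree x" for i
      proof -
        have "monom 1 i \<in> S" using S(2) that deg by auto
        then show ?thesis using S(1) unfolding Dp.param_subspace_def by blast
      qed
      then have "sum (\<lambda>i. monom (coeff x i) i) A \<in> S" if "A \<subseteq> {..degree x}" for A
        using that S(1) unfolding Dp.param_subspace_def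
          by (induction A rule: infinite_finite_induct) (auto simp: smult_monom)
      then have "(\<Sum>i\<le>degree x. monom (coeff x i) i) \<in> S" by blast
      then show ?thesis by (simp add: poly_as_sum_of_monoms)
    qed
  have "finite ?B" by simp
  note dim = Dp.dim_eq_card[OF this BG inj0 indep span]
  then show "vectorspace.fin_dim class_ring DL" "vectorspace.dim class_ring DL = ?n"
    by (simp_all add: card_image[OF inj])
qed

context
  fixes c :: 'a
  assumes qc: "q = [:c:]"
begin

lemma c_nonzero: "c \<noteq> 0" using q_nonzero qc by auto
lemma q_unit: "q dvd x"
  by (rule unit_imp_dvd) (use qc c_nonzero in \<open>simp add: is_unit_iff_degree\<close>)

lemma pi_q_eq_1: "pi_poly q = 1"
proof -
  have "pi_poly q dvd 1" using dvd_pderiv_mult_iff[OF q_nonzero, of 1] by (simp add: qc)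
  then have "degree (pi_poly q) = 0" using pi_poly_nonzero[OF q_nonzero]
    by (simp add: is_unit_iff_degree)
  then obtain a where "pi_poly q = [:a:]" by (rule degree_eq_zeroE)
  then show ?thesis using lead_coeff_pi_poly[OF q_nonzero] by (simp add: one_pCons)
qed

lemma calN_zero: "calN h = {\<zero>\<^bsub>L\<^esub>}"
proof -
  have "\<Theta> n = \<zero>\<^bsub>L\<^esub>" if "n \<in> Nf \<pi>q" for n
    using that Nf_subset_Ac[OF q_unit] \<Theta>_eq_0_iff Ac_subset_Mc by blast
  moreover have "\<zero>\<^bsub>L\<^esub> \<in> \<Theta> ` Nf \<pi>q" using HHp.\<delta>_0 Nf_0 by (metis imageI)
  ultimately show ?thesis unfolding calN_eq by blast
qed

lemma degree_pi: "degree (pi_poly h) = degree h"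
  using arg_cong[OF h_eq, of degree] c_nonzero by (simp add: qc)

definition g0 :: "'k poly \<Rightarrow> 'a poly" where "g0 p = (SOME g. H * d (coeff p 0) = \<iota> g)"

lemma g0: "p \<in> Mc \<Longrightarrow> H * d (coeff p 0) = \<iota> (g0 p)"
  unfolding g0_def by (rule someI_ex) (auto simp: Mc_def R_def)

lemma g0_eqI: "p \<in> Mc \<Longrightarrow> H * d (coeff p 0) = \<iota> g \<Longrightarrow> g0 p = g"
  using g0[of p] by (simp add: \<iota>_eq_iff)

text \<open>
  A derivation \<open>D\<^sub>g\<close> is inner exactly if \<open>h dvd g\<close>, because polynomials have polynomial
  antiderivatives; and for constant \<open>q\<close> every class is the class of some \<open>D\<^sub>g\<close>.
\<close>

lemma \<Theta>_eq_iff_g0: assumes p: "p \<in> Mc" and s: "s \<in> Mc" shows "\<Theta> p = \<Theta> s \<longleftrightarrow> g0 p mod h = g0 s mod h"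
proof -
  have ps: "p - s \<in> Mc" using p s by (rule Mc_diff)
  have eq: "H * d (coeff (p - s) 0) = \<iota> (g0 p - g0 s)" using g0[OF p] g0[OF s]
    by (simp add: d_diff right_diff_distrib \<iota>_diff)
  have "p - s \<in> Ac \<longleftrightarrow> h dvd g0 p - g0 s"
  proof
    assume "p - s \<in> Ac"
    then obtain t where "coeff (p - s) 0 = \<iota> t" by (auto simp: Ac_def R_def)
    then have "\<iota> (g0 p - g0 s) = \<iota> (h * pderiv t)" using eq by (simp add: d_\<iota> H_def \<iota>_mult)
    then have "g0 p - g0 s = h * pderiv t" by (simp add: \<iota>_eq_iff)
    then show "h dvd g0 p - g0 s" by simp
  next
    assume "h dvd g0 p - g0 s"
    then obtain t where t: "g0 p - g0 s = h * t" by blast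
    obtain t1 where t1: "pderiv t1 = t" using ex_pderiv_eq by metis
    have "H * d (coeff (p - s) 0 - \<iota> t1) = 0" using eq
      by (simp add: t d_diff d_\<iota> t1 right_diff_distrib \<iota>_mult H_def)
    then have "d (coeff (p - s) 0 - \<iota> t1) = 0" using H_nonzero by simp
    then obtain k where "coeff (p - s) 0 - \<iota> t1 = \<iota> [:k:]" using d_eq_0 by blast
    then have "coeff (p - s) 0 = \<iota> (t1 + [:k:])" by (simp only: \<iota>_add diff_eq_eq add.commute)
    then have 0: "coeff (p - s) 0 \<in> R" by simp
    have "coeff (p - s) n \<in> R" for n
      using 0 Mc_eq_Zc_if_q_const[OF qc ps] by (cases n) (auto simp: Zc_def simp del: coeff_diff)
    then show "p - s \<in> Ac" unfolding Ac_def by blast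
  qed
  then show ?thesis by (simp add: \<Theta>_eq_iff[OF p s] mod_eq_dvd_iff)
qed

definition iso :: "((Ah_gen, 'a) free_alg set \<Rightarrow> (Ah_gen, 'a) free_alg set) set \<Rightarrow> (Ah_gen,
    'a) free_alg set \<Rightarrow> (Ah_gen, 'a) free_alg set" where
  "iso u = D_der h (g0 (SOME p. p \<in> Mc \<and> \<Theta> p = u) mod h)"

lemma iso_\<Theta>: assumes p: "p \<in> Mc" shows "iso (\<Theta> p) = D_der h (g0 p mod h)"
proof -
  let ?p = "SOME s. s \<in> Mc \<and> \<Theta> s = \<Theta> p"
  have "?p \<in> Mc \<and> \<Theta> ?p = \<Theta> p" by (rule someI[of _ p]) (simp add: p)
  then show ?thesis using \<Theta>_eq_iff_g0[of ?p p] p by (simp add: iso_def)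
qed

lemma mod_h_in_G: "g mod h \<in> G"
  using degree_mod_less[OF h_nonzero, of g] by (auto simp: G_def degree_pi)

lemma lie_isomorphic_D: "lie_isomorphic L DL"
  unfolding lie_isomorphic_def
proof (intro bexI conjI ballI)
  have add: "iso (\<Theta> p \<oplus>\<^bsub>L\<^esub> \<Theta> s) = iso (\<Theta> p) \<oplus>\<^bsub>DL\<^esub> iso (\<Theta> s)" if "p \<in> Mc" "s \<in> Mc" for p s
  proof -
    have "g0 (p + s) = g0 p + g0 s" using that g0[OF that(1)] g0[OF that(2)]
      by (intro g0_eqI) (simp_all add: Mc_add d_add distrib_left \<iota>_add)
    then show ?thesis using that
      by (simp add: HHp.\<delta>_add[symmetric] iso_\<Theta> Mc_add poly_mod_add_left D_der_add)
  qed
  have sc: "iso (a \<odot>\<^bsub>L\<^esub> \<Theta> p) = a \<odot>\<^bsub>DL\<^esub> iso (\<Theta> p)" if "p \<in> Mc" for p a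
  proof -
    have "\<iota> (Polynomial.smult a g) = \<iota> [:a:] * \<iota> g" for g by (simp add: \<iota>_mult[symmetric])
    then have "g0 (Polynomial.smult (\<iota> [:a:]) p) = Polynomial.smult a (g0 p)"
      using that g0[OF that] HHp.M_sc[OF that, of a]
      by (intro g0_eqI) (simp_all add: d_mult d_const mult.left_commute[of H])
    then show ?thesis using that HHp.M_sc[OF that, of a]
      by (simp add: HHp.\<delta>_sc[symmetric] iso_\<Theta> mod_smult_left D_der_sc)
  qed
  have cl: "iso (\<Theta> p) \<in> carrier DL" if "p \<in> Mc" for p
    using that mod_h_in_G by (simp add: iso_\<Theta> D_space_eq)
  show "iso \<in> LinearCombinations.module_hom class_ring L DL"
    unfolding LinearCombinations.module_hom_def HHp.carrier_eq using add sc cl by blast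
  show "bij_betw iso (carrier L) (carrier DL)"
    unfolding bij_betw_def
  proof
    show "inj_on iso (carrier L)"
    proof (rule inj_onI)
      fix u v assume "u \<in> carrier L" "v \<in> carrier L" and eq: "iso u = iso v"
      then obtain p s where ps: "p \<in> Mc" "u = \<Theta> p" "s \<in> Mc" "v = \<Theta> s" unfolding HHp.carrier_eq by blast
      then have "D_der h (g0 p mod h) = D_der h (g0 s mod h)" using eq by (simp add: iso_\<Theta>)
      then have "D_der h (g0 p mod h - g0 s mod h) = \<zero>\<^bsub>Der (Ah h)\<^esub>"
        using Dp.\<delta>_eq_iff[OF mod_h_in_G mod_h_in_G] by simp
      then have "g0 p mod h - g0 s mod h = 0" by (rule D_der_inj)
      then show "u = v" using ps \<Theta>_eq_iff_g0 by simp
    qed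
    have "D_der h g \<in> iso ` carrier L" if g: "g \<in> G" for g
    proof -
      obtain w where w: "H * d w = \<iota> g" using antiderivative[of g] by (auto simp: H_def)
      have wM: "[:w:] \<in> Mc" by (rule const_in_Mc) (simp add: w)
      have "g0 [:w:] = g" by (rule g0_eqI[OF wM]) (simp add: w)
      moreover have "g mod h = g" using g by (auto simp: G_def degree_pi intro: mod_poly_less)
      ultimately have "iso (\<Theta> [:w:]) = D_der h g" by (simp add: iso_\<Theta>[OF wM])
      then show ?thesis using HHp.\<delta>_closed[OF wM] by (metis imageI)
    qed
    then show "iso ` carrier L = carrier DL" using cl unfolding HHp.carrier_eq
      by (auto simp: D_space_eq)
  qed
  fix u v assume "u \<in> carrier L" "v \<in> carrier L"
  then obtain p s where ps: "p \<in> Mc" "u = \<Theta> p" "s \<in> Mc" "v = \<Theta> s" unfolding HHp.carrier_eq by blast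
  have "PB p s \<in> Ac" by (rule Zc_PB(1)[OF Mc_eq_Zc_if_q_const[OF qc ps(1)] ps(3)])
  then have "u \<otimes>\<^bsub>L\<^esub> v = \<Theta> 0" using ps \<Theta>_eq_0_iff[OF PB_in_Mc[OF ps(1,3)]]
    by (simp add: HHp.\<delta>_pr[symmetric] HHp.\<delta>_0)
  moreover have "g0 0 = 0" by (rule g0_eqI) simp_all
  ultimately have "iso (u \<otimes>\<^bsub>L\<^esub> v) = \<zero>\<^bsub>Der (Ah h)\<^esub>" by (simp add: iso_\<Theta> D_der_0)
  then show "iso (u \<otimes>\<^bsub>L\<^esub> v) = iso u \<otimes>\<^bsub>DL\<^esub> iso v" using ps by (simp add: iso_\<Theta> D_der_bracket)
qed

end

theorem HH1_structure:
  "let H = HH1 (Ah h); Z = lie_center H; N = calN h; D = (Der (Ah h))\<lparr>carrier := D_space h\<rparr> in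
     (Z \<inter> N = {\<zero>\<^bsub>H\<^esub>} \<and>
      maximal_nilpotent_ideal H (Z <+>\<^bsub>H\<^esub> N) \<and>
      (\<forall>I. maximal_nilpotent_ideal H I \<longrightarrow> I = Z <+>\<^bsub>H\<^esub> N)) \<and>
     (lie_nilpotent H (carrier H) \<longleftrightarrow> (\<exists>c. c \<noteq> 0 \<and> h div pi_poly h = [:c:])) \<and>
     ((\<exists>c. c \<noteq> 0 \<and> h div pi_poly h = [:c:]) \<longrightarrow>
        pi_poly (h div pi_poly h) = 1 \<and>
        lie_commutator H (carrier H) (carrier H) = {\<zero>\<^bsub>H\<^esub>} \<and> N = {\<zero>\<^bsub>H\<^esub>} \<and>
        degree (pi_poly h) = degree h \<and>
        lie_subalgebra (Der (Ah h)) (D_space h) \<and> lie_isomorphic H D \<and> lie_abelian D \<and>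
        vectorspace.fin_dim class_ring D \<and> vectorspace.dim class_ring D = degree h)"
  unfolding Let_def q_def[symmetric]
proof (intro conjI allI impI)
  assume "\<exists>c. c \<noteq> 0 \<and> q = [:c:]"
  then obtain c where qc: "q = [:c:]" by blast
  show "pi_poly q = 1" by (rule pi_q_eq_1[OF qc])
  show "lie_commutator L (carrier L) (carrier L) = {\<zero>\<^bsub>L\<^esub>}" by (rule commutator_zero_if_q_const[OF qc])
  show "calN h = {\<zero>\<^bsub>L\<^esub>}" by (rule calN_zero[OF qc])
  show "degree (pi_poly h) = degree h" by (rule degree_pi[OF qc])
  show "lie_isomorphic L DL" by (rule lie_isomorphic_D[OF qc])
  show "vectorspace.dim class_ring DL = degree h" using dim_D(2) degree_pi[OF qc] by simp
qed (rule largest_nilpotent_ideal nilpotent_iff_q_const lie_subalgebra_D lie_abelian_D dim_D; assumption?)+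

end

section \<open>Differential operators on Laurent series\<close>

text \<open>
  The additive maps of an abelian group form the ring in which the differential operators live.
\<close>

typedef (overloaded) 'b endo = "{f :: 'b \<Rightarrow> 'b::ab_group_add. \<forall>x y. f (x + y) = f x + f y}"
  by (rule exI[of _ "\<lambda>_. 0"]) simp

lemma Rep_endo_add: "Rep_endo f (x + y) = Rep_endo f x + Rep_endo f y"
  using Rep_endo[of f] by simp
lemma Rep_Abs_endo: "(\<And>x y. f (x + y) = f x + f y) \<Longrightarrow> Rep_endo (Abs_endo f) = f"
  by (rule Abs_endo_inverse) simp
lemma endo_eqI: "(\<And>x. Rep_endo f x = Rep_endo g x) \<Longrightarrow> f = g"
  by (metis Rep_endo_inject ext)

instantiation endo :: ("{ab_group_add, zero_neq_one}") ring_1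
begin
definition zero_endo :: "'a endo" where "0 = Abs_endo (\<lambda>_. 0)"
definition one_endo :: "'a endo" where "1 = Abs_endo (\<lambda>x. x)"
definition plus_endo :: "'a endo \<Rightarrow> 'a endo \<Rightarrow> 'a endo" where "f + g
    = Abs_endo (\<lambda>x. Rep_endo f x + Rep_endo g x)"
definition uminus_endo :: "'a endo \<Rightarrow> 'a endo" where "- f = Abs_endo (\<lambda>x. - Rep_endo f x)"
definition minus_endo :: "'a endo \<Rightarrow> 'a endo \<Rightarrow> 'a endo" where "f - g
    = Abs_endo (\<lambda>x. Rep_endo f x - Rep_endo g x)"
definition times_endo :: "'a endo \<Rightarrow> 'a endo \<Rightarrow> 'a endo" where "f * g
    = Abs_endo (\<lambda>x. Rep_endo f (Rep_endo g x))"

lemma Rep_endo_simps: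
  "Rep_endo 0 x = (0 :: 'a)" "Rep_endo 1 x = (x :: 'a)" "Rep_endo (f + g) x
      = Rep_endo f x + (Rep_endo g x :: 'a)"
  "Rep_endo (- f) x = - (Rep_endo f x :: 'a)" "Rep_endo (f - g) x = Rep_endo f x - (Rep_endo g x :: 'a)"
  "Rep_endo (f * g) x = Rep_endo f (Rep_endo g x :: 'a)"
  unfolding zero_endo_def one_endo_def plus_endo_def uminus_endo_def minus_endo_def times_endo_def
  by (subst Rep_Abs_endo; simp add: Rep_endo_add algebra_simps)+

instance
proof
  show "(0 :: 'a endo) \<noteq> 1" using Rep_endo_simps(1,2)[of 1] by (metis zero_neq_one)
qed (auto intro!: endo_eqI simp: Rep_endo_simps Rep_endo_add algebra_simps)
end

text \<open>
  The variable is sent to \<open>c + X\<close> with \<open>h(c) \<noteq> 0\<close>. Then \<open>h\<close> is an invertible power series, so \<open>g/h\<close> is a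
  power series and can be integrated termwise.
\<close>

lemma ex_weyl_calculus:
  fixes h :: "'a::field_char_0 poly"
  assumes "h \<noteq> 0"
  obtains d :: "'a fls \<Rightarrow> 'a fls" and \<iota> and \<mu> :: "'a fls \<Rightarrow> 'a fls endo" and dy
  where "weyl_calculus d \<iota> \<mu> dy h"
proof -
  have "finite {x. poly h x = 0}" using assms by (rule poly_roots_finite)
  then obtain c where c: "poly h c \<noteq> 0" using ex_new_if_finite[OF infinite_UNIV_char_0] by blast
  define \<phi> where "\<phi> p = fps_of_poly (pcompose p [:c, 1:])" for p
  define \<iota> where "\<iota> p = fps_to_fls (\<phi> p)" for p
  define \<mu> where "\<mu> f = Abs_endo (\<lambda>x. f * x)" for f :: "'a fls"
  define dy where "dy = Abs_endo (fls_deriv :: 'a fls \<Rightarrow> 'a fls)"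
  have Rep_\<mu>: "Rep_endo (\<mu> f) x = f * x" for f x unfolding \<mu>_def
    by (subst Rep_Abs_endo) (simp_all add: distrib_left)
  have Rep_dy: "Rep_endo dy x = fls_deriv x" for x unfolding dy_def by (subst Rep_Abs_endo) simp_all
  have \<phi>_deriv: "fps_deriv (\<phi> p) = \<phi> (pderiv p)" for p
    unfolding \<phi>_def by (simp add: fps_of_poly_pderiv[symmetric] pderiv_pcompose pderiv_pCons)
  have h0: "fps_nth (\<phi> h) 0 \<noteq> 0" using c by (simp add: \<phi>_def coeff_pcompose_0)
  have "weyl_calculus fls_deriv \<iota> \<mu> dy h"
  proof
    fix p q :: "'a poly"
    show "\<iota> (p + q) = \<iota> p + \<iota> q" by (simp add: \<iota>_def \<phi>_def pcompose_add fps_of_poly_add)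
    show "\<iota> (p * q) = \<iota> p * \<iota> q"
      by (simp add: \<iota>_def \<phi>_def pcompose_mult fps_of_poly_mult fls_times_fps_to_fls)
    show "\<iota> 1 = 1" by (simp add: \<iota>_def \<phi>_def pcompose_1)
    show "p = 0" if "\<iota> p = 0"
    proof -
      have "fps_of_poly (pcompose p [:c, 1:]) = 0" using that by (simp add: \<iota>_def \<phi>_def)
      then have "pcompose p [:c, 1:] = 0" by (metis fps_of_poly_0 fps_of_poly_eq_iff)
      then show ?thesis by (simp add: pcompose_eq_0)
    qed
    show "fls_deriv (\<iota> p) = \<iota> (pderiv p)" by (simp add: \<iota>_def fls_deriv_fps_to_fls \<phi>_deriv)
  next
    fix g
    define w where "w = fps_to_fls (fps_integral0 (\<phi> g * inverse (\<phi> h)))"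
    have "\<iota> h * fls_deriv w = fps_to_fls (\<phi> h * (\<phi> g * inverse (\<phi> h)))"
      by (simp add: w_def \<iota>_def fls_deriv_fps_to_fls fls_times_fps_to_fls fps_deriv_fps_integral)
    also have "\<phi> h * (\<phi> g * inverse (\<phi> h)) = \<phi> g * (inverse (\<phi> h) * \<phi> h)" by (simp add: mult_ac)
    also have "\<dots> = \<phi> g" using inverse_mult_eq_1[OF h0] by simp
    finally show "\<exists>w. \<iota> h * fls_deriv w = \<iota> g" by (auto simp: \<iota>_def)
  next
    fix w :: "'a fls" assume "fls_deriv w = 0"
    then have "w = fls_const (fls_nth w 0)" by (simp add: fls_deriv_eq_0_iff)
    also have "\<dots> = \<iota> [:fls_nth w 0:]" by (simp add: \<iota>_def \<phi>_def fps_of_poly_const)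
    finally show "\<exists>c. w = \<iota> [:c:]" by blast
  next
    fix x :: "'a fls" assume "\<mu> x = 0"
    then have "Rep_endo (\<mu> x) 1 = Rep_endo 0 1" by simp
    then show "x = 0" by (simp add: Rep_\<mu> Rep_endo_simps)
  qed (auto intro!: endo_eqI simp: Rep_\<mu> Rep_dy Rep_endo_simps assms algebra_simps)
  then show thesis by (rule that)
qed

theorem corollary5p25:
  fixes h :: "'a::field_char_0 poly"
  assumes "h \<noteq> 0"
  shows
    "let H = HH1 (Ah h); Z = lie_center H; N = calN h; D = (Der (Ah h))\<lparr>carrier := D_space h\<rparr> in
     (Z \<inter> N = {\<zero>\<^bsub>H\<^esub>} \<and>
      maximal_nilpotent_ideal H (Z <+>\<^bsub>H\<^esub> N) \<and>
      (\<forall>I. maximal_nilpotent_ideal H I \<longrightarrow> I = Z <+>\<^bsub>H\<^esub> N)) \<and>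
     (lie_nilpotent H (carrier H) \<longleftrightarrow> (\<exists>c. c \<noteq> 0 \<and> h div pi_poly h = [:c:])) \<and>
     ((\<exists>c. c \<noteq> 0 \<and> h div pi_poly h = [:c:]) \<longrightarrow>
        pi_poly (h div pi_poly h) = 1 \<and>
        lie_commutator H (carrier H) (carrier H) = {\<zero>\<^bsub>H\<^esub>} \<and> N = {\<zero>\<^bsub>H\<^esub>} \<and>
        degree (pi_poly h) = degree h \<and>
        lie_subalgebra (Der (Ah h)) (D_space h) \<and> lie_isomorphic H D \<and> lie_abelian D \<and>
        vectorspace.fin_dim class_ring D \<and> vectorspace.dim class_ring D = degree h)"
proof -
  obtain d :: "'a fls \<Rightarrow> 'a fls" and \<iota> and \<mu> :: "'a fls \<Rightarrow> 'a fls endo" and dy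
    where w: "weyl_calculus d \<iota> \<mu> dy h" using ex_weyl_calculus[OF assms] .
  show ?thesis by (rule weyl_calculus.HH1_structure[OF w])
qed

end
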